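(* Let $n\geq 2$ and let $\Omega$ be a bounded domain in $\mathbb{R}^n$ with $C^{6+\epsilon}$ boundary. Suppose that the overdetermined problem $$\Delta^3 u=-1 \ \text{in } \Omega,\qquad u=\frac{\partial u}{\partial \nu}=\Delta u=0 \ \text{on } \partial\Omega,\qquad \frac{\partial (\Delta u)}{\partial \nu}= c \ \text{on } \partial\Omega,$$ where $c$ is a constant, has a solution $u\in C^6(\overline{\Omega})$. When $n\geq 3$, assume in addition that $$\int_{\Omega} (\Delta^2u)^2\gamma\, dx\leq \frac{2(n+2)c^2|\Omega|}{n+6},$$ where $|\Omega|$ is the volume of $\Omega$ and $\gamma$ is the torsion function of $\Omega$, i.e. the solution of $\Delta\gamma=-1$ in $\Omega$, $\gamma=0$ on $\partial\Omega$. Then $\Omega$ is a ball of radius $\left(|c|n(n+2)(n+4)\right)^{1/3}$, and $$u(x) = -\frac{1}{48n(n+2)(n+4)}r^6 +\left(\frac{c^2}{n(n+2)(n+4)}\right)^{1/3}\frac{r^4}{16} -\left(c^4n(n+2)(n+4)\right)^{1/3}\frac{r^2}{16}+\frac{c^2n(n+2)(n+4)}{48},$$ where $r$ denotes the distance from $x$ to the center of $\Omega$.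
   Context: $\nu$ denotes the outward unit normal of $\partial\Omega$. *)

theory Defs
  imports "HOL-Analysis.Analysis"
begin

definition dir_deriv :: "('a::euclidean_space \<Rightarrow> real) \<Rightarrow> 'a \<Rightarrow> 'a \<Rightarrow> real" where
  "dir_deriv f v x = frechet_derivative f (at x) v"

fun iter_deriv :: "'a::euclidean_space list \<Rightarrow> ('a \<Rightarrow> real) \<Rightarrow> 'a \<Rightarrow> real" where
  "iter_deriv [] f = f"
| "iter_deriv (v # vs) f = dir_deriv (iter_deriv vs f) v"

definition grad :: "('a::euclidean_space \<Rightarrow> real) \<Rightarrow> 'a \<Rightarrow> 'a" where
  "grad f x = (\<Sum>i\<in>Basis. dir_deriv f i x *\<^sub>R i)"

definition laplacian :: "('a::euclidean_space \<Rightarrow> real) \<Rightarrow> 'a \<Rightarrow> real" where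
  "laplacian f x = (\<Sum>i\<in>Basis. dir_deriv (dir_deriv f i) i x)"

definition Ck_on :: "nat \<Rightarrow> 'a::euclidean_space set \<Rightarrow> ('a \<Rightarrow> real) \<Rightarrow> bool" where
  "Ck_on k S f \<longleftrightarrow>
     (\<forall>vs. length vs < k \<longrightarrow> set vs \<subseteq> Basis \<longrightarrow> (\<forall>x\<in>S. iter_deriv vs f differentiable (at x))) \<and>
     (\<forall>vs. length vs \<le> k \<longrightarrow> set vs \<subseteq> Basis \<longrightarrow> continuous_on S (iter_deriv vs f))"

definition Ck_closure :: "nat \<Rightarrow> 'a::euclidean_space set \<Rightarrow> ('a \<Rightarrow> real) \<Rightarrow> bool" where
  "Ck_closure k S f \<longleftrightarrow> Ck_on k S f \<and> continuous_on (closure S) f \<and>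
     (\<forall>vs. length vs \<le> k \<longrightarrow> set vs \<subseteq> Basis \<longrightarrow>
        (\<exists>g. continuous_on (closure S) g \<and> (\<forall>x\<in>S. g x = iter_deriv vs f x)))"

definition Ck_holder_on :: "nat \<Rightarrow> real \<Rightarrow> 'a::euclidean_space set \<Rightarrow> ('a \<Rightarrow> real) \<Rightarrow> bool" where
  "Ck_holder_on k e S f \<longleftrightarrow> Ck_on k S f \<and>
     (\<exists>M. \<forall>vs. length vs = k \<longrightarrow> set vs \<subseteq> Basis \<longrightarrow>
        (\<forall>x\<in>S. \<forall>y\<in>S. \<bar>iter_deriv vs f x - iter_deriv vs f y\<bar> \<le> M * dist x y powr e))"

definition local_defining_fun :: "'a::euclidean_space set \<Rightarrow> 'a \<Rightarrow> real \<Rightarrow> ('a \<Rightarrow> real) \<Rightarrow> bool" where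
  "local_defining_fun \<Omega> p r \<phi> \<longleftrightarrow> 0 < r \<and> Ck_on 1 (ball p r) \<phi> \<and>
     (\<forall>x\<in>ball p r. grad \<phi> x \<noteq> 0) \<and> \<Omega> \<inter> ball p r = {x\<in>ball p r. \<phi> x < 0}"

definition Ck_eps_boundary :: "nat \<Rightarrow> real \<Rightarrow> 'a::euclidean_space set \<Rightarrow> bool" where
  "Ck_eps_boundary k e \<Omega> \<longleftrightarrow> (\<forall>p\<in>frontier \<Omega>. \<exists>r \<phi>.
      local_defining_fun \<Omega> p r \<phi> \<and> Ck_holder_on k e (ball p r) \<phi>)"

text \<open>Outward unit normal at a boundary point p (independent of the chosen defining function).\<close>
definition outward_normal :: "'a::euclidean_space set \<Rightarrow> 'a \<Rightarrow> 'a" where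
  "outward_normal \<Omega> p = (SOME v. \<exists>r \<phi>. local_defining_fun \<Omega> p r \<phi> \<and>
                                  v = grad \<phi> p /\<^sub>R norm (grad \<phi> p))"

definition bval :: "'a::euclidean_space set \<Rightarrow> ('a \<Rightarrow> real) \<Rightarrow> 'a \<Rightarrow> real" where
  "bval \<Omega> h p = Lim (at p within \<Omega>) h"

definition normal_deriv :: "'a::euclidean_space set \<Rightarrow> ('a \<Rightarrow> real) \<Rightarrow> 'a \<Rightarrow> real" where
  "normal_deriv \<Omega> f p =
     (\<Sum>i\<in>Basis. bval \<Omega> (dir_deriv f i) p *\<^sub>R i) \<bullet> outward_normal \<Omega> p"

definition torsion_function :: "'a::euclidean_space set \<Rightarrow> ('a \<Rightarrow> real) \<Rightarrow> bool" where
  "torsion_function \<Omega> \<gamma> \<longleftrightarrow> Ck_on 2 \<Omega> \<gamma> \<and> continuous_on (closure \<Omega>) \<gamma> \<and>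
     (\<forall>x\<in>\<Omega>. laplacian \<gamma> x = -1) \<and> (\<forall>x\<in>frontier \<Omega>. \<gamma> x = 0)"

end

theory Submission
  imports Defs
begin

text \<open>Write \<open>v = \<Delta>u\<close>, \<open>w = \<Delta>\<^sup>2u\<close>.  The boundary conditions force \<open>\<nabla>u = 0\<close>, \<open>D\<^sup>2u = 0\<close> and
  \<open>D\<^sup>3u = c \<nu> \<otimes> \<nu> \<otimes> \<nu>\<close> on the boundary, so with \<open>\<beta> = (n - 8) / (2 (n + 4))\<close> the function
  \<open>P = |D\<^sup>3u|\<^sup>2 - D\<^sup>2u : D\<^sup>2v + \<nabla>u \<cdot> \<nabla>w / 2 + \<beta> |\<nabla>v|\<^sup>2 - (1/4 + \<beta>) (v w + u)\<close> equals \<open>c\<^sup>2 (1 + \<beta>)\<close> there.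
  Moreover \<open>\<Delta>P = 2 |H|\<^sup>2 - \<kappa> w\<^sup>2\<close>, where \<open>H\<close> is the trace-free part of \<open>D\<^sup>4u\<close> and \<open>\<kappa>\<close> is a nonnegative constant
  that vanishes exactly for \<open>n = 2\<close>.  A Pohozaev identity evaluates the integral of \<open>P\<close>.  Testing with the torsion
  function for \<open>n \<ge> 3\<close>, or using the maximum principle for \<open>n = 2\<close>, gives \<open>H = 0\<close>.  Then \<open>D\<^sup>2w = - I / n\<close>, so \<open>w\<close> is
  radial; the angular derivatives of \<open>u\<close> are biharmonic with zero Dirichlet data, so \<open>v\<close> is radial too, and in fact a
  quadratic polynomial in \<open>|x - x\<^sub>0|\<^sup>2\<close>.  The values of \<open>v\<close> and \<open>|\<nabla>v|\<close> on the boundary determine \<open>|x - x\<^sub>0|\<close>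
  there, and the Dirichlet problem on the resulting ball is solved by \<open>(R\<^sup>2 - |x - x\<^sub>0|\<^sup>2)\<^sup>3 / (48 n (n + 2) (n + 4))\<close>.\<close>

section \<open>Functions that are C0 or C1 up to the boundary\<close>

text \<open>The identity for \<Delta>P can only be had weakly. Since u is C6, w is C2, and P
  contains \<nabla>w, so \<nabla>P need not be differentiable; each use of \<Delta>P is an integral
  against a compactly supported test function. Boundary terms are never computed: every integration
  by parts concerns a field that vanishes on the frontier. The bound assumed for n \<ge> 3 is the
  value at which the argument closes. Put Q = c^2 (1 + \<beta>) - P, which vanishes on the boundary.
  Testing with \<gamma>, where \<Delta>\<gamma> = -1, shows that \<gamma> (2 |H|^2 - \<kappa> w^2)
  and Q have the same integral, and the Pohozaev identity evaluates the latter as -\<kappa> times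
  exactly that bound. So 2 \<gamma> |H|^2 has as integral \<kappa> times the excess of the integral
  of \<gamma> w^2 over the bound, which is \<le> 0. For n = 2, where \<kappa> = 0, P is weakly
  subharmonic, so Q \<ge> 0, while Q has integral zero. Of \<gamma> only continuity is known up to
  the boundary, so \<nabla>\<gamma> might be unbounded. Hence \<gamma> enters truncated, and the
  truncation level is sent to zero at the end.\<close>

definition C0bar :: "'a::euclidean_space set \<Rightarrow> ('a \<Rightarrow> real) \<Rightarrow> bool" where
  "C0bar S f \<longleftrightarrow> (\<exists>g. continuous_on (closure S) g \<and> (\<forall>x\<in>S. g x = f x))"

definition C1bar :: "'a::euclidean_space set \<Rightarrow> ('a \<Rightarrow> real) \<Rightarrow> bool" where
  "C1bar S f \<longleftrightarrow> C0bar S f \<and> (\<forall>x\<in>S. f differentiable (at x)) \<and> (\<forall>i\<in>Basis. C0bar S (dir_deriv f i))"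

text \<open>Boundary values are limits from inside, and \<open>C0bar\<close> speaks of some
  continuous extension, because derivatives computed by \<open>dir_deriv\<close> carry no reliable
  information at points of the frontier or beyond.\<close>

definition zero_bdry :: "'a::euclidean_space set \<Rightarrow> ('a \<Rightarrow> real) \<Rightarrow> bool" where
  "zero_bdry S f \<longleftrightarrow> (\<forall>p\<in>frontier S. (f \<longlongrightarrow> 0) (at p within S))"

lemma dir_deriv_eqI: "(f has_derivative f') (at x) \<Longrightarrow> dir_deriv f v x = f' v"
  by (metis dir_deriv_def frechet_derivative_at)

lemma has_derivative_dir_deriv:
  "f differentiable (at x) \<Longrightarrow> (f has_derivative (\<lambda>v. dir_deriv f v x)) (at x)"
  by (simp add: dir_deriv_def frechet_derivative_works[symmetric])

lemma dir_deriv_cong: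
  assumes "open S" "x \<in> S" "\<And>y. y \<in> S \<Longrightarrow> f y = g y"
  shows "dir_deriv f v x = dir_deriv g v x"
proof -
  have "(f has_derivative D) (at x) \<longleftrightarrow> (g has_derivative D) (at x)" for D
    using has_derivative_transform_within_open[OF _ assms(1,2)] assms(3) by metis
  then show ?thesis unfolding dir_deriv_def frechet_derivative_def by simp
qed

lemma differentiable_cong_open:
  assumes "open S" "x \<in> S" "\<And>y. y \<in> S \<Longrightarrow> f y = g y" "f differentiable (at x)"
  shows "g differentiable (at x)"
  using has_derivative_transform_within_open[OF _ assms(1,2)] assms(3,4)
  unfolding differentiable_def by metis

lemma dir_deriv_add: "f differentiable (at x) \<Longrightarrow> g differentiable (at x) \<Longrightarrow>
    dir_deriv (\<lambda>x. f x + g x) v x = dir_deriv f v x + dir_deriv g v x"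
  by (rule dir_deriv_eqI) (intro derivative_intros has_derivative_dir_deriv)

lemma dir_deriv_diff: "f differentiable (at x) \<Longrightarrow> g differentiable (at x) \<Longrightarrow>
    dir_deriv (\<lambda>x. f x - g x) v x = dir_deriv f v x - dir_deriv g v x"
  by (rule dir_deriv_eqI) (intro derivative_intros has_derivative_dir_deriv)

lemma dir_deriv_mult: "f differentiable (at x) \<Longrightarrow> g differentiable (at x) \<Longrightarrow>
    dir_deriv (\<lambda>x. f x * g x :: real) v x = f x * dir_deriv g v x + dir_deriv f v x * g x"
  by (rule dir_deriv_eqI) (intro derivative_intros has_derivative_dir_deriv)

lemma dir_deriv_sum: "(\<And>i. i \<in> I \<Longrightarrow> f i differentiable (at x)) \<Longrightarrow>
    dir_deriv (\<lambda>x. \<Sum>i\<in>I. f i x) v x = (\<Sum>i\<in>I. dir_deriv (f i) v x)"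
  by (rule dir_deriv_eqI) (intro derivative_intros has_derivative_dir_deriv)

lemma dir_deriv_const [simp]: "dir_deriv (\<lambda>x. c) v x = 0"
  by (rule dir_deriv_eqI) (intro derivative_intros)

lemma dir_deriv_inner [simp]: "dir_deriv (\<lambda>x. x \<bullet> b) v x = v \<bullet> b"
  by (rule dir_deriv_eqI) (auto intro!: derivative_eq_intros)

lemma dir_deriv_Basis:
  fixes f :: "'a::euclidean_space \<Rightarrow> real"
  assumes "f differentiable (at x)"
  shows "dir_deriv f v x = (\<Sum>i\<in>Basis. (v \<bullet> i) * dir_deriv f i x)"
proof -
  interpret linear "\<lambda>v. dir_deriv f v x"
    using has_derivative_dir_deriv[OF assms] by (rule has_derivative_linear)
  have "dir_deriv f v x = dir_deriv f (\<Sum>i\<in>Basis. (v \<bullet> i) *\<^sub>R i) x"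
    by (simp add: euclidean_representation)
  also have "\<dots> = (\<Sum>i\<in>Basis. (v \<bullet> i) * dir_deriv f i x)"
    by (simp add: sum scale)
  finally show ?thesis .
qed

lemma dir_deriv_line:
  assumes "f differentiable (at (x + t *\<^sub>R d))"
  shows "((\<lambda>t. f (x + t *\<^sub>R d)) has_real_derivative dir_deriv f d (x + t *\<^sub>R d)) (at t)"
proof -
  have "((f \<circ> (\<lambda>t. x + t *\<^sub>R d)) has_derivative (\<lambda>v. dir_deriv f v (x + t *\<^sub>R d)) \<circ> (\<lambda>h. h *\<^sub>R d)) (at t)"
    by (intro diff_chain_at has_derivative_dir_deriv assms) (auto intro!: derivative_eq_intros)
  moreover have "(\<lambda>v. dir_deriv f v (x + t *\<^sub>R d)) \<circ> (\<lambda>h. h *\<^sub>R d) = (*) (dir_deriv f d (x + t *\<^sub>R d))"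
    using linear_scale[OF has_derivative_linear[OF has_derivative_dir_deriv[OF assms]]]
    by (auto simp: fun_eq_iff)
  ultimately show ?thesis by (simp add: has_field_derivative_def comp_def)
qed

lemma C0bar_cong: "C0bar S f \<Longrightarrow> (\<And>x. x \<in> S \<Longrightarrow> g x = f x) \<Longrightarrow> C0bar S g"
  unfolding C0bar_def by metis

lemma C0barI: "continuous_on (closure S) f \<Longrightarrow> C0bar S f"
  unfolding C0bar_def by auto

lemma C0bar_const [simp, intro]: "C0bar S (\<lambda>x. c)"
  by (intro C0barI continuous_intros)

lemma C0bar_inner [simp, intro]: "C0bar S (\<lambda>x. x \<bullet> b)"
  by (intro C0barI continuous_intros)

lemma C0bar_add [intro]: "C0bar S f \<Longrightarrow> C0bar S g \<Longrightarrow> C0bar S (\<lambda>x. f x + g x)"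
  unfolding C0bar_def by (metis (no_types, lifting) continuous_on_add)

lemma C0bar_diff [intro]: "C0bar S f \<Longrightarrow> C0bar S g \<Longrightarrow> C0bar S (\<lambda>x. f x - g x)"
  unfolding C0bar_def by (metis (no_types, lifting) continuous_on_diff)

lemma C0bar_minus [intro]: "C0bar S f \<Longrightarrow> C0bar S (\<lambda>x. - f x)"
  unfolding C0bar_def by (metis (no_types, lifting) continuous_on_minus)

lemma C0bar_mult [intro]: "C0bar S f \<Longrightarrow> C0bar S g \<Longrightarrow> C0bar S (\<lambda>x. f x * g x)"
  unfolding C0bar_def by (metis (no_types, lifting) continuous_on_mult)

lemma C0bar_power [intro]: "C0bar S f \<Longrightarrow> C0bar S (\<lambda>x. f x ^ k)"
  unfolding C0bar_def by (metis (no_types, lifting) continuous_on_power)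

lemma C0bar_sum [intro]: "(\<And>i. i \<in> I \<Longrightarrow> C0bar S (f i)) \<Longrightarrow> C0bar S (\<lambda>x. \<Sum>i\<in>I. f i x)"
  by (induction I rule: infinite_finite_induct) auto

lemma C0bar_continuous_on: "C0bar S f \<Longrightarrow> continuous_on S f"
  unfolding C0bar_def using closure_subset[of S] continuous_on_cong[of S S _ f] continuous_on_subset by blast

lemma C0bar_bounded:
  assumes "bounded S" "C0bar S f"
  obtains M where "0 < M" "\<And>x. x \<in> S \<Longrightarrow> \<bar>f x\<bar> \<le> M"
proof -
  obtain g where g: "continuous_on (closure S) g" "\<And>x. x \<in> S \<Longrightarrow> g x = f x"
    using assms(2) unfolding C0bar_def by auto
  have "bounded (g ` closure S)"
    using assms(1) g(1) by (intro compact_imp_bounded compact_continuous_image) (auto simp: compact_closure)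
  then obtain M where "0 < M" "\<And>y. y \<in> g ` closure S \<Longrightarrow> norm y \<le> M"
    unfolding bounded_pos by auto
  with g(2) show ?thesis using that[of M] closure_subset by fastforce
qed

lemma frontier_within_nontrivial:
  assumes "open S" "p \<in> frontier S"
  shows "at p within S \<noteq> bot"
proof -
  have "p \<in> closure S" "p \<notin> S" using assms(1,2) by (auto simp: frontier_def interior_open)
  then show ?thesis by (simp add: closure_def trivial_limit_within)
qed

lemma C0bar_bval:
  assumes "open S" "p \<in> frontier S" "C0bar S f"
  shows "(f \<longlongrightarrow> bval S f p) (at p within S)"
proof -
  have p: "p \<in> closure S" "p \<notin> S" using assms(1,2) by (auto simp: frontier_def interior_open)
  have nt: "at p within S \<noteq> bot" using assms(1,2) by (rule frontier_within_nontrivial)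
  obtain g where g: "continuous_on (closure S) g" "\<And>x. x \<in> S \<Longrightarrow> g x = f x"
    using assms(3) unfolding C0bar_def by auto
  have "(g \<longlongrightarrow> g p) (at p within S)"
    using g(1) p(1) unfolding continuous_on_def
    using tendsto_within_subset[OF _ closure_subset] by blast
  then have "(f \<longlongrightarrow> g p) (at p within S)"
    by (rule Lim_transform_eventually) (auto simp: eventually_at_filter g(2))
  then show ?thesis using tendsto_Lim[OF nt, of f "g p"] unfolding bval_def by simp
qed

lemma C0bar_absolutely_integrable:
  assumes "open S" "bounded S" "C0bar S f"
  shows "f absolutely_integrable_on S"
proof -
  obtain M where M: "\<And>x. x \<in> S \<Longrightarrow> \<bar>f x\<bar> \<le> M" using C0bar_bounded[OF assms(2,3)] by blast
  have S: "S \<in> lmeasurable" using assms(1,2) lmeasurable_open by auto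
  show ?thesis
  proof (rule measurable_bounded_by_integrable_imp_absolutely_integrable)
    show "f \<in> borel_measurable (lebesgue_on S)"
      using C0bar_continuous_on[OF assms(3)] S
      by (intro continuous_imp_measurable_on_sets_lebesgue) auto
    show "S \<in> sets lebesgue" using S by auto
    show "(\<lambda>x. M) integrable_on S" using S by (simp add: integrable_on_const)
  qed (use M in auto)
qed

lemma C0bar_integrable:
  "open S \<Longrightarrow> bounded S \<Longrightarrow> C0bar S f \<Longrightarrow> f integrable_on S"
  using C0bar_absolutely_integrable set_lebesgue_integral_eq_integral(1) by blast

lemma C1barD:
  assumes "C1bar S f"
  shows "C0bar S f" "\<And>x. x \<in> S \<Longrightarrow> f differentiable (at x)" "\<And>i. i \<in> Basis \<Longrightarrow> C0bar S (dir_deriv f i)"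
  using assms unfolding C1bar_def by auto

lemma C1bar_const [simp, intro]: "C1bar S (\<lambda>x. c)"
  unfolding C1bar_def by (auto intro: C0bar_cong[OF C0bar_const])

lemma C1bar_inner [simp, intro]: "C1bar S (\<lambda>x. x \<bullet> b)"
  unfolding C1bar_def
proof (intro conjI ballI)
  show "C0bar S (dir_deriv (\<lambda>x. x \<bullet> b) i)" for i
    by (rule C0bar_cong[OF C0bar_const[of S "i \<bullet> b"]]) simp
qed (auto simp: bounded_linear_imp_differentiable bounded_linear_inner_left)

lemma C1bar_add [intro]:
  assumes "C1bar S f" "C1bar S g" shows "C1bar S (\<lambda>x. f x + g x)"
  unfolding C1bar_def
proof (intro conjI ballI)
  fix i :: 'a assume "i \<in> Basis"
  then show "C0bar S (dir_deriv (\<lambda>x. f x + g x) i)"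
    using assms by (intro C0bar_cong[OF C0bar_add[OF C1barD(3)[OF assms(1)] C1barD(3)[OF assms(2)]]])
      (auto simp: dir_deriv_add C1barD)
qed (use assms in \<open>auto simp: C1barD\<close>)

lemma C1bar_diff [intro]:
  assumes "C1bar S f" "C1bar S g" shows "C1bar S (\<lambda>x. f x - g x)"
  unfolding C1bar_def
proof (intro conjI ballI)
  fix i :: 'a assume "i \<in> Basis"
  then show "C0bar S (dir_deriv (\<lambda>x. f x - g x) i)"
    using assms by (intro C0bar_cong[OF C0bar_diff[OF C1barD(3)[OF assms(1)] C1barD(3)[OF assms(2)]]])
      (auto simp: dir_deriv_diff C1barD)
qed (use assms in \<open>auto simp: C1barD\<close>)

lemma C1bar_mult [intro]:
  assumes "C1bar S f" "C1bar S g" shows "C1bar S (\<lambda>x. f x * g x)"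
  unfolding C1bar_def
proof (intro conjI ballI)
  fix i :: 'a assume "i \<in> Basis"
  then have "C0bar S (\<lambda>x. f x * dir_deriv g i x + dir_deriv f i x * g x)"
    using assms by (intro C0bar_add C0bar_mult) (auto simp: C1barD)
  then show "C0bar S (dir_deriv (\<lambda>x. f x * g x) i)"
    using assms by (rule_tac C0bar_cong) (auto simp: dir_deriv_mult C1barD)
qed (use assms in \<open>auto simp: C1barD\<close>)

lemma C1bar_sum [intro]: "(\<And>i. i \<in> I \<Longrightarrow> C1bar S (f i)) \<Longrightarrow> C1bar S (\<lambda>x. \<Sum>i\<in>I. f i x)"
  by (induction I rule: infinite_finite_induct) auto

lemma zero_bdry_mult:
  assumes "open S" "zero_bdry S f" "C0bar S g" shows "zero_bdry S (\<lambda>x. f x * g x)"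
  unfolding zero_bdry_def
proof
  fix p assume p: "p \<in> frontier S"
  show "((\<lambda>x. f x * g x) \<longlongrightarrow> 0) (at p within S)"
    using tendsto_mult[OF _ C0bar_bval[OF assms(1) p assms(3)], of f 0] assms(2) p
    by (auto simp: zero_bdry_def)
qed

lemma zero_bdry_mult2:
  assumes "open S" "C0bar S f" "zero_bdry S g" shows "zero_bdry S (\<lambda>x. f x * g x)"
  using zero_bdry_mult[OF assms(1,3,2)] by (simp add: mult.commute)

lemma zero_bdry_add: "zero_bdry S f \<Longrightarrow> zero_bdry S g \<Longrightarrow> zero_bdry S (\<lambda>x. f x + g x)"
  unfolding zero_bdry_def using tendsto_add[of f 0 _ g 0] by fastforce

lemma zero_bdry_diff: "zero_bdry S f \<Longrightarrow> zero_bdry S g \<Longrightarrow> zero_bdry S (\<lambda>x. f x - g x)"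
  unfolding zero_bdry_def using tendsto_diff[of f 0 _ g 0] by fastforce

lemma zero_bdry_const: "zero_bdry S (\<lambda>x. 0)"
  unfolding zero_bdry_def by auto

lemma zero_bdry_sum: "(\<And>i. i \<in> I \<Longrightarrow> zero_bdry S (f i)) \<Longrightarrow> zero_bdry S (\<lambda>x. \<Sum>i\<in>I. f i x)"
  by (induction I rule: infinite_finite_induct) (auto simp: zero_bdry_const intro: zero_bdry_add)

lemma continuous_on_zero_extension:
  fixes f :: "'a::euclidean_space \<Rightarrow> real"
  assumes S: "open S" and f: "C0bar S f" and z: "zero_bdry S f"
  shows "continuous_on UNIV (\<lambda>x. if x \<in> S then f x else 0)" (is "continuous_on UNIV ?f")
proof -
  have "isCont ?f x" for x
  proof -
    consider "x \<in> S" | "x \<in> - closure S" | "x \<in> frontier S"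
      using S by (auto simp: frontier_def interior_open)
    then show ?thesis
    proof cases
      case 1
      have "(f \<longlongrightarrow> f x) (at x)"
        using C0bar_continuous_on[OF f] S 1 continuous_on_eq_continuous_at isCont_def by blast
      then have "(?f \<longlongrightarrow> f x) (at x)"
        by (rule Lim_transform_within_open[OF _ S 1]) simp
      with 1 show ?thesis by (simp add: isCont_def)
    next
      case 2
      then have "x \<notin> S" using closure_subset[of S] by blast
      have "((\<lambda>x. 0::real) \<longlongrightarrow> 0) (at x)" by simp
      then have "(?f \<longlongrightarrow> 0) (at x)"
      proof (rule Lim_transform_within_open[OF _ open_Compl[OF closed_closure] 2])
        show "0 = ?f y" if "y \<in> - closure S" for y
          using that closure_subset[of S] by auto
      qed
      with \<open>x \<notin> S\<close> show ?thesis by (simp add: isCont_def)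
    next
      case 3
      then have nx: "x \<notin> S" using S by (auto simp: frontier_def interior_open)
      have "(f \<longlongrightarrow> 0) (at x within S)" using z 3 unfolding zero_bdry_def by blast
      then have "(?f \<longlongrightarrow> 0) (at x within S)"
        by (rule Lim_transform_eventually) (simp add: eventually_at_filter)
      moreover have "((\<lambda>x. 0::real) \<longlongrightarrow> 0) (at x within -S)" by simp
      then have "(?f \<longlongrightarrow> 0) (at x within -S)"
        by (rule Lim_transform_eventually) (simp add: eventually_at_filter)
      ultimately have "(?f \<longlongrightarrow> 0) (at x within S \<union> - S)"
        by (subst Lim_within_Un) blast
      then show ?thesis using nx unfolding isCont_def Compl_partition by simp
    qed
  qed
  then show ?thesis by (simp add: continuous_at_imp_continuous_on)
qed

text \<open>The part of [a, b] outside W can have any shape, but only its first point s and last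
  point t matter: g vanishes at both, so the mean value theorem is applied on [a, s] and [t, b]
  alone. The intended W is the preimage of a domain under a line, which may leave and re-enter it
  infinitely often.\<close>

lemma lipschitz_of_bounded_deriv_off_zero:
  fixes g :: "real \<Rightarrow> real"
  assumes g: "continuous_on UNIV g" and W: "open W" and off: "\<And>t. t \<notin> W \<Longrightarrow> g t = 0"
    and d: "\<And>t. t \<in> W \<Longrightarrow> (g has_real_derivative g' t) (at t)" and K: "\<And>t. t \<in> W \<Longrightarrow> \<bar>g' t\<bar> \<le> K"
    and K0: "0 \<le> K" and ab: "a \<le> b"
  shows "\<bar>g b - g a\<bar> \<le> K * (b - a)"
proof -
  have seg: "\<bar>g t - g s\<bar> \<le> K * (t - s)" if st: "s \<le> t" "{s<..<t} \<subseteq> W" for s t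
  proof (cases "s = t")
    case False
    then have "s < t" using st by auto
    then obtain z where z: "s < z" "z < t" "g t - g s = (t - s) * g' z"
    proof (rule mvt[of s t g "\<lambda>z h. h * g' z"])
      show "continuous_on {s..t} g" using g continuous_on_subset by blast
      show "(g has_derivative (\<lambda>h. h * g' x)) (at x)" if "s < x" "x < t" for x
      proof -
        have "(*) (g' x) = (\<lambda>h. h * g' x)" by (auto simp: fun_eq_iff)
        moreover have "x \<in> W" using st that by auto
        ultimately show ?thesis using d[of x] by (simp add: has_field_derivative_def)
      qed
    qed auto
    then have "\<bar>g t - g s\<bar> = (t - s) * \<bar>g' z\<bar>" using st by (simp add: abs_mult)
    also have "\<dots> \<le> (t - s) * K" using K[of z] z st by (intro mult_left_mono) auto
    finally show ?thesis by (simp add: mult.commute)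
  qed auto
  show ?thesis
  proof (cases "{a..b} - W = {}")
    case True
    then have "{a<..<b} \<subseteq> W" using greaterThanLessThan_subseteq_atLeastAtMost_iff[of a b a b] by blast
    then show ?thesis by (rule seg[OF ab])
  next
    case False
    let ?C = "{a..b} - W"
    have cp: "compact ?C" using W by (intro compact_diff) auto
    obtain s where s: "s \<in> ?C" "\<And>x. x \<in> ?C \<Longrightarrow> s \<le> x" using compact_attains_inf[OF cp False] by blast
    obtain t where t: "t \<in> ?C" "\<And>x. x \<in> ?C \<Longrightarrow> x \<le> t" using compact_attains_sup[OF cp False] by blast
    have "\<bar>g s - g a\<bar> \<le> K * (s - a)"
    proof (rule seg)
      show "{a<..<s} \<subseteq> W"
      proof
        fix x assume "x \<in> {a<..<s}"
        then show "x \<in> W" using s(1) s(2)[of x] by (cases "x \<in> W") auto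
      qed
    qed (use s in auto)
    moreover have "\<bar>g b - g t\<bar> \<le> K * (b - t)"
    proof (rule seg)
      show "{t<..<b} \<subseteq> W"
      proof
        fix x assume "x \<in> {t<..<b}"
        then show "x \<in> W" using t(1) t(2)[of x] by (cases "x \<in> W") auto
      qed
    qed (use t in auto)
    moreover have "g s = 0" "g t = 0" using s t off by auto
    moreover have "s \<le> t" using s t by auto
    ultimately have "\<bar>g b - g a\<bar> \<le> K * (s - a) + K * (b - t)" by auto
    also have "\<dots> \<le> K * (b - a)"
      using K0 \<open>s \<le> t\<close> mult_left_mono[of s t K] by (simp add: algebra_simps)
    finally show ?thesis .
  qed
qed

lemma zero_extension_lipschitz:
  fixes f :: "'a::euclidean_space \<Rightarrow> real"
  assumes S: "open S" and f: "C0bar S f" and z: "zero_bdry S f"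
    and df: "\<And>x. x \<in> S \<Longrightarrow> f differentiable (at x)"
    and K: "\<And>x. x \<in> S \<Longrightarrow> \<bar>dir_deriv f d x\<bar> \<le> K" and K0: "0 \<le> K" and h: "0 \<le> h"
  defines "f0 \<equiv> (\<lambda>x. if x \<in> S then f x else 0)"
  shows "\<bar>f0 (x + h *\<^sub>R d) - f0 x\<bar> \<le> K * h"
proof -
  let ?W = "(\<lambda>t. x + t *\<^sub>R d) -` S"
  have W: "open ?W" using S by (intro continuous_open_vimage) (auto intro!: continuous_intros)
  have "\<bar>f0 (x + h *\<^sub>R d) - f0 (x + 0 *\<^sub>R d)\<bar> \<le> K * (h - 0)"
  proof (rule lipschitz_of_bounded_deriv_off_zero[OF _ W, where g' = "\<lambda>t. dir_deriv f d (x + t *\<^sub>R d)"])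
    show "continuous_on UNIV (\<lambda>a. f0 (x + a *\<^sub>R d))"
      using continuous_on_compose2[OF continuous_on_zero_extension[OF S f z], of UNIV "\<lambda>a. x + a *\<^sub>R d"]
      by (simp add: f0_def continuous_on_add continuous_on_scaleR)
    show "((\<lambda>a. f0 (x + a *\<^sub>R d)) has_real_derivative dir_deriv f d (x + t *\<^sub>R d)) (at t)" if "t \<in> ?W" for t
      by (rule has_field_derivative_transform_within_open[OF dir_deriv_line[OF df] W])
        (use that in \<open>auto simp: f0_def\<close>)
  qed (use K K0 h in \<open>auto simp: f0_def\<close>)
  then show ?thesis by simp
qed

section \<open>Integration by parts without a trace theorem\<close>

lemma integrable_lborel_translate:
  fixes f :: "'a::euclidean_space \<Rightarrow> real"
  assumes "integrable lborel f"
  shows "integrable lborel (\<lambda>x. f (x + c))" "(\<integral>x. f (x + c) \<partial>lborel) = (\<integral>x. f x \<partial>lborel)"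
proof -
  have f: "f \<in> borel_measurable borel" using assms by auto
  have eq: "lborel = distr lborel borel ((+) c)" by (rule lborel_distr_plus[symmetric])
  have "integrable (distr lborel borel ((+) c)) f" using assms eq by metis
  then have "integrable lborel (\<lambda>x. f (c + x))"
    by (subst (asm) integrable_distr_eq) (use f in auto)
  then show "integrable lborel (\<lambda>x. f (x + c))" by (simp add: add.commute)
  have "(\<integral>x. f x \<partial>lborel) = (\<integral>x. f x \<partial>(distr lborel borel ((+) c)))" using eq by metis
  also have "\<dots> = (\<integral>x. f (c + x) \<partial>lborel)" by (rule integral_distr) (use f in auto)
  finally show "(\<integral>x. f (x + c) \<partial>lborel) = (\<integral>x. f x \<partial>lborel)" by (simp add: add.commute)
qed

lemma C0bar_set_integrable_lborel:
  assumes "open S" "bounded S" "C0bar S f"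
  shows "integrable lborel (\<lambda>x. indicator S x * f x)" "(\<integral>x. indicator S x * f x \<partial>lborel) = integral S f"
proof -
  have 1: "set_integrable lebesgue S f" using C0bar_absolutely_integrable[OF assms] .
  have m: "(\<lambda>x. indicator S x *\<^sub>R f x) \<in> borel_measurable borel"
    using assms(1) C0bar_continuous_on[OF assms(3)] by (intro borel_measurable_continuous_on_indicator) auto
  have 2: "set_integrable lborel S f"
    using 1 m unfolding set_integrable_def by (subst (asm) integrable_completion) auto
  show "integrable lborel (\<lambda>x. indicator S x * f x)" using 2 by (simp add: set_integrable_def)
  show "(\<integral>x. indicator S x * f x \<partial>lborel) = integral S f"
    using set_borel_integral_eq_integral(2)[OF 2] by (simp add: set_lebesgue_integral_def)
qed

lemma difference_quotient_sequence:
  fixes f :: "'a::euclidean_space \<Rightarrow> real"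
  assumes f: "f differentiable (at x)" and h: "\<And>m. h m \<noteq> 0" "h \<longlonglongrightarrow> 0"
  shows "(\<lambda>m. (f (x + h m *\<^sub>R d) - f x) / h m) \<longlonglongrightarrow> dir_deriv f d x"
proof -
  have "((\<lambda>t. f (x + t *\<^sub>R d)) has_real_derivative dir_deriv f d (x + 0 *\<^sub>R d)) (at 0)"
    by (rule dir_deriv_line) (use f in simp)
  then have "((\<lambda>t. (f (x + t *\<^sub>R d) - f x) / t) \<longlongrightarrow> dir_deriv f d x) (at 0)"
    by (simp add: DERIV_def)
  moreover have "filterlim h (at 0) sequentially"
    using h by (simp add: filterlim_at)
  ultimately show ?thesis by (rule filterlim_compose)
qed

text \<open>The difference quotients of the zero extension of \<open>f\<close> have integral zero by translation invariance; the
  part outside \<open>S\<close> is at most a constant times the measure of \<open>(S - h d) - S\<close>, which tends to zero.  No regularity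
  of the boundary of \<open>S\<close> is needed.\<close>

lemma integral_dir_deriv_zero:
  fixes f :: "'a::euclidean_space \<Rightarrow> real"
  assumes S: "open S" "bounded S" and f: "C0bar S f" "zero_bdry S f"
    and df: "\<And>x. x \<in> S \<Longrightarrow> f differentiable (at x)" and D: "C0bar S (dir_deriv f d)"
  shows "integral S (dir_deriv f d) = 0"
proof -
  define f0 where "f0 x = (if x \<in> S then f x else 0)" for x
  define s where "s = (indicator S :: 'a \<Rightarrow> real)"
  define h where "h m = inverse (real (Suc m))" for m
  have h0: "h m \<noteq> 0" "h m > 0" for m by (auto simp: h_def)
  have hl: "h \<longlonglongrightarrow> 0" unfolding h_def by (rule LIMSEQ_inverse_real_of_nat)
  obtain K where K: "0 < K" "\<And>x. x \<in> S \<Longrightarrow> \<bar>dir_deriv f d x\<bar> \<le> K"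
    using C0bar_bounded[OF S(2) D] by blast
  have f0_eq: "f0 = (\<lambda>x. if x \<in> S then f x else 0)" by (auto simp: f0_def)
  have lip: "\<bar>f0 (x + h m *\<^sub>R d) - f0 x\<bar> \<le> K * h m" for x m
    unfolding f0_def
    by (rule zero_extension_lipschitz[OF S(1) f df K(2)]) (use K(1) h0(2)[of m] in auto)
  have f0i: "integrable lborel f0"
  proof -
    have "f0 = (\<lambda>x. indicator S x * f x)" by (auto simp: f0_def fun_eq_iff)
    then show ?thesis using C0bar_set_integrable_lborel(1)[OF S f(1)] by simp
  qed
  have si: "integrable lborel s"
    using C0bar_set_integrable_lborel(1)[OF S C0bar_const[of S 1]] by (simp add: s_def)
  define q where "q m x = (f0 (x + h m *\<^sub>R d) - f0 x) / h m" for m x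
  have qi: "integrable lborel (q m)" for m
    unfolding q_def by (intro integrable_divide Bochner_Integration.integrable_diff integrable_lborel_translate f0i)
  have q0: "(\<integral>x. q m x \<partial>lborel) = 0" for m
    unfolding q_def using integrable_lborel_translate[OF f0i, of "h m *\<^sub>R d"] f0i by simp
  have qK: "\<bar>q m x\<bar> \<le> K" for m x
    using lip[where x=x and m=m] h0(2)[of m] by (simp add: q_def abs_divide pos_divide_le_eq)
  have meas [measurable]: "s \<in> borel_measurable borel" "q m \<in> borel_measurable borel"
    "(\<lambda>x. s (x + h m *\<^sub>R d)) \<in> borel_measurable borel" for m
    using si qi integrable_lborel_translate(1)[OF si] by (auto dest: borel_measurable_integrable)
  have sqi: "integrable lborel (\<lambda>x. s x * q m x)" for m
  proof (rule Bochner_Integration.integrable_bound[OF qi[of m]])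
    show "(\<lambda>x. s x * q m x) \<in> borel_measurable lborel" by measurable
  qed (auto simp: s_def indicator_def)
  have ssi: "integrable lborel (\<lambda>x. s x * s (x + h m *\<^sub>R d))" for m
  proof (rule Bochner_Integration.integrable_bound[OF si])
    show "(\<lambda>x. s x * s (x + h m *\<^sub>R d)) \<in> borel_measurable lborel" by measurable
  qed (auto simp: s_def indicator_def)
  have ev: "\<forall>\<^sub>F m in sequentially. x + h m *\<^sub>R d \<in> S" if "x \<in> S" for x
  proof -
    have "(\<lambda>m. x + h m *\<^sub>R d) \<longlonglongrightarrow> x + 0 *\<^sub>R d" by (intro tendsto_intros hl)
    then show ?thesis using topological_tendstoD[OF _ S(1)] that by auto
  qed
  have lim1: "(\<lambda>m. \<integral>x. s x * q m x \<partial>lborel) \<longlonglongrightarrow> (\<integral>x. s x * dir_deriv f d x \<partial>lborel)"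
  proof (rule integral_dominated_convergence[where w = "\<lambda>x. K * s x"])
    show "(\<lambda>x. s x * dir_deriv f d x) \<in> borel_measurable lborel"
      using C0bar_set_integrable_lborel(1)[OF S D] by (auto simp: s_def)
    show "AE x in lborel. (\<lambda>m. s x * q m x) \<longlonglongrightarrow> s x * dir_deriv f d x"
    proof (rule AE_I2)
      fix x :: 'a
      show "(\<lambda>m. s x * q m x) \<longlonglongrightarrow> s x * dir_deriv f d x"
      proof (cases "x \<in> S")
        case True
        have "(\<lambda>m. q m x) \<longlonglongrightarrow> dir_deriv f d x"
          using difference_quotient_sequence[OF df[OF True] h0(1) hl, of d]
          by (rule Lim_transform_eventually)
            (use ev[OF True] True in \<open>auto simp: q_def f0_def elim!: eventually_mono\<close>)
        then show ?thesis by (intro tendsto_intros)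
      qed (simp add: s_def)
    qed
    show "AE x in lborel. norm (s x * q m x) \<le> K * s x" for m
      using qK by (auto simp: s_def indicator_def)
  qed (use si in auto)
  have lim2: "(\<lambda>m. \<integral>x. s x * s (x + h m *\<^sub>R d) \<partial>lborel) \<longlonglongrightarrow> (\<integral>x. s x \<partial>lborel)"
  proof (rule integral_dominated_convergence[where w = s])
    show "AE x in lborel. (\<lambda>m. s x * s (x + h m *\<^sub>R d)) \<longlonglongrightarrow> s x"
    proof (rule AE_I2)
      fix x :: 'a
      show "(\<lambda>m. s x * s (x + h m *\<^sub>R d)) \<longlonglongrightarrow> s x"
      proof (cases "x \<in> S")
        case True
        show ?thesis
          by (rule tendsto_eventually) (use ev[OF True] True in \<open>auto simp: s_def elim!: eventually_mono\<close>)
      qed (simp add: s_def)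
    qed
    show "AE x in lborel. norm (s x * s (x + h m *\<^sub>R d)) \<le> s x" for m
      by (auto simp: s_def indicator_def)
  qed (use si in auto)
  have bnd: "norm (\<integral>x. s x * q m x \<partial>lborel) \<le> K * ((\<integral>x. s x \<partial>lborel) - (\<integral>x. s x * s (x + h m *\<^sub>R d) \<partial>lborel))" for m
  proof -
    have "(\<integral>x. s x * q m x \<partial>lborel) = (\<integral>x. s x * q m x - q m x \<partial>lborel)"
      using q0 sqi qi by simp
    also have "norm \<dots> \<le> (\<integral>x. K * (s (x + h m *\<^sub>R d) - s x * s (x + h m *\<^sub>R d)) \<partial>lborel)"
    proof (rule Bochner_Integration.integral_norm_bound_integral)
      show "integrable lborel (\<lambda>x. K * (s (x + h m *\<^sub>R d) - s x * s (x + h m *\<^sub>R d)))"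
        using ssi integrable_lborel_translate(1)[OF si] by auto
      show "norm (s x * q m x - q m x) \<le> K * (s (x + h m *\<^sub>R d) - s x * s (x + h m *\<^sub>R d))" for x
        using qK[of m x] by (auto simp: s_def indicator_def q_def f0_def)
    qed (use sqi qi in auto)
    also have "\<dots> = K * ((\<integral>x. s x \<partial>lborel) - (\<integral>x. s x * s (x + h m *\<^sub>R d) \<partial>lborel))"
      using ssi integrable_lborel_translate[OF si] by simp
    finally show ?thesis .
  qed
  have "(\<lambda>m. K * ((\<integral>x. s x \<partial>lborel) - (\<integral>x. s x * s (x + h m *\<^sub>R d) \<partial>lborel))) \<longlonglongrightarrow> K * ((\<integral>x. s x \<partial>lborel) - (\<integral>x. s x \<partial>lborel))"
    by (intro tendsto_intros lim2)
  then have "(\<lambda>m. \<integral>x. s x * q m x \<partial>lborel) \<longlonglongrightarrow> 0"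
    by (intro Lim_null_comparison[OF always_eventually[OF allI[OF bnd]]]) simp
  then have "(\<integral>x. s x * dir_deriv f d x \<partial>lborel) = 0"
    using lim1 LIMSEQ_unique by blast
  then show ?thesis using C0bar_set_integrable_lborel(2)[OF S D] by (simp add: s_def)
qed

lemma divergence_zero:
  fixes F :: "'a::euclidean_space \<Rightarrow> 'a \<Rightarrow> real"
  assumes S: "open S" "bounded S" and F: "\<And>i. i \<in> Basis \<Longrightarrow> C1bar S (F i)" "\<And>i. i \<in> Basis \<Longrightarrow> zero_bdry S (F i)"
    and E: "\<And>x. x \<in> S \<Longrightarrow> E x = (\<Sum>i\<in>Basis. dir_deriv (F i) i x)"
  shows "integral S E = 0"
proof -
  have "integral S E = integral S (\<lambda>x. \<Sum>i\<in>Basis. dir_deriv (F i) i x)"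
    using E by (intro integral_cong) auto
  also have "\<dots> = (\<Sum>i\<in>Basis. integral S (dir_deriv (F i) i))"
    by (intro integral_sum C0bar_integrable S C1barD(3) F) auto
  also have "\<dots> = 0"
    using F by (intro sum.neutral ballI integral_dir_deriv_zero S) (blast intro: C1barD)+
  finally show ?thesis .
qed

section \<open>Symmetry of mixed second derivatives\<close>

lemma second_difference_mvt:
  fixes f :: "'a::euclidean_space \<Rightarrow> real"
  assumes h: "h > 0" and inS: "\<And>a b. 0 \<le> a \<Longrightarrow> a \<le> h \<Longrightarrow> 0 \<le> b \<Longrightarrow> b \<le> h \<Longrightarrow> x + a *\<^sub>R i + b *\<^sub>R j \<in> S"
    and df: "\<And>y. y \<in> S \<Longrightarrow> f differentiable (at y)" and ddf: "\<And>y. y \<in> S \<Longrightarrow> dir_deriv f i differentiable (at y)"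
  shows "\<exists>a b. 0 \<le> a \<and> a \<le> h \<and> 0 \<le> b \<and> b \<le> h \<and>
     f (x + h *\<^sub>R i + h *\<^sub>R j) - f (x + h *\<^sub>R i) - f (x + h *\<^sub>R j) + f x
       = h * (h * dir_deriv (dir_deriv f i) j (x + a *\<^sub>R i + b *\<^sub>R j))"
proof -
  have "\<exists>a>0. a < h \<and> (f (x + h *\<^sub>R j + h *\<^sub>R i) - f (x + h *\<^sub>R i)) - (f (x + h *\<^sub>R j + 0 *\<^sub>R i) - f (x + 0 *\<^sub>R i))
      = (h - 0) * (dir_deriv f i (x + h *\<^sub>R j + a *\<^sub>R i) - dir_deriv f i (x + a *\<^sub>R i))"
  proof (rule MVT2[OF h, where f = "\<lambda>a. f (x + h *\<^sub>R j + a *\<^sub>R i) - f (x + a *\<^sub>R i)"])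
    fix a assume a: "0 \<le> a" "a \<le> h"
    have "x + h *\<^sub>R j + a *\<^sub>R i \<in> S" "x + a *\<^sub>R i \<in> S"
      using inS[of a h] inS[of a 0] a h by (simp_all add: algebra_simps)
    then show "((\<lambda>a. f (x + h *\<^sub>R j + a *\<^sub>R i) - f (x + a *\<^sub>R i)) has_real_derivative
       dir_deriv f i (x + h *\<^sub>R j + a *\<^sub>R i) - dir_deriv f i (x + a *\<^sub>R i)) (at a)"
      by (intro DERIV_diff dir_deriv_line df)
  qed
  then obtain a where a: "0 < a" "a < h" and
    1: "f (x + h *\<^sub>R i + h *\<^sub>R j) - f (x + h *\<^sub>R i) - f (x + h *\<^sub>R j) + f x
      = h * (dir_deriv f i (x + a *\<^sub>R i + h *\<^sub>R j) - dir_deriv f i (x + a *\<^sub>R i))"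
    by (auto simp: algebra_simps)
  have "\<exists>b>0. b < h \<and> dir_deriv f i (x + a *\<^sub>R i + h *\<^sub>R j) - dir_deriv f i (x + a *\<^sub>R i + 0 *\<^sub>R j)
      = (h - 0) * dir_deriv (dir_deriv f i) j (x + a *\<^sub>R i + b *\<^sub>R j)"
    by (rule MVT2[OF h, where f = "\<lambda>b. dir_deriv f i (x + a *\<^sub>R i + b *\<^sub>R j)"], rule dir_deriv_line, rule ddf, rule inS)
      (use a in auto)
  then obtain b where b: "0 < b" "b < h" "dir_deriv f i (x + a *\<^sub>R i + h *\<^sub>R j) - dir_deriv f i (x + a *\<^sub>R i)
      = h * dir_deriv (dir_deriv f i) j (x + a *\<^sub>R i + b *\<^sub>R j)"
    by auto
  show ?thesis by (rule exI[of _ a], rule exI[of _ b]) (use a b 1 in simp)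
qed

text \<open>The second difference of f along i and j is symmetric in i and j. By
  \<open>second_difference_mvt\<close> it is h^2 times either mixed derivative, taken at some point
  near x, so the two derivatives agree at points arbitrarily close to x; continuity does the
  rest.\<close>

lemma dir_deriv_commute:
  fixes f :: "'a::euclidean_space \<Rightarrow> real"
  assumes S: "open S" "x \<in> S" and df: "\<And>y. y \<in> S \<Longrightarrow> f differentiable (at y)"
    and dd: "\<And>y. y \<in> S \<Longrightarrow> dir_deriv f i differentiable (at y)" "\<And>y. y \<in> S \<Longrightarrow> dir_deriv f j differentiable (at y)"
    and c: "continuous_on S (dir_deriv (dir_deriv f i) j)" "continuous_on S (dir_deriv (dir_deriv f j) i)"
  shows "dir_deriv (dir_deriv f i) j x = dir_deriv (dir_deriv f j) i x"
proof (rule ccontr)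
  let ?A = "dir_deriv (dir_deriv f i) j" and ?B = "dir_deriv (dir_deriv f j) i"
  assume ne: "?A x \<noteq> ?B x"
  define e where "e = \<bar>?A x - ?B x\<bar> / 2"
  have e: "e > 0" using ne by (simp add: e_def)
  have A: "isCont ?A x" using S c(1) continuous_on_eq_continuous_at by blast
  have B: "isCont ?B x" using S c(2) continuous_on_eq_continuous_at by blast
  obtain d1 where d1: "d1 > 0" "\<And>y. dist y x < d1 \<Longrightarrow> dist (?A y) (?A x) < e"
    using A e unfolding continuous_at_eps_delta by blast
  obtain d2 where d2: "d2 > 0" "\<And>y. dist y x < d2 \<Longrightarrow> dist (?B y) (?B x) < e"
    using B e unfolding continuous_at_eps_delta by blast
  obtain d3 where d3: "d3 > 0" "ball x d3 \<subseteq> S" using S open_contains_ball by blast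
  define N where "N = norm i + norm j + 1"
  have nn: "N > 0" unfolding N_def by (smt (verit) norm_ge_zero)
  \<comment> \<open>With both steps at most h, every point of the parallelogram is closer to x than
    2 h N, which is the smallest of the three radii.\<close>
  define h where "h = min d1 (min d2 d3) / (2 * N)"
  have h: "h > 0" using d1 d2 d3 nn by (simp add: h_def)
  have near: "dist (x + a *\<^sub>R i + b *\<^sub>R j) x < min d1 (min d2 d3)"
    if "0 \<le> a" "a \<le> h" "0 \<le> b" "b \<le> h" for a b
  proof -
    have "dist (x + a *\<^sub>R i + b *\<^sub>R j) x = norm (a *\<^sub>R i + b *\<^sub>R j)" by (simp add: dist_norm algebra_simps)
    also have "\<dots> \<le> a * norm i + b * norm j" using that norm_triangle_ineq[of "a *\<^sub>R i" "b *\<^sub>R j"] by simp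
    also have "\<dots> \<le> h * norm i + h * norm j" using that by (intro add_mono mult_right_mono) auto
    also have "\<dots> < 2 * (h * N)"
    proof -
      have n: "0 \<le> h * norm i" "0 \<le> h * norm j" using h by auto
      show ?thesis using h n unfolding N_def distrib_left by linarith
    qed
    also have "\<dots> = min d1 (min d2 d3)" using nn by (simp add: h_def)
    finally show ?thesis .
  qed
  have near': "dist (x + a *\<^sub>R j + b *\<^sub>R i) x < min d1 (min d2 d3)"
    if "0 \<le> a" "a \<le> h" "0 \<le> b" "b \<le> h" for a b
    using near[of b a] that by (simp add: algebra_simps)
  have inS: "y \<in> S" if "dist y x < min d1 (min d2 d3)" for y
    using d3(2) that by (auto simp: dist_commute)
  obtain y where y: "dist y x < min d1 (min d2 d3)" and
    1: "f (x + h *\<^sub>R i + h *\<^sub>R j) - f (x + h *\<^sub>R i) - f (x + h *\<^sub>R j) + f x = h * (h * ?A y)"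
    using second_difference_mvt[OF h inS[OF near] df dd(1)] near by blast
  obtain z where z: "dist z x < min d1 (min d2 d3)" and
    2: "f (x + h *\<^sub>R j + h *\<^sub>R i) - f (x + h *\<^sub>R j) - f (x + h *\<^sub>R i) + f x = h * (h * ?B z)"
    using second_difference_mvt[OF h inS[OF near'] df dd(2)] near' by blast
  have "h * (h * ?A y) = h * (h * ?B z)" using 1 2 by (simp add: algebra_simps)
  then have "?A y = ?B z" using h by simp
  moreover have "\<bar>?A y - ?A x\<bar> < e" using d1(2)[of y] y by (simp add: dist_real_def)
  moreover have "\<bar>?B z - ?B x\<bar> < e" using d2(2)[of z] z by (simp add: dist_real_def)
  ultimately show False unfolding e_def by argo
qed

section \<open>Boundary gradients of functions vanishing on the frontier\<close>

lemma C1bar_dir_deriv_bound: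
  fixes f :: "'a::euclidean_space \<Rightarrow> real"
  assumes S: "bounded S" and f: "C1bar S f"
  obtains M where "0 < M" "\<And>x d. x \<in> S \<Longrightarrow> \<bar>dir_deriv f d x\<bar> \<le> M * norm d"
proof -
  have "\<forall>i\<in>Basis. \<exists>K. \<forall>x\<in>S. \<bar>dir_deriv f i x\<bar> \<le> K"
    using C0bar_bounded[OF S C1barD(3)[OF f]] by meson
  then obtain K where K: "\<And>i x. i \<in> Basis \<Longrightarrow> x \<in> S \<Longrightarrow> \<bar>dir_deriv f i x\<bar> \<le> K i" by metis
  let ?M = "(\<Sum>i\<in>(Basis::'a set). \<bar>K i\<bar>) + 1"
  have M: "0 < ?M" by (simp add: add_nonneg_pos sum_nonneg)
  have "\<bar>dir_deriv f d x\<bar> \<le> ?M * norm d" if x: "x \<in> S" for x d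
  proof -
    have "\<bar>dir_deriv f d x\<bar> = \<bar>\<Sum>i\<in>Basis. (d \<bullet> i) * dir_deriv f i x\<bar>"
      using dir_deriv_Basis[OF C1barD(2)[OF f x], of d] by simp
    also have "\<dots> \<le> (\<Sum>i\<in>Basis. \<bar>(d \<bullet> i) * dir_deriv f i x\<bar>)" by (rule sum_abs)
    also have "\<dots> \<le> (\<Sum>i\<in>(Basis::'a set). norm d * \<bar>K i\<bar>)"
    proof (rule sum_mono)
      fix i :: 'a assume i: "i \<in> Basis"
      show "\<bar>(d \<bullet> i) * dir_deriv f i x\<bar> \<le> norm d * \<bar>K i\<bar>"
        unfolding abs_mult using K[OF i x] Basis_le_norm[OF i, of d] by (intro mult_mono) auto
    qed
    also have "\<dots> \<le> ?M * norm d" by (simp add: sum_distrib_left[symmetric] algebra_simps)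
    finally show ?thesis .
  qed
  with M show ?thesis using that by blast
qed

text \<open>Near p, \<phi> is negative on S, so the limit from inside gives \<phi> p \<le> 0, while
  a negative value would put p into the open set S.\<close>

lemma local_defining_fun_value:
  assumes S: "open S" "p \<in> frontier S" and l: "local_defining_fun S p r \<phi>"
  shows "0 < r" "\<phi> p = 0" "(\<phi> has_derivative (\<lambda>v. grad \<phi> p \<bullet> v)) (at p)" "grad \<phi> p \<noteq> 0"
    "\<And>x. x \<in> ball p r \<Longrightarrow> x \<in> S \<longleftrightarrow> \<phi> x < 0"
proof -
  show r: "0 < r" and g: "grad \<phi> p \<noteq> 0" using l unfolding local_defining_fun_def by auto
  show inS: "x \<in> S \<longleftrightarrow> \<phi> x < 0" if "x \<in> ball p r" for x
    using l that unfolding local_defining_fun_def by blast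
  have c1: "Ck_on 1 (ball p r) \<phi>" using l unfolding local_defining_fun_def by blast
  have "\<forall>x\<in>ball p r. iter_deriv [] \<phi> differentiable (at x)"
    using c1 unfolding Ck_on_def by (metis empty_subsetI length_0_conv list.set(1) zero_less_one)
  then have df: "\<phi> differentiable (at p)" using r by simp
  have "(\<lambda>v. dir_deriv \<phi> v p) = (\<lambda>v. grad \<phi> p \<bullet> v)"
  proof
    fix v
    have "grad \<phi> p \<bullet> v = (\<Sum>i\<in>Basis. dir_deriv \<phi> i p * (i \<bullet> v))" by (simp add: grad_def inner_sum_left)
    also have "\<dots> = (\<Sum>i\<in>Basis. (v \<bullet> i) * dir_deriv \<phi> i p)"
      by (rule sum.cong) (simp_all add: inner_commute mult.commute)
    finally show "dir_deriv \<phi> v p = grad \<phi> p \<bullet> v" using dir_deriv_Basis[OF df, of v] by simp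
  qed
  then show "(\<phi> has_derivative (\<lambda>v. grad \<phi> p \<bullet> v)) (at p)"
    using has_derivative_dir_deriv[OF df] by simp
  have pS: "p \<notin> S" "p \<in> closure S" using S by (auto simp: frontier_def interior_open)
  have cont: "(\<phi> \<longlongrightarrow> \<phi> p) (at p within S)"
    using differentiable_imp_continuous_within[OF df] by (auto simp: continuous_within intro: tendsto_within_subset)
  have "\<forall>\<^sub>F x in at p within S. \<phi> x \<le> 0"
    unfolding eventually_at using r inS by (intro exI[of _ r]) (auto simp: dist_commute less_imp_le)
  then have "\<phi> p \<le> 0"
    using tendsto_upperbound[OF cont] frontier_within_nontrivial[OF S] by blast
  moreover have "\<not> \<phi> p < 0" using inS[of p] pS r by simp
  ultimately show "\<phi> p = 0" by simp
qed

text \<open>On the segment from \<open>p - \<delta> s \<nu>\<close> in the direction \<open>s t\<close>, which lies in \<open>S\<close>, the values of \<open>f\<close> are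
  of order \<open>\<delta> s\<close> at both ends because the zero extension of \<open>f\<close> is Lipschitz; the mean value theorem then
  bounds the derivative along \<open>t\<close> by a multiple of \<open>\<delta>\<close>.\<close>

lemma bdry_tangential_deriv:
  fixes f :: "'a::euclidean_space \<Rightarrow> real"
  assumes S: "open S" "bounded S" and f: "C1bar S f" "zero_bdry S f" and p: "p \<in> frontier S"
    and l: "local_defining_fun S p r \<phi>" and t: "t \<bullet> grad \<phi> p = 0"
    and L: "(dir_deriv f t \<longlongrightarrow> L) (at p within S)"
  shows "L = 0"
proof -
  note ld = local_defining_fun_value[OF S(1) p l]
  define m where "m = norm (grad \<phi> p)"
  define \<nu> where "\<nu> = grad \<phi> p /\<^sub>R m"
  have m: "m > 0" using ld(4) by (simp add: m_def)
  have nu: "norm \<nu> = 1" "grad \<phi> p = m *\<^sub>R \<nu>" using m by (auto simp: \<nu>_def m_def)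
  have nn: "\<nu> \<bullet> \<nu> = 1" using nu(1) by (simp add: norm_eq_1)
  have tn: "t \<bullet> \<nu> = 0" using t by (simp add: \<nu>_def)
  obtain M where M: "0 < M" "\<And>x d. x \<in> S \<Longrightarrow> \<bar>dir_deriv f d x\<bar> \<le> M * norm d"
    using C1bar_dir_deriv_bound[OF S(2) f(1)] by blast
  define T where "T = 1 + norm t"
  have T: "T \<ge> 1" by (simp add: T_def)
  have ineq: "\<bar>L\<bar> \<le> 3 * M * \<delta> + \<eta>" if \<delta>: "0 < \<delta>" "\<delta> < 1" and \<eta>: "0 < \<eta>" for \<delta> \<eta>
  proof -
    obtain d1 where d1: "d1 > 0" "\<And>x. x \<in> S \<Longrightarrow> x \<noteq> p \<Longrightarrow> dist x p < d1 \<Longrightarrow> dist (dir_deriv f t x) L < \<eta>"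
      using L \<eta> unfolding Lim_within by (metis dist_nz)
    \<comment> \<open>This accuracy fits the radius 2 T s used below: the linearisation error of
      \<phi> is then at most m \<delta> s / 2, half of what a normal shift by \<delta> s
      contributes, so the sign of \<phi> is decided.\<close>
    have "0 < m * \<delta> / (4 * T)" using m \<delta> T by simp
    then obtain d2 where d2: "d2 > 0" and
      d2': "\<And>y. norm (y - p) < d2 \<Longrightarrow> norm (\<phi> y - \<phi> p - grad \<phi> p \<bullet> (y - p)) \<le> m * \<delta> / (4 * T) * norm (y - p)"
      using ld(3) unfolding has_derivative_at_alt by blast
    then have lin: "\<bar>\<phi> (p + y) - m * (\<nu> \<bullet> y)\<bar> \<le> m * \<delta> / (4 * T) * norm y" if "norm y < d2" for y
      using d2'[of "p + y"] that ld(2) nu(2) by simp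
    define s where "s = min r (min d1 d2) / (4 * T)"
    have s: "s > 0" using T d1 d2 ld(1) by (simp add: s_def)
    have s4: "2 * T * s < r" "2 * T * s < d1" "2 * T * s < d2"
    proof -
      have "4 * T * s = min r (min d1 d2)" using T by (simp add: s_def)
      moreover have "2 * T * s < 4 * T * s" using T s by simp
      ultimately show "2 * T * s < r" "2 * T * s < d1" "2 * T * s < d2" by linarith+
    qed
    have ny: "norm (a *\<^sub>R \<nu> + \<sigma> *\<^sub>R t) \<le> 2 * T * s" if "\<bar>a\<bar> \<le> \<delta> * s" "0 \<le> \<sigma>" "\<sigma> \<le> s" for a \<sigma>
    proof -
      have "norm (a *\<^sub>R \<nu> + \<sigma> *\<^sub>R t) \<le> \<bar>a\<bar> + \<sigma> * norm t"
        using norm_triangle_ineq[of "a *\<^sub>R \<nu>" "\<sigma> *\<^sub>R t"] nu(1) that by simp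
      also have "\<dots> \<le> 1 * s + s * norm t"
        using that \<delta> s by (intro add_mono mult_right_mono) (auto intro: order_trans[OF that(1)] mult_right_mono)
      also have "\<dots> = T * s" by (simp add: T_def algebra_simps)
      also have "\<dots> \<le> 2 * T * s" using T s by simp
      finally show ?thesis .
    qed
    have phi: "\<bar>\<phi> (p + (a *\<^sub>R \<nu> + \<sigma> *\<^sub>R t)) - m * a\<bar> \<le> m * \<delta> * s / 2" if "\<bar>a\<bar> \<le> \<delta> * s" "0 \<le> \<sigma>" "\<sigma> \<le> s" for a \<sigma>
    proof -
      have "\<nu> \<bullet> (a *\<^sub>R \<nu> + \<sigma> *\<^sub>R t) = a" using tn nn by (simp add: inner_add_right inner_commute)
      then have "\<bar>\<phi> (p + (a *\<^sub>R \<nu> + \<sigma> *\<^sub>R t)) - m * a\<bar> \<le> m * \<delta> / (4 * T) * norm (a *\<^sub>R \<nu> + \<sigma> *\<^sub>R t)"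
        using lin[of "a *\<^sub>R \<nu> + \<sigma> *\<^sub>R t"] ny[OF that] s4(3) by simp
      also have "\<dots> \<le> m * \<delta> / (4 * T) * (2 * T * s)"
        using ny[OF that] m \<delta> T by (intro mult_left_mono) auto
      also have "\<dots> = m * \<delta> * s / 2" using T by (simp add: field_simps)
      finally show ?thesis .
    qed
    have bl: "p + (a *\<^sub>R \<nu> + \<sigma> *\<^sub>R t) \<in> ball p r" if "\<bar>a\<bar> \<le> \<delta> * s" "0 \<le> \<sigma>" "\<sigma> \<le> s" for a \<sigma>
    proof -
      have "dist p (p + (a *\<^sub>R \<nu> + \<sigma> *\<^sub>R t)) = norm (a *\<^sub>R \<nu> + \<sigma> *\<^sub>R t)"
        by (simp only: dist_norm norm_minus_commute[of p]) simp
      then show ?thesis using ny[OF that] s4(1) unfolding mem_ball by linarith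
    qed
    have mds: "m * \<delta> * s > 0" using m \<delta> s by simp
    have ds: "\<bar>-(\<delta> * s)\<bar> \<le> \<delta> * s" "\<bar>\<delta> * s\<bar> \<le> \<delta> * s" using \<delta> s by auto
    have inn: "p + (-(\<delta> * s)) *\<^sub>R \<nu> + \<sigma> *\<^sub>R t \<in> S" if "0 \<le> \<sigma>" "\<sigma> \<le> s" for \<sigma>
    proof -
      have "\<phi> (p + ((-(\<delta> * s)) *\<^sub>R \<nu> + \<sigma> *\<^sub>R t)) < 0"
        using phi[OF ds(1) that] mds unfolding abs_le_iff by linarith
      then show ?thesis using ld(5)[OF bl[OF ds(1) that]] by (simp only: add.assoc)
    qed
    have out: "p + (\<delta> * s) *\<^sub>R \<nu> + s *\<^sub>R t \<notin> S"
    proof -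
      have 0: "0 \<le> s" "s \<le> s" using s by auto
      have "\<not> \<phi> (p + ((\<delta> * s) *\<^sub>R \<nu> + s *\<^sub>R t)) < 0"
        using phi[OF ds(2) 0] mds unfolding abs_le_iff by linarith
      then show ?thesis using ld(5)[OF bl[OF ds(2) 0]] by (simp only: add.assoc not_False_eq_True)
    qed
    have pS: "p \<notin> S" using S(1) p by (auto simp: frontier_def interior_open)
    let ?f0 = "\<lambda>x. if x \<in> S then f x else 0"
    have lip: "\<bar>?f0 (x + h *\<^sub>R \<nu>) - ?f0 x\<bar> \<le> M * h" if "h \<ge> 0" for x h
      by (rule zero_extension_lipschitz[OF S(1) C1barD(1)[OF f(1)] f(2) C1barD(2)[OF f(1)]])
        (use M nu(1) that in \<open>auto dest: M(2)[of _ \<nu>]\<close>)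
    have "\<bar>f (p + (-(\<delta> * s)) *\<^sub>R \<nu>)\<bar> \<le> M * (\<delta> * s)"
      using lip[of "\<delta> * s" "p + (-(\<delta> * s)) *\<^sub>R \<nu>"] inn[of 0] s \<delta> pS by simp
    moreover have "\<bar>f (p + (-(\<delta> * s)) *\<^sub>R \<nu> + s *\<^sub>R t)\<bar> \<le> M * (2 * (\<delta> * s))"
    proof -
      have "p + (-(\<delta> * s)) *\<^sub>R \<nu> + s *\<^sub>R t + (2 * (\<delta> * s)) *\<^sub>R \<nu> = p + (\<delta> * s) *\<^sub>R \<nu> + s *\<^sub>R t"
        by (simp add: algebra_simps scaleR_2[symmetric])
      then show ?thesis
        using lip[of "2 * (\<delta> * s)" "p + (-(\<delta> * s)) *\<^sub>R \<nu> + s *\<^sub>R t"] inn[of s] s \<delta> out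
        by (simp only: if_True if_False) simp
    qed
    moreover have "\<exists>z>0. z < s \<and> f (p + (-(\<delta> * s)) *\<^sub>R \<nu> + s *\<^sub>R t) - f (p + (-(\<delta> * s)) *\<^sub>R \<nu> + 0 *\<^sub>R t)
       = (s - 0) * dir_deriv f t (p + (-(\<delta> * s)) *\<^sub>R \<nu> + z *\<^sub>R t)"
      by (rule MVT2[OF s, where f = "\<lambda>z. f (p + (-(\<delta> * s)) *\<^sub>R \<nu> + z *\<^sub>R t)"], rule dir_deriv_line,
          rule C1barD(2)[OF f(1)], rule inn) auto
    then obtain z where z: "0 < z" "z < s" "f (p + (-(\<delta> * s)) *\<^sub>R \<nu> + s *\<^sub>R t) - f (p + (-(\<delta> * s)) *\<^sub>R \<nu>)
       = s * dir_deriv f t (p + (-(\<delta> * s)) *\<^sub>R \<nu> + z *\<^sub>R t)"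
      by auto
    ultimately have "\<bar>s * dir_deriv f t (p + (-(\<delta> * s)) *\<^sub>R \<nu> + z *\<^sub>R t)\<bar> \<le> s * (3 * M * \<delta>)"
      by (simp only: z(3)[symmetric]) (simp add: algebra_simps)
    then have 1: "\<bar>dir_deriv f t (p + (-(\<delta> * s)) *\<^sub>R \<nu> + z *\<^sub>R t)\<bar> \<le> 3 * M * \<delta>"
      using s by (simp add: abs_mult)
    have xS: "p + (-(\<delta> * s)) *\<^sub>R \<nu> + z *\<^sub>R t \<in> S" using inn[of z] z by simp
    have "dist (p + (-(\<delta> * s)) *\<^sub>R \<nu> + z *\<^sub>R t) p < d1"
      using ny[OF ds(1), of z] z s4(2) by (simp add: dist_norm add.assoc)
    then have "dist (dir_deriv f t (p + (-(\<delta> * s)) *\<^sub>R \<nu> + z *\<^sub>R t)) L < \<eta>"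
      using d1(2)[OF xS] xS pS by metis
    with 1 show ?thesis by (simp add: dist_real_def)
  qed
  show ?thesis
  proof (rule ccontr)
    assume "L \<noteq> 0"
    \<comment> \<open>Then 8 M \<delta> \<le> |L|, and the estimate with error |L| / 4 reads |L|
      \<le> 3/8 |L| + 1/4 |L|.\<close>
    define \<delta> where "\<delta> = min (1/2) (\<bar>L\<bar> / (8 * M))"
    have d: "0 < \<delta>" "\<delta> < 1" using \<open>L \<noteq> 0\<close> M(1) by (auto simp: \<delta>_def)
    have "8 * M * \<delta> \<le> 8 * M * (\<bar>L\<bar> / (8 * M))" using M(1) by (intro mult_left_mono) (auto simp: \<delta>_def)
    then have "8 * M * \<delta> \<le> \<bar>L\<bar>" using M(1) by simp
    moreover have "\<bar>L\<bar> \<le> 3 * M * \<delta> + \<bar>L\<bar> / 4" using ineq[OF d, of "\<bar>L\<bar>/4"] \<open>L \<noteq> 0\<close> by simp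
    ultimately show False using \<open>L \<noteq> 0\<close> by (simp add: field_simps)
  qed
qed

lemma outward_normal_local:
  assumes "\<exists>r \<phi>. local_defining_fun S p r \<phi>"
  obtains r \<phi> where "local_defining_fun S p r \<phi>" "outward_normal S p = grad \<phi> p /\<^sub>R norm (grad \<phi> p)"
proof -
  have "\<exists>v r \<phi>. local_defining_fun S p r \<phi> \<and> v = grad \<phi> p /\<^sub>R norm (grad \<phi> p)" using assms by blast
  then show ?thesis using that someI_ex[of "\<lambda>v. \<exists>r \<phi>. local_defining_fun S p r \<phi> \<and> v = grad \<phi> p /\<^sub>R norm (grad \<phi> p)"]
    unfolding outward_normal_def by blast
qed

lemma norm_outward_normal:
  assumes "\<exists>r \<phi>. local_defining_fun S p r \<phi>"
  shows "norm (outward_normal S p) = 1"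
proof -
  obtain r \<phi> where "local_defining_fun S p r \<phi>" "outward_normal S p = grad \<phi> p /\<^sub>R norm (grad \<phi> p)"
    using outward_normal_local[OF assms] .
  then show ?thesis by (auto simp: local_defining_fun_def)
qed

text \<open>Removing from i its component along the normal leaves a direction t orthogonal to
  \<open>grad \<phi> p\<close>, in which the derivative tends to 0 by
  \<open>bdry_tangential_deriv\<close>. The \<phi> used is the one hidden in the choice operator of
  \<open>outward_normal\<close>.\<close>

lemma bdry_gradient:
  fixes f :: "'a::euclidean_space \<Rightarrow> real"
  assumes S: "open S" "bounded S" and f: "C1bar S f" "zero_bdry S f" and p: "p \<in> frontier S"
    and l: "\<exists>r \<phi>. local_defining_fun S p r \<phi>" and i: "i \<in> Basis"
  shows "(dir_deriv f i \<longlongrightarrow> normal_deriv S f p * (outward_normal S p \<bullet> i)) (at p within S)"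
proof -
  obtain r \<phi> where ld: "local_defining_fun S p r \<phi>" and nu: "outward_normal S p = grad \<phi> p /\<^sub>R norm (grad \<phi> p)"
    using outward_normal_local[OF l] .
  let ?\<nu> = "outward_normal S p"
  have n1: "?\<nu> \<bullet> ?\<nu> = 1" using norm_outward_normal[OF l] by (simp add: norm_eq_1)
  have lim: "(dir_deriv f j \<longlongrightarrow> bval S (dir_deriv f j) p) (at p within S)" if "j \<in> Basis" for j
    using C0bar_bval[OF S(1) p C1barD(3)[OF f(1) that]] .
  define t where "t = i - (?\<nu> \<bullet> i) *\<^sub>R ?\<nu>"
  have "t \<bullet> ?\<nu> = 0" using n1 by (simp add: t_def inner_diff_left inner_commute[of i])
  then have t: "t \<bullet> grad \<phi> p = 0" using nu ld by (auto simp: local_defining_fun_def)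
  have "((\<lambda>x. \<Sum>j\<in>Basis. (t \<bullet> j) * dir_deriv f j x) \<longlongrightarrow> (\<Sum>j\<in>Basis. (t \<bullet> j) * bval S (dir_deriv f j) p)) (at p within S)"
    by (intro tendsto_sum tendsto_mult tendsto_const lim)
  then have "(dir_deriv f t \<longlongrightarrow> (\<Sum>j\<in>Basis. (t \<bullet> j) * bval S (dir_deriv f j) p)) (at p within S)"
    by (rule Lim_transform_eventually)
      (simp add: eventually_at_filter always_eventually dir_deriv_Basis[OF C1barD(2)[OF f(1)], symmetric])
  then have "(\<Sum>j\<in>Basis. (t \<bullet> j) * bval S (dir_deriv f j) p) = 0"
    using bdry_tangential_deriv[OF S f p ld t] by blast
  moreover have "(\<Sum>j\<in>Basis. (t \<bullet> j) * bval S (dir_deriv f j) p)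
      = (\<Sum>j\<in>Basis. (i \<bullet> j) * bval S (dir_deriv f j) p) - (?\<nu> \<bullet> i) * normal_deriv S f p"
  proof -
    have "normal_deriv S f p = (\<Sum>j\<in>Basis. (?\<nu> \<bullet> j) * bval S (dir_deriv f j) p)"
      unfolding normal_deriv_def inner_sum_left
      by (rule sum.cong) (simp_all add: inner_commute[of _ ?\<nu>] mult.commute)
    then show ?thesis
      by (simp add: t_def inner_diff_left left_diff_distrib sum_subtractf sum_distrib_left mult.assoc)
  qed
  moreover have "(\<Sum>j\<in>Basis. (i \<bullet> j) * bval S (dir_deriv f j) p) = bval S (dir_deriv f i) p"
    using i by (simp add: inner_Basis if_distrib[of "\<lambda>x. x * _"] cong: if_cong)
  ultimately show ?thesis using lim[OF i] by (simp add: mult.commute)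
qed

section \<open>Compactly supported functions and the antisymmetric integral identity\<close>

lemma dir_deriv_shift:
  fixes f :: "'a::euclidean_space \<Rightarrow> real"
  assumes "f differentiable (at (x + c))"
  shows "(\<lambda>x. f (x + c)) differentiable (at x)" "dir_deriv (\<lambda>x. f (x + c)) v x = dir_deriv f v (x + c)"
proof -
  have "((f \<circ> (\<lambda>x. x + c)) has_derivative (\<lambda>v. dir_deriv f v (x + c)) \<circ> (\<lambda>v. v)) (at x)"
    by (intro diff_chain_at has_derivative_dir_deriv assms) (auto intro!: derivative_eq_intros)
  then have "((\<lambda>x. f (x + c)) has_derivative (\<lambda>v. dir_deriv f v (x + c))) (at x)"
    by (simp add: comp_def)
  then show "(\<lambda>x. f (x + c)) differentiable (at x)" "dir_deriv (\<lambda>x. f (x + c)) v x = dir_deriv f v (x + c)"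
    by (auto simp: differentiable_def dir_deriv_eqI)
qed

lemma compact_support_bar:
  fixes f :: "'a::euclidean_space \<Rightarrow> real"
  assumes S: "open S" and K: "compact K" "K \<subseteq> S" and f: "continuous_on S f" and z: "\<And>x. x \<in> S \<Longrightarrow> x \<notin> K \<Longrightarrow> f x = 0"
  shows "C0bar S f" "zero_bdry S f" "continuous_on UNIV (\<lambda>x. if x \<in> S then f x else 0)"
proof -
  let ?f = "\<lambda>x. if x \<in> S then f x else 0"
  have "continuous_on (S \<union> - K) ?f"
  proof (rule continuous_on_open_Un)
    show "open (- K)" using K(1) compact_imp_closed by blast
    show "continuous_on S ?f" using f by (rule continuous_on_eq) simp
    show "continuous_on (- K) ?f"
      by (rule continuous_on_eq[OF continuous_on_const[of _ 0]]) (use z in auto)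
  qed (rule S)
  moreover have "S \<union> - K = UNIV" using K(2) by auto
  ultimately show c: "continuous_on UNIV ?f" by simp
  have "continuous_on (closure S) ?f" using c continuous_on_subset by blast
  then show "C0bar S f" unfolding C0bar_def by (intro exI[of _ ?f]) auto
  show "zero_bdry S f" unfolding zero_bdry_def
  proof
    fix p assume p: "p \<in> frontier S"
    then have "p \<notin> S" using S by (auto simp: frontier_def interior_open)
    have "(?f \<longlongrightarrow> ?f p) (at p)" using c by (simp add: continuous_on_def)
    then have "(?f \<longlongrightarrow> 0) (at p within S)" using \<open>p \<notin> S\<close> tendsto_within_subset[of ?f _ p UNIV S] by auto
    then show "(f \<longlongrightarrow> 0) (at p within S)"
      by (rule Lim_transform_eventually) (simp add: eventually_at_filter)
  qed
qed

text \<open>Only one derivative of \<open>\<psi>\<close> and \<open>b\<close> is available, so one derivative is replaced by a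
  difference quotient and moved across by translation invariance.\<close>

lemma integral_null_lagrangian:
  fixes \<psi> b :: "'a::euclidean_space \<Rightarrow> real"
  assumes S: "open S" "bounded S" and K: "compact K" "K \<subseteq> S"
    and psi: "C1bar S \<psi>" and z: "\<And>x. x \<in> S \<Longrightarrow> x \<notin> K \<Longrightarrow> \<psi> x = 0" and b: "C1bar S b"
    and i: "i \<in> Basis" and j: "j \<in> Basis"
  shows "integral S (\<lambda>x. dir_deriv \<psi> j x * dir_deriv b i x) = integral S (\<lambda>x. dir_deriv \<psi> i x * dir_deriv b j x)"
proof -
  define \<psi>0 where "\<psi>0 x = (if x \<in> S then \<psi> x else 0)" for x
  define P where "P x = (if x \<in> S then dir_deriv \<psi> i x else 0)" for x
  have opK: "open (- K)" using K(1) compact_imp_closed by blast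
  have dz: "dir_deriv \<psi> d x = 0" if "x \<in> S" "x \<notin> K" for x d
  proof -
    have "dir_deriv \<psi> d x = dir_deriv (\<lambda>x. 0) d x"
      by (rule dir_deriv_cong[of "S \<inter> - K"]) (use S opK that z in auto)
    then show ?thesis by simp
  qed
  note c0 = compact_support_bar[OF S(1) K C0bar_continuous_on[OF C1barD(1)[OF psi]] z]
  note cP = compact_support_bar[OF S(1) K C0bar_continuous_on[OF C1barD(3)[OF psi i]] dz]
  have cont: "continuous_on UNIV \<psi>0" "continuous_on UNIV P"
    using c0(3) cP(3) by (simp_all add: \<psi>0_def[abs_def] P_def[abs_def])
  have d0: "\<psi>0 differentiable (at x)" "dir_deriv \<psi>0 i x = P x" for x
  proof -
    have "\<psi>0 differentiable (at x) \<and> dir_deriv \<psi>0 i x = P x"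
    proof (cases "x \<in> S")
      case True
      have "\<psi>0 differentiable (at x)"
        by (rule differentiable_cong_open[OF S(1) True _ C1barD(2)[OF psi True]]) (simp add: \<psi>0_def)
      moreover have "dir_deriv \<psi>0 i x = dir_deriv \<psi> i x"
        by (rule dir_deriv_cong[OF S(1) True]) (simp add: \<psi>0_def)
      ultimately show ?thesis using True by (simp add: P_def)
    next
      case False
      then have xK: "x \<in> - K" using K(2) by auto
      have "\<psi>0 differentiable (at x)"
        by (rule differentiable_cong_open[OF opK xK, of "\<lambda>x. 0"]) (use z in \<open>auto simp: \<psi>0_def\<close>)
      moreover have "dir_deriv \<psi>0 i x = dir_deriv (\<lambda>x. 0) i x"
        by (rule dir_deriv_cong[OF opK xK]) (use z in \<open>auto simp: \<psi>0_def\<close>)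
      ultimately show ?thesis using False by (simp add: P_def)
    qed
    then show "\<psi>0 differentiable (at x)" "dir_deriv \<psi>0 i x = P x" by auto
  qed
  \<comment> \<open>A margin around K: points at distance at most \<rho> from K stay in S. Empty K
    is a separate alternative, because \<open>infdist\<close> to the empty set is 0 by convention
    and the inclusion would then claim that S is everything.\<close>
  obtain \<rho> where rho: "\<rho> > 0" "{x. infdist x K \<le> \<rho>} \<subseteq> S \<or> K = {}"
    using compact_in_open_separated[OF _ K(1) S(1) K(2)] zero_less_one by metis
  have near: "y \<in> S" if "x \<in> K" "dist x y \<le> \<rho>" for x y
  proof -
    have "infdist y K \<le> dist y x" using that(1) by (rule infdist_le)
    then have "infdist y K \<le> \<rho>" using that(2) by (simp add: dist_commute)
    then show ?thesis using rho(2) that(1) by blast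
  qed
  define h where "h m = \<rho> * inverse (real (Suc m))" for m
  have hr: "h m \<le> \<rho>" for m
  proof -
    have "inverse (real (Suc m)) \<le> 1" by (simp add: inverse_eq_divide)
    then show ?thesis using rho(1) mult_left_mono[of "inverse (real (Suc m))" 1 \<rho>] by (simp add: h_def)
  qed
  have h0: "h m > 0" "h m \<noteq> 0" "- h m \<noteq> 0" for m using rho(1) by (auto simp: h_def)
  have hl: "h \<longlonglongrightarrow> 0" unfolding h_def
    using tendsto_mult[OF tendsto_const[of \<rho>] LIMSEQ_inverse_real_of_nat] by simp
  have hl': "(\<lambda>m. - h m) \<longlonglongrightarrow> 0" using tendsto_minus[OF hl] by simp
  have nj: "norm j = 1" using j by simp
  obtain M where M: "0 < M" "\<And>x d. x \<in> S \<Longrightarrow> \<bar>dir_deriv b d x\<bar> \<le> M * norm d"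
    using C1bar_dir_deriv_bound[OF S(2) b] by blast
  obtain M' where M': "0 < M'" "\<And>x d. x \<in> S \<Longrightarrow> \<bar>dir_deriv \<psi> d x\<bar> \<le> M' * norm d"
    using C1bar_dir_deriv_bound[OF S(2) psi] by blast
  obtain Mb where Mb: "0 < Mb" "\<And>x. x \<in> S \<Longrightarrow> \<bar>dir_deriv b i x\<bar> \<le> Mb"
    using C0bar_bounded[OF S(2) C1barD(3)[OF b i]] by blast
  define q where "q m x = (\<psi>0 (x + h m *\<^sub>R j) - \<psi>0 x) / h m" for m x
  define A where "A m x = q m x * dir_deriv b i x" for m x
  define B where "B m x = (P (x + h m *\<^sub>R j) - P x) / h m * b x" for m x
  have cs: "continuous_on UNIV (\<lambda>x. \<psi>0 (x + h m *\<^sub>R j))" "continuous_on UNIV (\<lambda>x. P (x + h m *\<^sub>R j))" for m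
    by (rule continuous_on_compose2[OF cont(1)] continuous_on_compose2[OF cont(2)]; auto intro!: continuous_intros)+
  have q_c: "continuous_on UNIV (q m)" for m
    unfolding q_def by (intro continuous_intros cs cont) (use h0 in auto)
  have C0: "C0bar S (q m)" "C0bar S (\<lambda>x. P (x + h m *\<^sub>R j))" "C0bar S P" for m
    using q_c cs cont by (auto intro!: C0barI intro: continuous_on_subset)
  have C0d: "C0bar S (\<lambda>x. (P (x + h m *\<^sub>R j) - P x) / h m)" for m
    using C0bar_mult[OF C0bar_diff[OF C0(2,3)] C0bar_const[of S "1 / h m"]] by simp
  \<comment> \<open>A + B is the i-th derivative of \<open>q m * b\<close>, which vanishes on the
    frontier because the shifted support of \<psi> still lies inside S; hence the two integrals are
    opposite.\<close>
  have AB: "integral S (A m) = - integral S (B m)" for m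
  proof -
    have dq: "q m differentiable (at x)" "dir_deriv (q m) i x = (P (x + h m *\<^sub>R j) - P x) / h m" for x
    proof -
      note sh = dir_deriv_shift[OF d0(1)]
      show "q m differentiable (at x)" unfolding q_def
        using h0(2) by (intro derivative_intros sh d0) auto
      have e: "q m = (\<lambda>x. (1 / h m) * (\<psi>0 (x + h m *\<^sub>R j) - \<psi>0 x))" by (auto simp: q_def)
      show "dir_deriv (q m) i x = (P (x + h m *\<^sub>R j) - P x) / h m"
        unfolding e by (subst dir_deriv_mult) (auto intro!: derivative_intros sh d0 simp: dir_deriv_diff sh d0)
    qed
    have dF: "dir_deriv (\<lambda>x. q m x * b x) i x = A m x + B m x" if "x \<in> S" for x
      using dir_deriv_mult[OF dq(1) C1barD(2)[OF b that]] dq(2) by (simp add: A_def B_def)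
    have cA: "C0bar S (A m)" "C0bar S (B m)" unfolding A_def B_def
      by (intro C0bar_mult C0 C0d C1barD(1)[OF b] C1barD(3)[OF b i])+
    have "integral S (dir_deriv (\<lambda>x. q m x * b x) i) = 0"
    proof (rule integral_dir_deriv_zero[OF S])
      show "C0bar S (\<lambda>x. q m x * b x)" by (intro C0bar_mult C0 C1barD(1)[OF b])
      show "C0bar S (dir_deriv (\<lambda>x. q m x * b x) i)" by (rule C0bar_cong[OF C0bar_add[OF cA] dF])
      show "(\<lambda>x. q m x * b x) differentiable at x" if "x \<in> S" for x
        using dq(1) C1barD(2)[OF b that] by (rule differentiable_mult)
      have "zero_bdry S (q m)" unfolding zero_bdry_def
      proof
        fix p assume p: "p \<in> frontier S"
        then have pS: "p \<notin> S" using S by (auto simp: frontier_def interior_open)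
        then have "p + h m *\<^sub>R j \<notin> K"
          using near[of "p + h m *\<^sub>R j" p] hr[of m] h0[of m] nj by (auto simp: dist_norm)
        then have "\<psi>0 (p + h m *\<^sub>R j) = 0" "\<psi>0 p = 0" using z pS by (auto simp: \<psi>0_def)
        then have "q m p = 0" by (simp add: q_def)
        moreover have "(q m \<longlongrightarrow> q m p) (at p)" using q_c by (simp add: continuous_on_def)
        ultimately show "(q m \<longlongrightarrow> 0) (at p within S)" using tendsto_within_subset[of "q m" _ p UNIV S] by auto
      qed
      then show "zero_bdry S (\<lambda>x. q m x * b x)" by (rule zero_bdry_mult[OF S(1) _ C1barD(1)[OF b]])
    qed
    moreover have "integral S (dir_deriv (\<lambda>x. q m x * b x) i) = integral S (\<lambda>x. A m x + B m x)"
      by (rule integral_cong) (rule dF)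
    moreover have "\<dots> = integral S (A m) + integral S (B m)"
      by (intro integral_add C0bar_integrable S cA)
    ultimately show ?thesis by simp
  qed
  have limA: "(\<lambda>m. integral S (A m)) \<longlonglongrightarrow> integral S (\<lambda>x. dir_deriv \<psi> j x * dir_deriv b i x)"
  proof (rule dominated_convergence(2)[where h = "\<lambda>x. M' * Mb"])
    show "A m integrable_on S" for m unfolding A_def
      by (intro C0bar_integrable S C0bar_mult C0 C1barD(3)[OF b i])
    show "(\<lambda>x. M' * Mb) integrable_on S" by (intro C0bar_integrable S C0bar_const)
    show "norm (A m x) \<le> M' * Mb" if "x \<in> S" for m x
    proof -
      have "\<bar>\<psi>0 (x + h m *\<^sub>R j) - \<psi>0 x\<bar> \<le> M' * h m" unfolding \<psi>0_def
        by (rule zero_extension_lipschitz[OF S(1) C1barD(1)[OF psi] c0(2) C1barD(2)[OF psi]])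
          (use M' nj h0(1)[of m] in \<open>auto dest: M'(2)[of _ j]\<close>)
      then have "\<bar>q m x\<bar> \<le> M'" using h0(1)[of m] by (simp add: q_def abs_divide pos_divide_le_eq)
      then show ?thesis unfolding A_def real_norm_def abs_mult using Mb(2)[OF that] M' by (intro mult_mono) auto
    qed
    show "(\<lambda>m. A m x) \<longlonglongrightarrow> dir_deriv \<psi> j x * dir_deriv b i x" if x: "x \<in> S" for x
    proof -
      have "dir_deriv \<psi>0 j x = dir_deriv \<psi> j x"
        by (rule dir_deriv_cong[OF S(1) x]) (simp add: \<psi>0_def)
      then have "(\<lambda>m. q m x) \<longlonglongrightarrow> dir_deriv \<psi> j x" unfolding q_def
        using difference_quotient_sequence[OF d0(1) h0(2) hl, of x j] by simp
      then show ?thesis unfolding A_def by (intro tendsto_mult tendsto_const)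
    qed
  qed
  define b0 where "b0 x = indicator S x * b x" for x
  define C where "C m x = P x * ((b0 (x - h m *\<^sub>R j) - b0 x) / h m)" for m x
  have Pb: "integrable lborel (\<lambda>x. P (x + h m *\<^sub>R j) * b0 x)" "integrable lborel (\<lambda>x. P x * b0 x)" for m
    using C0bar_set_integrable_lborel(1)[OF S C0bar_mult[OF C0(2) C1barD(1)[OF b]]]
      C0bar_set_integrable_lborel(1)[OF S C0bar_mult[OF C0(3) C1barD(1)[OF b]]]
    by (simp_all add: b0_def algebra_simps)
  have Pb': "integrable lborel (\<lambda>x. P x * b0 (x - h m *\<^sub>R j))"
    "(\<integral>x. P x * b0 (x - h m *\<^sub>R j) \<partial>lborel) = (\<integral>x. P (x + h m *\<^sub>R j) * b0 x \<partial>lborel)" for m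
    using integrable_lborel_translate[OF Pb(1)[of m], of "- (h m *\<^sub>R j)"] by simp_all
  have Ci: "integrable lborel (C m)" for m
  proof -
    have "C m = (\<lambda>x. (P x * b0 (x - h m *\<^sub>R j) - P x * b0 x) / h m)" by (auto simp: C_def algebra_simps diff_divide_distrib)
    then show ?thesis using Pb Pb' by (auto intro!: integrable_divide Bochner_Integration.integrable_diff)
  qed
  \<comment> \<open>A translation moves the difference quotient from P to b with step - h, which
    produces a minus sign in the limit. Extending b by zero does no harm, because P vanishes off K
    and K keeps the distance \<rho> from the complement of S.\<close>
  have BC: "integral S (B m) = (\<integral>x. C m x \<partial>lborel)" for m
  proof -
    have "integral S (B m) = (\<integral>x. indicator S x * B m x \<partial>lborel)"
      by (rule C0bar_set_integrable_lborel(2)[OF S, symmetric])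
        (unfold B_def, intro C0bar_mult C0d C1barD(1)[OF b])
    also have "\<dots> = (\<integral>x. (P (x + h m *\<^sub>R j) * b0 x - P x * b0 x) / h m \<partial>lborel)"
      by (rule Bochner_Integration.integral_cong) (auto simp: B_def b0_def algebra_simps diff_divide_distrib)
    also have "\<dots> = ((\<integral>x. P x * b0 (x - h m *\<^sub>R j) \<partial>lborel) - (\<integral>x. P x * b0 x \<partial>lborel)) / h m"
      using Pb Pb' by simp
    also have "\<dots> = (\<integral>x. (P x * b0 (x - h m *\<^sub>R j) - P x * b0 x) / h m \<partial>lborel)"
      using Pb Pb' by simp
    also have "\<dots> = (\<integral>x. C m x \<partial>lborel)"
      by (rule Bochner_Integration.integral_cong) (auto simp: C_def algebra_simps diff_divide_distrib)
    finally show ?thesis .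
  qed
  have "(\<lambda>m. \<integral>x. C m x \<partial>lborel) \<longlonglongrightarrow> (\<integral>x. - (indicator S x * (dir_deriv \<psi> i x * dir_deriv b j x)) \<partial>lborel)"
  proof (rule integral_dominated_convergence[where w = "\<lambda>x. indicator S x * (M' * M)"])
    show "(\<lambda>x. - (indicator S x * (dir_deriv \<psi> i x * dir_deriv b j x))) \<in> borel_measurable lborel"
      by (rule borel_measurable_uminus, rule borel_measurable_integrable,
          rule C0bar_set_integrable_lborel(1)[OF S C0bar_mult[OF C1barD(3)[OF psi i] C1barD(3)[OF b j]]])
    show "C m \<in> borel_measurable lborel" for m using Ci by (rule borel_measurable_integrable)
    show "integrable lborel (\<lambda>x. indicator S x * (M' * M))"
      by (rule C0bar_set_integrable_lborel(1)[OF S C0bar_const])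
    have P0: "P x = 0" if "x \<notin> K" for x using dz that by (auto simp: P_def)
    show "AE x in lborel. (\<lambda>m. C m x) \<longlonglongrightarrow> - (indicator S x * (dir_deriv \<psi> i x * dir_deriv b j x))"
    proof (rule AE_I2)
      fix x :: 'a
      show "(\<lambda>m. C m x) \<longlonglongrightarrow> - (indicator S x * (dir_deriv \<psi> i x * dir_deriv b j x))"
      proof (cases "x \<in> K")
        case True
        then have x: "x \<in> S" using K(2) by auto
        have yS: "x - h m *\<^sub>R j \<in> S" for m
          using near[OF True, of "x - h m *\<^sub>R j"] hr[of m] h0(1)[of m] nj by (simp add: dist_norm)
        have "(\<lambda>m. (b (x + (- h m) *\<^sub>R j) - b x) / (- h m)) \<longlonglongrightarrow> dir_deriv b j x"
          by (rule difference_quotient_sequence[OF C1barD(2)[OF b x] h0(3) hl'])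
        then have "(\<lambda>m. P x * - ((b (x + (- h m) *\<^sub>R j) - b x) / (- h m))) \<longlonglongrightarrow> P x * - dir_deriv b j x"
          by (intro tendsto_intros)
        then show ?thesis using x yS by (simp add: C_def b0_def P_def)
      next
        case False
        then show ?thesis using P0 dz by (cases "x \<in> S") (auto simp: C_def)
      qed
    qed
    show "AE x in lborel. norm (C m x) \<le> indicator S x * (M' * M)" for m
    proof (rule AE_I2)
      fix x :: 'a
      show "norm (C m x) \<le> indicator S x * (M' * M)"
      proof (cases "x \<in> K")
        case True
        then have x: "x \<in> S" using K(2) by auto
        have yS: "x + t *\<^sub>R (- j) \<in> S" if "0 \<le> t" "t \<le> h m" for t
          using near[OF True, of "x + t *\<^sub>R (- j)"] hr[of m] that nj by (simp add: dist_norm)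
        have "\<exists>t>0. t < h m \<and> b (x + h m *\<^sub>R (- j)) - b (x + 0 *\<^sub>R (- j)) = (h m - 0) * dir_deriv b (- j) (x + t *\<^sub>R (- j))"
          by (rule MVT2[OF h0(1), where f = "\<lambda>t. b (x + t *\<^sub>R (- j))"], rule dir_deriv_line, rule C1barD(2)[OF b], rule yS) auto
        then obtain t where t: "0 < t" "t < h m" "b (x - h m *\<^sub>R j) - b x = h m * dir_deriv b (- j) (x + t *\<^sub>R (- j))"
          by auto
        then have "\<bar>(b (x - h m *\<^sub>R j) - b x) / h m\<bar> \<le> M"
          using M(2)[OF yS[of t], of "-j"] nj h0(1)[of m] by simp
        moreover have "\<bar>P x\<bar> \<le> M'" using x M'(2)[OF x, of i] i by (simp add: P_def)
        moreover have "x - h m *\<^sub>R j \<in> S" using yS[of "h m"] h0(1)[of m] by simp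
        ultimately show ?thesis using x M' unfolding C_def real_norm_def abs_mult b0_def
          by (simp del: abs_divide) (intro mult_mono; auto)
      next
        case False
        then show ?thesis using P0 M M' by (simp add: C_def)
      qed
    qed
  qed
  then have "(\<lambda>m. integral S (A m)) \<longlonglongrightarrow> (\<integral>x. indicator S x * (dir_deriv \<psi> i x * dir_deriv b j x) \<partial>lborel)"
    using tendsto_minus[of "\<lambda>m. \<integral>x. C m x \<partial>lborel"] by (simp add: AB BC) fastforce
  then show ?thesis
    using LIMSEQ_unique[OF limA] C0bar_set_integrable_lborel(2)[OF S C0bar_mult[OF C1barD(3)[OF psi i] C1barD(3)[OF b j]]]
    by simp
qed

section \<open>Interior minima, vanishing gradients and vanishing integrals\<close>

lemma second_deriv_nonneg_at_min:
  fixes f :: "'a::euclidean_space \<Rightarrow> real"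
  assumes S: "open S" "x \<in> S" and df: "\<And>y. y \<in> S \<Longrightarrow> f differentiable (at y)"
    and dd: "dir_deriv f i differentiable (at x)" and mn: "\<And>y. y \<in> S \<Longrightarrow> f x \<le> f y"
  shows "0 \<le> dir_deriv (dir_deriv f i) i x"
proof (rule ccontr)
  assume neg: "\<not> ?thesis"
  have op: "open ((\<lambda>t. x + t *\<^sub>R i) -` S)"
    using S(1) by (intro continuous_open_vimage) (auto intro!: continuous_intros)
  moreover have "0 \<in> (\<lambda>t. x + t *\<^sub>R i) -` S" using S(2) by simp
  ultimately obtain r where r: "r > 0" "ball 0 r \<subseteq> (\<lambda>t. x + t *\<^sub>R i) -` S"
    using open_contains_ball by blast
  have inS: "x + t *\<^sub>R i \<in> S" if "\<bar>t\<bar> < r" for t using r(2) that by (auto simp: dist_real_def)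
  have d: "((\<lambda>t. f (x + t *\<^sub>R i)) has_real_derivative dir_deriv f i (x + t *\<^sub>R i)) (at t)" if "\<bar>t\<bar> < r" for t
    by (rule dir_deriv_line[OF df[OF inS[OF that]]])
  have "dir_deriv f i (x + 0 *\<^sub>R i) = 0"
    by (rule DERIV_local_min[OF d r(1)]) (use r(1) mn inS in auto)
  then have z: "dir_deriv f i x = 0" by simp
  have "((\<lambda>t. dir_deriv f i (x + t *\<^sub>R i)) has_real_derivative dir_deriv (dir_deriv f i) i (x + 0 *\<^sub>R i)) (at 0)"
    by (rule dir_deriv_line) (use dd in simp)
  then obtain e where e: "e > 0" "\<And>h. 0 < h \<Longrightarrow> h < e \<Longrightarrow> dir_deriv f i (x + h *\<^sub>R i) < 0"
    using DERIV_neg_dec_right[of "\<lambda>t. dir_deriv f i (x + t *\<^sub>R i)" "dir_deriv (dir_deriv f i) i x" 0] neg z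
    by (simp add: not_le) blast
  define h where "h = min e r / 2"
  have h: "0 < h" "h < e" "h < r" using e r by (auto simp: h_def)
  have "\<exists>t>0. t < h \<and> f (x + h *\<^sub>R i) - f (x + 0 *\<^sub>R i) = (h - 0) * dir_deriv f i (x + t *\<^sub>R i)"
    by (rule MVT2[OF h(1), where f = "\<lambda>t. f (x + t *\<^sub>R i)"], rule d) (use h in auto)
  then obtain t where t: "0 < t" "t < h" "f (x + h *\<^sub>R i) - f x = h * dir_deriv f i (x + t *\<^sub>R i)" by auto
  then have "f (x + h *\<^sub>R i) - f x < 0" using e(2)[of t] h by (simp add: mult_pos_neg)
  then show False using mn[OF inS[of h]] h by auto
qed

lemma constant_of_zero_gradient:
  fixes f :: "'a::euclidean_space \<Rightarrow> real"
  assumes S: "open S" "connected S" and df: "\<And>x. x \<in> S \<Longrightarrow> f differentiable (at x)"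
    and z: "\<And>x i. x \<in> S \<Longrightarrow> i \<in> Basis \<Longrightarrow> dir_deriv f i x = 0" and x: "x \<in> S" "y \<in> S"
  shows "f x = f y"
proof (rule has_derivative_zero_unique_connected[OF S _ x])
  fix x assume x: "x \<in> S"
  have "(\<lambda>v. dir_deriv f v x) = (\<lambda>v. 0)"
    by (rule ext, subst dir_deriv_Basis[OF df[OF x]]) (simp add: z x)
  then show "(f has_derivative (\<lambda>v. 0)) (at x)" using has_derivative_dir_deriv[OF df[OF x]] by simp
qed

lemma zero_of_zero_gradient:
  fixes f :: "'a::euclidean_space \<Rightarrow> real"
  assumes S: "open S" "connected S" "bounded S" and f: "C1bar S f" "zero_bdry S f"
    and z: "\<And>x i. x \<in> S \<Longrightarrow> i \<in> Basis \<Longrightarrow> dir_deriv f i x = 0" and x: "x \<in> S"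
  shows "f x = 0"
proof -
  have "frontier S \<noteq> {}"
    using x S(3) frontier_eq_empty not_bounded_UNIV by blast
  then obtain p where p: "p \<in> frontier S" by blast
  have "(f \<longlongrightarrow> 0) (at p within S)" using f(2) p by (simp add: zero_bdry_def)
  moreover have "(f \<longlongrightarrow> f x) (at p within S)"
    by (rule Lim_transform_eventually[OF tendsto_const])
      (use constant_of_zero_gradient[OF S(1,2) C1barD(2)[OF f(1)] z x] in \<open>simp add: eventually_at_filter\<close>)
  ultimately show ?thesis
    using tendsto_unique[OF frontier_within_nontrivial[OF S(1) p]] by metis
qed

lemma integral_nonneg_zero_imp:
  fixes f :: "'a::euclidean_space \<Rightarrow> real"
  assumes S: "open S" "bounded S" and f: "C0bar S f" and nn: "\<And>x. x \<in> S \<Longrightarrow> 0 \<le> f x"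
    and I: "integral S f \<le> 0" and x: "x \<in> S"
  shows "f x = 0"
proof (rule ccontr)
  assume "f x \<noteq> 0"
  then have pos: "f x / 2 > 0" using nn[OF x] by simp
  have "isCont f x" using C0bar_continuous_on[OF f] S(1) x continuous_on_eq_continuous_at by blast
  then obtain d where d: "d > 0" "\<And>y. dist y x < d \<Longrightarrow> dist (f y) (f x) < f x / 2"
    using pos unfolding continuous_at_eps_delta by blast
  obtain d' where d': "d' > 0" "ball x d' \<subseteq> S" using S(1) x open_contains_ball by blast
  define B where "B = ball x (min d d')"
  have B: "B \<subseteq> S" "open B" "B \<noteq> {}" "bounded B" using d d' by (auto simp: B_def)
  have fB: "f x / 2 \<le> f y" if "y \<in> B" for y
    using d(2)[of y] that by (simp add: B_def dist_commute dist_real_def) (smt (verit) field_sum_of_halves)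
  have fi: "f integrable_on S" using C0bar_integrable[OF S f] .
  have "f absolutely_integrable_on B"
    using C0bar_absolutely_integrable[OF S f] B by (rule_tac set_integrable_subset[of lebesgue S]) auto
  then have fiB: "f integrable_on B" using set_lebesgue_integral_eq_integral(1) by blast
  have Bm: "B \<in> lmeasurable" using B lmeasurable_open by auto
  have "0 < measure lebesgue B"
    using d(1) d'(1) by (simp add: B_def content_ball_pos)
  then have "0 < f x / 2 * measure lebesgue B" using pos by simp
  also have "\<dots> = integral B (\<lambda>y. f x / 2)" using Bm by (simp add: lmeasure_integral mult.commute flip: integral_mult_right)
  also have "\<dots> \<le> integral B f"
    using fB Bm by (intro integral_le fiB integrable_on_const) auto
  also have "\<dots> \<le> integral S f" by (rule integral_subset_le[OF B(1) fiB fi]) (simp add: nn)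
  finally show False using I by simp
qed

lemma integral_const_open:
  fixes S :: "'a::euclidean_space set"
  assumes "open S" "bounded S"
  shows "integral S (\<lambda>x. c) = c * measure lebesgue S"
proof -
  have "S \<in> lmeasurable" using assms lmeasurable_open by auto
  then show ?thesis by (simp add: lmeasure_integral flip: integral_mult_right)
qed

section \<open>A convex truncation\<close>

text \<open>\<open>trunc e t\<close> is \<open>(t - e)\<^sup>3 / t\<^sup>2\<close> for \<open>t > e\<close> and \<open>0\<close> otherwise; it is convex and C2, so
  composing it with a function that vanishes on the boundary gives compactly supported test functions.\<close>

definition trunc :: "real \<Rightarrow> real \<Rightarrow> real" where
  "trunc e t = (max e t - e) ^ 3 / (max e t)\<^sup>2"

text \<open>For e > 0, writing everything through \<open>max e t\<close> keeps the denominators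
  positive and lets a single formula, valid for all t, vanish when t \<le> e.\<close>

definition trunc' :: "real \<Rightarrow> real \<Rightarrow> real" where
  "trunc' e t = (1 - e / max e t)\<^sup>2 * (1 + 2 * (e / max e t))"

definition trunc'' :: "real \<Rightarrow> real \<Rightarrow> real" where
  "trunc'' e t = 6 * e\<^sup>2 * (max e t - e) / (max e t) ^ 4"

lemma deriv_zero_of_quadratic_bound:
  fixes g :: "real \<Rightarrow> real"
  assumes "\<And>t. \<bar>g t\<bar> \<le> C * (t - a)\<^sup>2"
  shows "(g has_real_derivative 0) (at a)"
proof -
  have ga: "g a = 0" using assms[of a] by simp
  have "((\<lambda>h. (g (a + h) - g a) / h) \<longlongrightarrow> 0) (at 0)"
  proof (rule Lim_null_comparison)
    show "((\<lambda>h. C * \<bar>h\<bar>) \<longlongrightarrow> 0) (at 0)" by (auto intro!: tendsto_eq_intros)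
    show "\<forall>\<^sub>F h in at 0. norm ((g (a + h) - g a) / h) \<le> C * \<bar>h\<bar>"
    proof (rule eventually_at_filter[THEN iffD2, OF always_eventually], intro allI impI)
      fix h :: real assume "h \<noteq> 0"
      then show "norm ((g (a + h) - g a) / h) \<le> C * \<bar>h\<bar>"
        using assms[of "a + h"] ga by (simp add: abs_divide pos_divide_le_eq power2_eq_square mult.assoc)
    qed
  qed
  then show ?thesis by (simp add: DERIV_def)
qed

text \<open>At the junction a the quadratic bound forces the derivative 0, so the two pieces fit.
  Used once for \<open>trunc\<close> and once for \<open>trunc'\<close>.\<close>

lemma has_real_derivative_piecewise:
  fixes g :: "real \<Rightarrow> real"
  assumes z: "\<And>t. t \<le> a \<Longrightarrow> g t = 0" and e: "\<And>t. a < t \<Longrightarrow> g t = k t"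
    and d: "\<And>t. a < t \<Longrightarrow> (k has_real_derivative k' t) (at t)" and q: "\<And>t. a < t \<Longrightarrow> \<bar>g t\<bar> \<le> C * (t - a)\<^sup>2" and C: "C \<ge> 0"
  shows "(g has_real_derivative (if t \<le> a then 0 else k' t)) (at t)"
proof -
  consider "t < a" | "t = a" | "t > a" by linarith
  then show ?thesis
  proof cases
    case 1
    have "(g has_real_derivative 0) (at t)"
      by (rule has_field_derivative_transform_within_open[OF DERIV_const[of 0] open_lessThan[of a]]) (use 1 z in auto)
    then show ?thesis using 1 by simp
  next
    case 2
    have "\<bar>g t\<bar> \<le> C * (t - a)\<^sup>2" for t using z[of t] q[of t] C by (cases "t \<le> a") auto
    then have "(g has_real_derivative 0) (at a)" by (rule deriv_zero_of_quadratic_bound)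
    then show ?thesis using 2 by simp
  next
    case 3
    have "(g has_real_derivative k' t) (at t)"
      by (rule has_field_derivative_transform_within_open[OF d[OF 3] open_greaterThan[of a]]) (use 3 e in auto)
    then show ?thesis using 3 by simp
  qed
qed

lemma trunc_deriv:
  assumes e: "e > 0"
  shows "(trunc e has_real_derivative trunc' e t) (at t)"
proof -
  have "(trunc e has_real_derivative (if t \<le> e then 0 else (1 - e / t)\<^sup>2 * (1 + 2 * (e / t)))) (at t)"
  proof (rule has_real_derivative_piecewise[where k = "\<lambda>t. (t - e) ^ 3 / t\<^sup>2" and C = "1/e"])
    fix t assume t: "e < t"
    then have t0: "t > 0" using e by simp
    show "((\<lambda>t. (t - e) ^ 3 / t\<^sup>2) has_real_derivative (1 - e / t)\<^sup>2 * (1 + 2 * (e / t))) (at t)"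
      using t0 by (auto intro!: derivative_eq_intros simp: field_simps power2_eq_square power3_eq_cube)
    have "(t - e) * e \<le> t * t" using t e by (intro mult_mono) auto
    then have "(t - e) / t\<^sup>2 \<le> 1 / e" using t0 e by (simp add: field_simps power2_eq_square)
    then have "(t - e) / t\<^sup>2 * (t - e)\<^sup>2 \<le> 1 / e * (t - e)\<^sup>2" by (intro mult_right_mono) auto
    then show "\<bar>trunc e t\<bar> \<le> 1 / e * (t - e)\<^sup>2"
      using t by (simp add: trunc_def power2_eq_square power3_eq_cube)
  qed (use e in \<open>auto simp: trunc_def\<close>)
  moreover have "(if t \<le> e then 0 else (1 - e / t)\<^sup>2 * (1 + 2 * (e / t))) = trunc' e t"
    using e by (auto simp: trunc'_def max_def)
  ultimately show ?thesis by simp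
qed

lemma trunc'_deriv:
  assumes e: "e > 0"
  shows "(trunc' e has_real_derivative trunc'' e t) (at t)"
proof -
  have "(trunc' e has_real_derivative (if t \<le> e then 0 else 6 * e\<^sup>2 * (t - e) / t ^ 4)) (at t)"
  proof (rule has_real_derivative_piecewise[where k = "\<lambda>t. (1 - e / t)\<^sup>2 * (1 + 2 * (e / t))" and C = "3 / e\<^sup>2"])
    fix t assume t: "e < t"
    then have t0: "t > 0" using e by simp
    have "((\<lambda>t. (1 - e / t)\<^sup>2 * (1 + 2 * (e / t))) has_real_derivative
        2 * (1 - e / t) * (e / t\<^sup>2) * (1 + 2 * (e / t)) + (1 - e / t)\<^sup>2 * (2 * (- e / t\<^sup>2))) (at t)"
      using t0 by (auto intro!: derivative_eq_intros simp: field_simps power2_eq_square)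
    moreover have "2 * (1 - e / t) * (e / t\<^sup>2) * (1 + 2 * (e / t)) + (1 - e / t)\<^sup>2 * (2 * (- e / t\<^sup>2)) = 6 * e\<^sup>2 * (t - e) / t ^ 4"
      using t0 by (simp add: field_simps power2_eq_square eval_nat_numeral)
    ultimately show "((\<lambda>t. (1 - e / t)\<^sup>2 * (1 + 2 * (e / t))) has_real_derivative 6 * e\<^sup>2 * (t - e) / t ^ 4) (at t)"
      by simp
    have a: "(1 - e / t)\<^sup>2 = (t - e)\<^sup>2 / t\<^sup>2" using t0 by (simp add: field_simps power2_eq_square)
    have "e / t \<le> 1" using t t0 by simp
    then have b: "1 + 2 * (e / t) \<le> 3" "0 \<le> 1 + 2 * (e / t)" using t0 e by (linarith, simp)
    have c: "(t - e)\<^sup>2 / t\<^sup>2 \<le> (t - e)\<^sup>2 / e\<^sup>2" using t e by (intro divide_left_mono power_mono) auto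
    have "(1 - e / t)\<^sup>2 * (1 + 2 * (e / t)) \<le> (t - e)\<^sup>2 / e\<^sup>2 * 3"
      unfolding a using b c by (intro mult_mono) auto
    then show "\<bar>trunc' e t\<bar> \<le> 3 / e\<^sup>2 * (t - e)\<^sup>2"
      using t b(2) by (simp add: trunc'_def abs_mult mult.commute[of 3])
  qed (use e in \<open>auto simp: trunc'_def\<close>)
  moreover have "(if t \<le> e then 0 else 6 * e\<^sup>2 * (t - e) / t ^ 4) = trunc'' e t"
    using e by (auto simp: trunc''_def max_def)
  ultimately show ?thesis by simp
qed

lemma trunc''_continuous: "e > 0 \<Longrightarrow> continuous_on A (trunc'' e)"
  unfolding trunc''_def by (intro continuous_intros) auto

lemma trunc_continuous: "e > 0 \<Longrightarrow> continuous_on A (trunc e)" "e > 0 \<Longrightarrow> continuous_on A (trunc' e)"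
  unfolding trunc_def trunc'_def by (intro continuous_intros; auto)+

lemma trunc_zero: "e > 0 \<Longrightarrow> t \<le> e \<Longrightarrow> trunc e t = 0" "e > 0 \<Longrightarrow> t \<le> e \<Longrightarrow> trunc' e t = 0" "e > 0 \<Longrightarrow> t \<le> e \<Longrightarrow> trunc'' e t = 0"
  by (auto simp: trunc_def trunc'_def trunc''_def max_def)

text \<open>For t > e put z = e / t, which lies in (0, 1); every claim becomes a polynomial
  inequality in z. The bounds with 3 e are the rates for the limit e to 0 in
  \<open>torsion_identity\<close>, where the last one controls the term weighted by
  \<gamma>.\<close>

lemma trunc_bounds:
  assumes e: "e > 0" and t: "t \<ge> 0"
  shows "0 \<le> trunc e t" "trunc e t \<le> t" "t - 3 * e \<le> trunc e t" "0 \<le> trunc' e t" "trunc' e t \<le> 1"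
    "0 \<le> trunc'' e t" "t * trunc' e t - trunc e t \<le> 3 * e"
proof -
  have *: "0 \<le> trunc e t \<and> trunc e t \<le> t \<and> t - 3 * e \<le> trunc e t \<and> 0 \<le> trunc' e t \<and> trunc' e t \<le> 1
    \<and> 0 \<le> trunc'' e t \<and> t * trunc' e t - trunc e t \<le> 3 * e"
  proof (cases "t \<le> e")
    case True
    then show ?thesis using trunc_zero[OF e True] e t by simp
  next
    case False
    define z where "z = e / t"
    have tp: "t > 0" using False e by simp
    have z: "0 < z" "z < 1" using False e tp by (auto simp: z_def)
    have e': "e = z * t" using tp by (simp add: z_def)
    have f: "trunc e t = t * (1 - z) ^ 3"
      using False tp by (simp add: trunc_def e' field_simps eval_nat_numeral)
    have f': "trunc' e t = (1 - z)\<^sup>2 * (1 + 2 * z)" using False by (simp add: trunc'_def z_def)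
    have f'': "0 \<le> trunc'' e t" using False e by (simp add: trunc''_def)
    have 1: "(1 - z) ^ 3 \<le> 1" using z by (intro power_le_one) auto
    have 2: "1 - 3 * z \<le> (1 - z) ^ 3"
    proof -
      have "(1 - z) ^ 3 - (1 - 3 * z) = z\<^sup>2 * (3 - z)" by (simp add: power2_eq_square eval_nat_numeral algebra_simps)
      also have "\<dots> \<ge> 0" using z by simp
      finally show ?thesis by simp
    qed
    have 3: "(1 - z)\<^sup>2 * (1 + 2 * z) \<le> 1"
    proof -
      have "1 - (1 - z)\<^sup>2 * (1 + 2 * z) = z\<^sup>2 * (3 - 2 * z)" by (simp add: power2_eq_square algebra_simps)
      also have "\<dots> \<ge> 0" using z by simp
      finally show ?thesis by simp
    qed
    have 4: "(1 - z)\<^sup>2 * (1 + 2 * z) - (1 - z) ^ 3 \<le> 3 * z"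
    proof -
      have "(1 - z)\<^sup>2 * (1 + 2 * z) - (1 - z) ^ 3 = 3 * z * (1 - z)\<^sup>2" by (simp add: power2_eq_square eval_nat_numeral algebra_simps)
      also have "\<dots> \<le> 3 * z * 1" using z by (intro mult_left_mono power_le_one) auto
      finally show ?thesis by simp
    qed
    have "t * (1 - z) ^ 3 \<le> t * 1" using 1 tp by (intro mult_left_mono) auto
    moreover have "t * (1 - 3 * z) \<le> t * (1 - z) ^ 3" using 2 tp by (intro mult_left_mono) auto
    moreover have "t * ((1 - z)\<^sup>2 * (1 + 2 * z) - (1 - z) ^ 3) \<le> t * (3 * z)" using 4 tp by (intro mult_left_mono) auto
    moreover have "0 \<le> t * (1 - z) ^ 3" using tp z by simp
    moreover have "0 \<le> (1 - z)\<^sup>2 * (1 + 2 * z)" using z by simp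
    moreover have "t * z = e" using e' by (simp add: mult.commute)
    ultimately show ?thesis using 3 f'' unfolding f f' by (simp add: algebra_simps)
  qed
  then show "0 \<le> trunc e t" "trunc e t \<le> t" "t - 3 * e \<le> trunc e t" "0 \<le> trunc' e t" "trunc' e t \<le> 1"
    "0 \<le> trunc'' e t" "t * trunc' e t - trunc e t \<le> 3 * e" by auto
qed

lemma trunc_pos: "e > 0 \<Longrightarrow> e < t \<Longrightarrow> 0 < trunc e t"
  by (simp add: trunc_def)

lemma dir_deriv_compose:
  assumes "(g has_real_derivative g') (at (f x))" "f differentiable (at x)"
  shows "(\<lambda>x. g (f x)) differentiable (at x)" "dir_deriv (\<lambda>x. g (f x)) v x = g' * dir_deriv f v x"
proof -
  have "((\<lambda>x. g (f x)) has_derivative (\<lambda>v. dir_deriv f v x * g')) (at x)"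
    using has_derivative_compose[OF has_derivative_dir_deriv[OF assms(2)], of g "(*) g'"] assms(1)
    by (simp add: has_field_derivative_def mult.commute)
  then show "(\<lambda>x. g (f x)) differentiable (at x)" "dir_deriv (\<lambda>x. g (f x)) v x = g' * dir_deriv f v x"
    by (auto simp: differentiable_def dir_deriv_eqI)
qed

text \<open>The zero extension of f is continuous on the whole space, and e > 0 excludes the points
  outside S, so the set is closed.\<close>

lemma compact_superlevel:
  fixes f :: "'a::euclidean_space \<Rightarrow> real"
  assumes S: "open S" "bounded S" and f: "C0bar S f" "zero_bdry S f" and e: "e > 0"
  shows "compact {x \<in> S. e \<le> f x}"
proof -
  let ?f = "\<lambda>x. if x \<in> S then f x else 0"
  have "closed {x. e \<le> ?f x}"
    by (rule closed_Collect_le[OF continuous_on_const continuous_on_zero_extension[OF S(1) f]])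
  moreover have "{x. e \<le> ?f x} = {x \<in> S. e \<le> f x}" using e by auto
  ultimately show ?thesis using S(2) bounded_subset[of S "{x \<in> S. e \<le> f x}"] by (simp add: compact_eq_bounded_closed)
qed

section \<open>A calculus of explicit gradients\<close>

definition grad_bar :: "'a::euclidean_space set \<Rightarrow> ('a \<Rightarrow> real) \<Rightarrow> ('a \<Rightarrow> 'a \<Rightarrow> real) \<Rightarrow> bool" where
  "grad_bar S f D \<longleftrightarrow> C1bar S f \<and> (\<forall>x\<in>S. \<forall>i\<in>Basis. dir_deriv f i x = D i x)"

named_theorems grad_intros

lemma grad_bar_const [grad_intros]: "grad_bar S (\<lambda>x. c) (\<lambda>i x. 0)"
  by (auto simp: grad_bar_def)

lemma grad_bar_inner [grad_intros]: "grad_bar S (\<lambda>x. x \<bullet> b) (\<lambda>i x. i \<bullet> b)"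
  by (auto simp: grad_bar_def)

lemma grad_bar_add [grad_intros]: "grad_bar S f f' \<Longrightarrow> grad_bar S g g' \<Longrightarrow> grad_bar S (\<lambda>x. f x + g x) (\<lambda>i x. f' i x + g' i x)"
  by (auto simp: grad_bar_def dir_deriv_add C1barD)

lemma grad_bar_diff [grad_intros]: "grad_bar S f f' \<Longrightarrow> grad_bar S g g' \<Longrightarrow> grad_bar S (\<lambda>x. f x - g x) (\<lambda>i x. f' i x - g' i x)"
  by (auto simp: grad_bar_def dir_deriv_diff C1barD)

lemma grad_bar_mult [grad_intros]: "grad_bar S f f' \<Longrightarrow> grad_bar S g g' \<Longrightarrow> grad_bar S (\<lambda>x. f x * g x) (\<lambda>i x. f x * g' i x + f' i x * g x)"
  by (auto simp: grad_bar_def dir_deriv_mult C1barD)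

lemma grad_bar_cmult: "grad_bar S f f' \<Longrightarrow> grad_bar S (\<lambda>x. k * f x) (\<lambda>i x. k * f' i x)"
  using grad_bar_mult[OF grad_bar_const[of S k], of f f'] by simp

lemma grad_bar_power2 [grad_intros]: "grad_bar S f f' \<Longrightarrow> grad_bar S (\<lambda>x. (f x)\<^sup>2) (\<lambda>i x. 2 * (f x * f' i x))"
  using grad_bar_mult[of S f f' f f'] by (simp add: power2_eq_square mult.commute)

lemma grad_bar_sum [grad_intros]: "(\<And>k. k \<in> I \<Longrightarrow> grad_bar S (f k) (f' k)) \<Longrightarrow> grad_bar S (\<lambda>x. \<Sum>k\<in>I. f k x) (\<lambda>i x. \<Sum>k\<in>I. f' k i x)"
proof -
  assume a: "\<And>k. k \<in> I \<Longrightarrow> grad_bar S (f k) (f' k)"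
  have "dir_deriv (\<lambda>x. \<Sum>k\<in>I. f k x) i x = (\<Sum>k\<in>I. f' k i x)" if "x \<in> S" "i \<in> Basis" for i x
  proof -
    have "dir_deriv (\<lambda>x. \<Sum>k\<in>I. f k x) i x = (\<Sum>k\<in>I. dir_deriv (f k) i x)"
      by (rule dir_deriv_sum) (use a that(1) in \<open>unfold grad_bar_def C1bar_def, blast\<close>)
    also have "\<dots> = (\<Sum>k\<in>I. f' k i x)"
      by (rule sum.cong) (use a that in \<open>auto simp: grad_bar_def\<close>)
    finally show ?thesis .
  qed
  moreover have "C1bar S (\<lambda>x. \<Sum>k\<in>I. f k x)" using a by (intro C1bar_sum) (auto simp: grad_bar_def)
  ultimately show ?thesis by (simp add: grad_bar_def)
qed

lemma grad_barD:
  assumes "grad_bar S f D"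
  shows "C1bar S f" "\<And>x i. x \<in> S \<Longrightarrow> i \<in> Basis \<Longrightarrow> dir_deriv f i x = D i x"
    "\<And>i. i \<in> Basis \<Longrightarrow> C0bar S (D i)"
proof -
  show 1: "C1bar S f" and 2: "\<And>x i. x \<in> S \<Longrightarrow> i \<in> Basis \<Longrightarrow> dir_deriv f i x = D i x"
    using assms by (auto simp: grad_bar_def)
  show "C0bar S (D i)" if "i \<in> Basis" for i
    by (rule C0bar_cong[OF C1barD(3)[OF 1 that]]) (simp add: 2 that)
qed

lemma grad_bar_cong:
  assumes "grad_bar S f D" "\<And>x i. x \<in> S \<Longrightarrow> i \<in> Basis \<Longrightarrow> D i x = D' i x"
  shows "grad_bar S f D'"
  using assms by (simp add: grad_bar_def)

text \<open>The working form of the divergence theorem. The rules \<open>grad_intros\<close> derive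
  the array D from the shape of F, so that each application is left with the boundary behaviour of F
  and an algebraic identity for E.\<close>

lemma divergence_zero_grad:
  assumes S: "open S" "bounded S" and F: "\<And>i. i \<in> Basis \<Longrightarrow> grad_bar S (F i) (D i)"
    and z: "\<And>i. i \<in> Basis \<Longrightarrow> zero_bdry S (F i)" and E: "\<And>x. x \<in> S \<Longrightarrow> E x = (\<Sum>i\<in>Basis. D i i x)"
  shows "integral S E = 0"
  by (rule divergence_zero[OF S grad_barD(1)[OF F] z]) (auto simp: E grad_barD(2)[OF F])

lemma tendsto_cong_within:
  assumes "\<And>x. x \<in> S \<Longrightarrow> f x = g x"
  shows "(f \<longlongrightarrow> l) (at p within S) \<longleftrightarrow> (g \<longlongrightarrow> l) (at p within S)"
  by (rule filterlim_cong) (auto simp: eventually_at_filter assms)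

lemma bval_cong: "(\<And>x. x \<in> S \<Longrightarrow> f x = g x) \<Longrightarrow> bval S f p = bval S g p"
  unfolding bval_def Topological_Spaces.Lim_def by (subst tendsto_cong_within[of S f g]) auto

lemma normal_deriv_cong:
  assumes "open S" "\<And>x. x \<in> S \<Longrightarrow> f x = g x"
  shows "normal_deriv S f p = normal_deriv S g p"
proof -
  have "bval S (dir_deriv f i) p = bval S (dir_deriv g i) p" for i
    by (rule bval_cong) (rule dir_deriv_cong[OF assms(1) _ assms(2)])
  then show ?thesis by (simp add: normal_deriv_def)
qed

lemma sum_Basis_inner_delta:
  assumes "a \<in> (Basis :: 'a::euclidean_space set)"
  shows "(\<Sum>i\<in>Basis. (a \<bullet> i) * f i) = f a" "(\<Sum>i\<in>Basis. f i * (a \<bullet> i)) = f a"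
    "(\<Sum>i\<in>Basis. (i \<bullet> a) * f i) = f a" "(\<Sum>i\<in>Basis. f i * (i \<bullet> a)) = f a"
proof -
  have "(\<Sum>i\<in>Basis. (a \<bullet> i) * f i) = (\<Sum>i\<in>Basis. if a = i then f i else 0)"
    using assms by (intro sum.cong) (auto simp: inner_Basis)
  also have "\<dots> = f a" using assms by simp
  finally show *: "(\<Sum>i\<in>Basis. (a \<bullet> i) * f i) = f a" .
  show "(\<Sum>i\<in>Basis. f i * (a \<bullet> i)) = f a" using * by (simp add: mult.commute)
  show "(\<Sum>i\<in>Basis. (i \<bullet> a) * f i) = f a" using * by (simp add: inner_commute[of a])
  show "(\<Sum>i\<in>Basis. f i * (i \<bullet> a)) = f a" using * by (simp add: inner_commute[of a] mult.commute)
qed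

section \<open>The overdetermined problem and the symmetry of the partial derivatives\<close>

locale overdetermined =
  fixes \<Omega> :: "'a::euclidean_space set" and u :: "'a \<Rightarrow> real" and c :: real
  assumes n2: "DIM('a) \<ge> 2"
    and opn: "open \<Omega>" and conn: "connected \<Omega>" and bdd: "bounded \<Omega>" and ne: "\<Omega> \<noteq> {}"
    and ldf: "\<And>p. p \<in> frontier \<Omega> \<Longrightarrow> \<exists>r \<phi>. local_defining_fun \<Omega> p r \<phi>"
    and reg: "Ck_closure 6 \<Omega> u"
    and pde: "\<forall>x\<in>\<Omega>. laplacian (laplacian (laplacian u)) x = -1"
    and bc0: "\<forall>p\<in>frontier \<Omega>. u p = 0"
    and bc1: "\<forall>p\<in>frontier \<Omega>. normal_deriv \<Omega> u p = 0"
    and bc2: "\<forall>p\<in>frontier \<Omega>. bval \<Omega> (laplacian u) p = 0"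
    and bc3: "\<forall>p\<in>frontier \<Omega>. normal_deriv \<Omega> (laplacian u) p = c"
begin

text \<open>\<open>T [i\<^sub>1, \<dots>, i\<^sub>k]\<close> is the partial derivative of \<open>u\<close>, extended by zero so that its
  symmetry in the indices needs no side conditions; \<open>V\<close> and \<open>W\<close> play the same role for
  \<open>\<Delta> u\<close> and \<open>\<Delta>\<^sup>2 u\<close>.\<close>

definition T :: "'a list \<Rightarrow> 'a \<Rightarrow> real" where
  "T vs x = (if x \<in> \<Omega> \<and> set vs \<subseteq> Basis then iter_deriv vs u x else 0)"

definition V :: "'a list \<Rightarrow> 'a \<Rightarrow> real" where
  "V vs x = (\<Sum>k\<in>Basis. T (vs @ [k, k]) x)"

definition W :: "'a list \<Rightarrow> 'a \<Rightarrow> real" where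
  "W vs x = (\<Sum>k\<in>Basis. V (vs @ [k, k]) x)"

definition n :: real where "n = real DIM('a)"

lemma n_ge_2: "n \<ge> 2" using n2 by (simp add: n_def)

lemma T_C0: "length vs \<le> 6 \<Longrightarrow> C0bar \<Omega> (T vs)"
proof (cases "set vs \<subseteq> Basis")
  case True
  assume "length vs \<le> 6"
  then have "C0bar \<Omega> (iter_deriv vs u)" using reg True unfolding Ck_closure_def C0bar_def by blast
  then show ?thesis by (rule C0bar_cong) (simp add: T_def True)
next
  case False
  then have "T vs = (\<lambda>x. 0)" by (simp add: T_def fun_eq_iff)
  then show ?thesis by simp
qed

lemma iter_deriv_differentiable:
  "length vs \<le> 5 \<Longrightarrow> set vs \<subseteq> Basis \<Longrightarrow> x \<in> \<Omega> \<Longrightarrow> iter_deriv vs u differentiable (at x)"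
  using reg unfolding Ck_closure_def Ck_on_def by auto

lemma T_differentiable:
  assumes "length vs \<le> 5" "x \<in> \<Omega>"
  shows "T vs differentiable (at x)"
proof (cases "set vs \<subseteq> Basis")
  case True
  show ?thesis
    by (rule differentiable_cong_open[OF opn assms(2) _ iter_deriv_differentiable[OF assms(1) True assms(2)]])
      (simp add: T_def True)
next
  case False
  then have "T vs = (\<lambda>x. 0)" by (simp add: T_def fun_eq_iff)
  then show ?thesis by simp
qed

lemma dir_deriv_T:
  assumes "length vs \<le> 5" "x \<in> \<Omega>" "i \<in> Basis"
  shows "dir_deriv (T vs) i x = T (i # vs) x"
proof (cases "set vs \<subseteq> Basis")
  case True
  have "dir_deriv (T vs) i x = dir_deriv (iter_deriv vs u) i x"
    by (rule dir_deriv_cong[OF opn assms(2)]) (simp add: T_def True)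
  then show ?thesis using assms True by (simp add: T_def)
next
  case False
  then have "T vs = (\<lambda>x. 0)" "T (i # vs) = (\<lambda>x. 0)" by (simp_all add: T_def fun_eq_iff)
  then show ?thesis by simp
qed

lemma T_grad [grad_intros]: "length vs \<le> 5 \<Longrightarrow> grad_bar \<Omega> (T vs) (\<lambda>i. T (i # vs))"
  unfolding grad_bar_def C1bar_def
  by (auto intro!: T_C0 T_differentiable C0bar_cong[of \<Omega> "T (_ # vs)" "dir_deriv (T vs) _"] simp: dir_deriv_T)

lemma T_swap: "length vs \<le> 4 \<Longrightarrow> T (i # j # vs) x = T (j # i # vs) x"
proof (cases "x \<in> \<Omega> \<and> set (i # j # vs) \<subseteq> Basis")
  case True
  assume len: "length vs \<le> 4"
  have c: "continuous_on \<Omega> (iter_deriv (a # b # vs) u)" if "a \<in> Basis" "b \<in> Basis" for a b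
  proof -
    have "\<forall>vs. length vs \<le> 6 \<longrightarrow> set vs \<subseteq> Basis \<longrightarrow> continuous_on \<Omega> (iter_deriv vs u)"
      using reg unfolding Ck_closure_def Ck_on_def by blast
    from this[rule_format, of "a # b # vs"] show ?thesis using True len that by simp
  qed
  have "dir_deriv (dir_deriv (iter_deriv vs u) j) i x = dir_deriv (dir_deriv (iter_deriv vs u) i) j x"
  proof (rule dir_deriv_commute[OF opn])
    show "dir_deriv (iter_deriv vs u) j differentiable at y" "dir_deriv (iter_deriv vs u) i differentiable at y"
      if "y \<in> \<Omega>" for y
      using iter_deriv_differentiable[of "j # vs" y] iter_deriv_differentiable[of "i # vs" y] True len that by auto
  qed (use True len c[of i j] c[of j i] iter_deriv_differentiable[of vs] in auto)
  then show ?thesis using True by (simp add: T_def)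
qed (auto simp: T_def)

lemma T_Cons_cong:
  assumes "T vs = T ws" "length vs \<le> 5" "length ws \<le> 5"
  shows "T (a # vs) = T (a # ws)"
proof
  fix x
  show "T (a # vs) x = T (a # ws) x"
  proof (cases "x \<in> \<Omega> \<and> a \<in> Basis")
    case True
    then show ?thesis using dir_deriv_T[of vs x a] dir_deriv_T[of ws x a] assms by simp
  qed (auto simp: T_def)
qed

lemma T_move: "length (xs @ a # ys) \<le> 6 \<Longrightarrow> T (xs @ a # ys) = T (a # xs @ ys)"
proof (induction xs)
  case (Cons b xs)
  then have "T (b # (xs @ a # ys)) = T (b # (a # xs @ ys))" by (intro T_Cons_cong) auto
  also have "\<dots> = T (a # b # xs @ ys)" using Cons.prems by (intro ext T_swap) auto
  finally show ?case by simp
qed simp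

text \<open>Swapping the two outermost derivatives (\<open>T_swap\<close>, by equality of mixed
  derivatives) and differentiating an equality (\<open>T_Cons_cong\<close>) generate all
  permutations; \<open>T_move\<close> is the resulting insertion step.\<close>

lemma T_perm: "mset vs = mset ws \<Longrightarrow> length vs \<le> 6 \<Longrightarrow> T vs = T ws"
proof (induction vs arbitrary: ws)
  case (Cons a vs)
  then have len: "length ws = Suc (length vs)" by (metis size_mset length_Cons)
  have "a \<in> set ws" using Cons.prems(1) by (metis list.set_intros(1) set_mset_mset)
  then obtain xs ys where ws: "ws = xs @ a # ys" by (meson split_list)
  then have "mset vs = mset (xs @ ys)" using Cons.prems(1) by simp
  then have "T vs = T (xs @ ys)" using Cons by simp
  then have "T (a # vs) = T (a # xs @ ys)" using Cons.prems len ws by (intro T_Cons_cong) auto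
  also have "\<dots> = T ws" using T_move[of xs a ys] Cons.prems len ws by simp
  finally show ?case .
qed simp

lemma V_grad [grad_intros]: "length vs \<le> 3 \<Longrightarrow> grad_bar \<Omega> (V vs) (\<lambda>i. V (i # vs))"
  unfolding V_def[abs_def] append_Cons by (intro grad_intros) simp

lemma W_grad [grad_intros]: "length vs \<le> 1 \<Longrightarrow> grad_bar \<Omega> (W vs) (\<lambda>i. W (i # vs))"
  unfolding W_def[abs_def] append_Cons by (intro grad_intros) simp

lemma V_C0: "length vs \<le> 4 \<Longrightarrow> C0bar \<Omega> (V vs)"
  unfolding V_def[abs_def] by (intro C0bar_sum T_C0) simp

lemma W_C0: "length vs \<le> 2 \<Longrightarrow> C0bar \<Omega> (W vs)"
  unfolding W_def[abs_def] by (intro C0bar_sum V_C0) simp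

text \<open>Multisets make the position of the contracted pair irrelevant: by symmetry of the
  partial derivatives, any two slots filled with k give a Laplacian.\<close>

lemma T_trace:
  assumes "\<And>k. mset (f k) = {#k, k#} + mset vs" "length vs \<le> 4"
  shows "(\<Sum>k\<in>Basis. T (f k) x) = V vs x"
  unfolding V_def
proof (rule sum.cong)
  fix k :: 'a
  have "mset (f k) = mset (vs @ [k, k])" using assms(1) by simp
  moreover have "size (mset (f k)) = size ({#k, k#} + mset vs)" using assms(1) by simp
  then have "length (f k) \<le> 6" using assms(2) by simp
  ultimately show "T (f k) x = T (vs @ [k, k]) x" using T_perm by metis
qed simp

lemma laplacian_u: "x \<in> \<Omega> \<Longrightarrow> laplacian u x = V [] x"
  by (simp add: laplacian_def V_def T_def)

lemma laplacian_laplacian_u: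
  assumes x: "x \<in> \<Omega>" shows "laplacian (laplacian u) x = W [] x"
proof -
  have 1: "dir_deriv (laplacian u) i y = V [i] y" if "y \<in> \<Omega>" "i \<in> Basis" for i y
    using dir_deriv_cong[OF opn that(1) laplacian_u] grad_barD(2)[OF V_grad[of "[]"] that] by simp
  have "dir_deriv (dir_deriv (laplacian u) i) i x = V [i, i] x" if "i \<in> Basis" for i
    using dir_deriv_cong[OF opn x 1[OF _ that]] grad_barD(2)[OF V_grad[of "[i]"] x that] by simp
  then show ?thesis by (simp add: laplacian_def W_def)
qed

lemma W_trace: assumes x: "x \<in> \<Omega>" shows "(\<Sum>i\<in>Basis. W [i, i] x) = -1"
proof -
  have 1: "dir_deriv (laplacian (laplacian u)) i y = W [i] y" if "y \<in> \<Omega>" "i \<in> Basis" for i y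
    using dir_deriv_cong[OF opn that(1) laplacian_laplacian_u] grad_barD(2)[OF W_grad[of "[]"] that] by simp
  have "dir_deriv (dir_deriv (laplacian (laplacian u)) i) i x = W [i, i] x" if "i \<in> Basis" for i
    using dir_deriv_cong[OF opn x 1[OF _ that]] grad_barD(2)[OF W_grad[of "[i]"] x that] by simp
  then have "laplacian (laplacian (laplacian u)) x = (\<Sum>i\<in>Basis. W [i, i] x)" by (simp add: laplacian_def)
  then show ?thesis using pde x by simp
qed

lemma V_perm: "mset vs = mset ws \<Longrightarrow> length vs \<le> 4 \<Longrightarrow> V vs = V ws"
  unfolding V_def[abs_def] by (intro ext sum.cong refl fun_cong[OF T_perm]) auto

lemma W_perm: "mset vs = mset ws \<Longrightarrow> length vs \<le> 2 \<Longrightarrow> W vs = W ws"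
  unfolding W_def[abs_def] by (intro ext sum.cong refl fun_cong[OF V_perm]) auto

lemma V_trace:
  assumes "\<And>k. mset (f k) = {#k, k#} + mset vs" "length vs \<le> 2"
  shows "(\<Sum>k\<in>Basis. V (f k) x) = W vs x"
  unfolding W_def
proof (rule sum.cong)
  fix k :: 'a
  have "mset (f k) = mset (vs @ [k, k])" using assms(1) by simp
  moreover have "size (mset (f k)) = size ({#k, k#} + mset vs)" using assms(1) by simp
  then have "length (f k) \<le> 4" using assms(2) by simp
  ultimately show "V (f k) x = V (vs @ [k, k]) x" using V_perm by metis
qed simp

section \<open>Boundary values\<close>

abbreviation \<nu> :: "'a \<Rightarrow> 'a" where "\<nu> p \<equiv> outward_normal \<Omega> p"

lemma nu_sum: "p \<in> frontier \<Omega> \<Longrightarrow> (\<Sum>i\<in>Basis. (\<nu> p \<bullet> i) * (\<nu> p \<bullet> i)) = 1"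
  using norm_outward_normal[OF ldf] by (simp add: euclidean_inner[symmetric] norm_eq_1)

lemma T_bval: "p \<in> frontier \<Omega> \<Longrightarrow> length vs \<le> 6 \<Longrightarrow> (T vs \<longlongrightarrow> bval \<Omega> (T vs) p) (at p within \<Omega>)"
  by (rule C0bar_bval[OF opn _ T_C0])

lemma T_bval_eqI:
  assumes "p \<in> frontier \<Omega>" "length vs \<le> 6" "(T vs \<longlongrightarrow> l) (at p within \<Omega>)"
  shows "bval \<Omega> (T vs) p = l"
  using tendsto_unique[OF frontier_within_nontrivial[OF opn assms(1)] T_bval[OF assms(1,2)] assms(3)] .

text \<open>One rung of a bootstrap: as soon as a partial derivative vanishes on the boundary, its
  gradient there is normal. It is applied to u, \<nabla>u and D^2 u in turn.\<close>

lemma T_bval_gradient: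
  assumes p: "p \<in> frontier \<Omega>" and z: "zero_bdry \<Omega> (T vs)" and l: "length vs \<le> 5" and i: "i \<in> Basis"
  shows "bval \<Omega> (T (i # vs)) p = normal_deriv \<Omega> (T vs) p * (\<nu> p \<bullet> i)"
proof (rule T_bval_eqI[OF p])
  have "(dir_deriv (T vs) i \<longlongrightarrow> normal_deriv \<Omega> (T vs) p * (\<nu> p \<bullet> i)) (at p within \<Omega>)"
    by (rule bdry_gradient[OF opn bdd grad_barD(1)[OF T_grad[OF l]] z p ldf[OF p] i])
  then show "(T (i # vs) \<longlongrightarrow> normal_deriv \<Omega> (T vs) p * (\<nu> p \<bullet> i)) (at p within \<Omega>)"
    by (subst (asm) tendsto_cong_within[OF dir_deriv_T]) (use l i in auto)
qed (use l in simp)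

lemma T0_zero_bdry: "zero_bdry \<Omega> (T [])"
  unfolding zero_bdry_def
proof
  fix p assume p: "p \<in> frontier \<Omega>"
  have "continuous_on (closure \<Omega>) u" using reg unfolding Ck_closure_def by blast
  then have "(u \<longlongrightarrow> u p) (at p within closure \<Omega>)" using p by (auto simp: continuous_on_def frontier_def)
  then have "(u \<longlongrightarrow> 0) (at p within \<Omega>)"
    using bc0 p tendsto_within_subset[OF _ closure_subset] by metis
  then show "(T [] \<longlongrightarrow> 0) (at p within \<Omega>)"
    by (subst tendsto_cong_within[of \<Omega> "T []" u]) (auto simp: T_def)
qed

lemma zero_bdry_of_bval:
  assumes "\<And>p. p \<in> frontier \<Omega> \<Longrightarrow> bval \<Omega> (T vs) p = 0" "length vs \<le> 6"
  shows "zero_bdry \<Omega> (T vs)"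
  unfolding zero_bdry_def using T_bval assms by metis

lemma T_not_Basis: "\<not> set vs \<subseteq> Basis \<Longrightarrow> T vs = (\<lambda>x. 0)"
  by (simp add: T_def fun_eq_iff)

lemma T1_zero_bdry: "zero_bdry \<Omega> (T [i])"
proof (cases "i \<in> Basis")
  case True
  have "normal_deriv \<Omega> (T []) p = normal_deriv \<Omega> u p" for p
    by (rule normal_deriv_cong[OF opn]) (simp add: T_def)
  then show ?thesis
    using T_bval_gradient[OF _ T0_zero_bdry _ True] bc1 by (intro zero_bdry_of_bval) auto
qed (simp add: T_not_Basis zero_bdry_const)

lemma bval_V:
  assumes p: "p \<in> frontier \<Omega>" and l: "length vs \<le> 4"
  shows "(V vs \<longlongrightarrow> (\<Sum>k\<in>Basis. bval \<Omega> (T (vs @ [k, k])) p)) (at p within \<Omega>)"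
  unfolding V_def[abs_def] using l by (intro tendsto_sum T_bval[OF p]) auto

lemma V0_zero_bdry: "zero_bdry \<Omega> (V [])"
  unfolding zero_bdry_def
proof
  fix p assume p: "p \<in> frontier \<Omega>"
  have "(V [] \<longlongrightarrow> bval \<Omega> (V []) p) (at p within \<Omega>)" by (rule C0bar_bval[OF opn p V_C0]) simp
  moreover have "bval \<Omega> (V []) p = bval \<Omega> (laplacian u) p" by (rule bval_cong) (simp add: laplacian_u)
  ultimately show "(V [] \<longlongrightarrow> 0) (at p within \<Omega>)" using bc2 p by simp
qed

text \<open>Since \<nabla>u = 0 on the boundary, D^2 u has there the entries \<mu>_j \<nu>_i.
  Symmetry makes it a multiple of \<nu> \<otimes> \<nu>, and the multiple is its trace \<Delta>u =
  0.\<close>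

lemma T2_zero_bdry: "zero_bdry \<Omega> (T [i, j])"
proof (cases "i \<in> Basis \<and> j \<in> Basis")
  case True
  show ?thesis
  proof (rule zero_bdry_of_bval)
    fix p assume p: "p \<in> frontier \<Omega>"
    define \<mu> where "\<mu> j = normal_deriv \<Omega> (T [j]) p" for j
    have B: "bval \<Omega> (T [i, j]) p = \<mu> j * (\<nu> p \<bullet> i)" if "i \<in> Basis" for i j
      unfolding \<mu>_def by (rule T_bval_gradient[OF p T1_zero_bdry _ that]) simp
    have sym: "\<mu> j * (\<nu> p \<bullet> i) = \<mu> i * (\<nu> p \<bullet> j)" if "i \<in> Basis" "j \<in> Basis" for i j
      using B[OF that(1), of j] B[OF that(2), of i] T_perm[of "[i, j]" "[j, i]"] by simp
    have "(\<Sum>k\<in>Basis. bval \<Omega> (T ([] @ [k, k])) p) = 0"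
      by (rule tendsto_unique[OF frontier_within_nontrivial[OF opn p] bval_V[OF p]])
        (use V0_zero_bdry p in \<open>auto simp: zero_bdry_def\<close>)
    then have tr: "(\<Sum>k\<in>Basis. \<mu> k * (\<nu> p \<bullet> k)) = 0" using B by simp
    have "\<mu> j = (\<Sum>i\<in>Basis. \<mu> j * ((\<nu> p \<bullet> i) * (\<nu> p \<bullet> i)))"
      using nu_sum[OF p] by (simp add: sum_distrib_left[symmetric])
    also have "\<dots> = (\<Sum>i\<in>Basis. (\<nu> p \<bullet> j) * (\<mu> i * (\<nu> p \<bullet> i)))"
    proof (rule sum.cong)
      fix i :: 'a assume i: "i \<in> Basis"
      have "\<mu> j * ((\<nu> p \<bullet> i) * (\<nu> p \<bullet> i)) = (\<mu> j * (\<nu> p \<bullet> i)) * (\<nu> p \<bullet> i)" by simp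
      also have "\<dots> = (\<mu> i * (\<nu> p \<bullet> j)) * (\<nu> p \<bullet> i)" using sym[of i j] i True by simp
      finally show "\<mu> j * ((\<nu> p \<bullet> i) * (\<nu> p \<bullet> i)) = (\<nu> p \<bullet> j) * (\<mu> i * (\<nu> p \<bullet> i))" by (simp only: ac_simps)
    qed simp
    also have "\<dots> = 0" using tr by (simp add: sum_distrib_left[symmetric])
    finally show "bval \<Omega> (T [i, j]) p = 0" using B True by simp
  qed simp
next
  case False
  then show ?thesis by (auto simp: T_not_Basis zero_bdry_const)
qed

text \<open>The argument for D^2 u one order higher, with two rounds of symmetry: \<open>m1\<close>
  splits off \<nu> in the second index and \<open>l1\<close> in the third. The scalar t that remains
  is the normal derivative of \<Delta>u, that is c.\<close>

lemma bval_T3: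
  assumes p: "p \<in> frontier \<Omega>" and ijk: "i \<in> Basis" "j \<in> Basis" "k \<in> Basis"
  shows "(T [i, j, k] \<longlongrightarrow> c * (\<nu> p \<bullet> i) * (\<nu> p \<bullet> j) * (\<nu> p \<bullet> k)) (at p within \<Omega>)"
proof -
  define \<mu> where "\<mu> j k = normal_deriv \<Omega> (T [j, k]) p" for j k
  have B: "bval \<Omega> (T [i, j, k]) p = \<mu> j k * (\<nu> p \<bullet> i)" if "i \<in> Basis" for i j k
    unfolding \<mu>_def by (rule T_bval_gradient[OF p T2_zero_bdry _ that]) simp
  have sym: "\<mu> j k * (\<nu> p \<bullet> i) = \<mu> i k * (\<nu> p \<bullet> j)" if "i \<in> Basis" "j \<in> Basis" for i j k
    using B[OF that(1), of j k] B[OF that(2), of i k] T_perm[of "[i, j, k]" "[j, i, k]"] by simp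
  have sym': "\<mu> j k = \<mu> k j" for j k
    unfolding \<mu>_def using T_perm[of "[j, k]" "[k, j]"] by simp
  define l where "l k = (\<Sum>i\<in>Basis. \<mu> i k * (\<nu> p \<bullet> i))" for k
  have m1: "\<mu> j k = (\<nu> p \<bullet> j) * l k" if "j \<in> Basis" for j k
  proof -
    have "\<mu> j k = (\<Sum>i\<in>Basis. \<mu> j k * ((\<nu> p \<bullet> i) * (\<nu> p \<bullet> i)))"
      using nu_sum[OF p] by (simp add: sum_distrib_left[symmetric])
    also have "\<dots> = (\<Sum>i\<in>Basis. (\<nu> p \<bullet> j) * (\<mu> i k * (\<nu> p \<bullet> i)))"
    proof (rule sum.cong)
      fix i :: 'a assume i: "i \<in> Basis"
      have "\<mu> j k * ((\<nu> p \<bullet> i) * (\<nu> p \<bullet> i)) = (\<mu> j k * (\<nu> p \<bullet> i)) * (\<nu> p \<bullet> i)" by simp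
      also have "\<dots> = (\<mu> i k * (\<nu> p \<bullet> j)) * (\<nu> p \<bullet> i)" using sym[of i j k] i that by simp
      finally show "\<mu> j k * ((\<nu> p \<bullet> i) * (\<nu> p \<bullet> i)) = (\<nu> p \<bullet> j) * (\<mu> i k * (\<nu> p \<bullet> i))" by (simp only: ac_simps)
    qed simp
    finally show ?thesis by (simp add: l_def sum_distrib_left)
  qed
  define t where "t = (\<Sum>i\<in>Basis. l i * (\<nu> p \<bullet> i))"
  have l1: "l k = t * (\<nu> p \<bullet> k)" if "k \<in> Basis" for k
  proof -
    have "l k = (\<Sum>i\<in>Basis. \<mu> k i * (\<nu> p \<bullet> i))" unfolding l_def using sym' by simp
    also have "\<dots> = (\<Sum>i\<in>Basis. (\<nu> p \<bullet> k) * (l i * (\<nu> p \<bullet> i)))" using m1[OF that] by (simp add: mult.assoc)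
    also have "\<dots> = (\<nu> p \<bullet> k) * t" by (simp add: t_def sum_distrib_left)
    finally show ?thesis by simp
  qed
  have B': "bval \<Omega> (T [i, j, k]) p = t * (\<nu> p \<bullet> i) * (\<nu> p \<bullet> j) * (\<nu> p \<bullet> k)"
    if "i \<in> Basis" "j \<in> Basis" "k \<in> Basis" for i j k
    using B m1 l1 that by simp
  have "bval \<Omega> (dir_deriv (laplacian u) i) p = t * (\<nu> p \<bullet> i)" if i: "i \<in> Basis" for i
  proof -
    have "bval \<Omega> (dir_deriv (laplacian u) i) p = bval \<Omega> (V [i]) p"
    proof (rule bval_cong)
      fix x assume x: "x \<in> \<Omega>"
      show "dir_deriv (laplacian u) i x = V [i] x"
        using dir_deriv_cong[OF opn x laplacian_u] grad_barD(2)[OF V_grad[of "[]"] x i] by simp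
    qed
    also have "\<dots> = (\<Sum>k\<in>Basis. bval \<Omega> (T ([i] @ [k, k])) p)"
      by (rule tendsto_unique[OF frontier_within_nontrivial[OF opn p] C0bar_bval[OF opn p V_C0] bval_V[OF p]]) auto
    also have "\<dots> = (\<Sum>k\<in>Basis. t * (\<nu> p \<bullet> i) * ((\<nu> p \<bullet> k) * (\<nu> p \<bullet> k)))"
      using i B' by (intro sum.cong) auto
    also have "\<dots> = t * (\<nu> p \<bullet> i)" using nu_sum[OF p] by (simp add: sum_distrib_left[symmetric])
    finally show ?thesis .
  qed
  then have "normal_deriv \<Omega> (laplacian u) p = (\<Sum>i\<in>Basis. t * ((\<nu> p \<bullet> i) * (\<nu> p \<bullet> i)))"
    unfolding normal_deriv_def inner_sum_left
    by (intro sum.cong refl) (simp add: inner_commute[of _ "\<nu> p"])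
  then have "t = c" using bc3 p nu_sum[OF p] by (simp add: sum_distrib_left[symmetric])
  then show ?thesis using T_bval[OF p, of "[i, j, k]"] B' ijk by simp
qed

lemma V1_bdry:
  assumes p: "p \<in> frontier \<Omega>" and i: "i \<in> Basis"
  shows "(V [i] \<longlongrightarrow> c * (\<nu> p \<bullet> i)) (at p within \<Omega>)"
proof -
  have "((\<lambda>x. \<Sum>k\<in>Basis. T ([i] @ [k, k]) x) \<longlongrightarrow> (\<Sum>k\<in>Basis. c * (\<nu> p \<bullet> i) * (\<nu> p \<bullet> k) * (\<nu> p \<bullet> k))) (at p within \<Omega>)"
    using bval_T3[OF p i] by (intro tendsto_sum) auto
  moreover have "(\<Sum>k\<in>Basis. c * (\<nu> p \<bullet> i) * (\<nu> p \<bullet> k) * (\<nu> p \<bullet> k)) = c * (\<nu> p \<bullet> i)"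
    using nu_sum[OF p] by (simp add: sum_distrib_left[symmetric] mult.assoc)
  ultimately show ?thesis unfolding V_def[abs_def] by simp
qed

end

section \<open>Energy integrals and the Pohozaev identity\<close>

lemma sum_rot3: "(\<Sum>a\<in>A. \<Sum>b\<in>A. \<Sum>c\<in>A. f a b c) = (\<Sum>b\<in>A. \<Sum>c\<in>A. \<Sum>a\<in>A. (f a b c :: real))"
  by (subst sum.swap) (rule sum.cong[OF refl], rule sum.swap)

lemma sum_rot4: "(\<Sum>a\<in>A. \<Sum>b\<in>A. \<Sum>c\<in>A. \<Sum>d\<in>A. f a b c d) = (\<Sum>b\<in>A. \<Sum>c\<in>A. \<Sum>d\<in>A. \<Sum>a\<in>A. (f a b c d :: real))"
  by (subst sum.swap) (rule sum.cong[OF refl], rule sum_rot3)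

context overdetermined begin

lemma T_tr: "length vs \<le> 4 \<Longrightarrow> (\<Sum>k\<in>Basis. T (k # k # vs) x) = V vs x"
  by (rule T_trace) auto

lemma V_sym2: "V [a, b] x = V [b, a] x"
  using fun_cong[OF V_perm[of "[a, b]" "[b, a]"]] by simp

lemma V_tr: "length vs \<le> 2 \<Longrightarrow> (\<Sum>k\<in>Basis. V (k # k # vs) x) = W vs x"
  by (rule V_trace) auto

lemmas C0_rules = C0bar_sum C0bar_mult C0bar_power C0bar_add C0bar_diff C0bar_const C0bar_inner T_C0 V_C0 W_C0

lemmas integrable_C0 = C0bar_integrable[OF opn bdd]

definition N3 :: "'a \<Rightarrow> real" where "N3 x = (\<Sum>a\<in>Basis. \<Sum>b\<in>Basis. \<Sum>c\<in>Basis. (T [a, b, c] x)\<^sup>2)"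
definition TV :: "'a \<Rightarrow> real" where "TV x = (\<Sum>a\<in>Basis. \<Sum>b\<in>Basis. T [a, b] x * V [a, b] x)"
definition GW :: "'a \<Rightarrow> real" where "GW x = (\<Sum>a\<in>Basis. T [a] x * W [a] x)"
definition GV :: "'a \<Rightarrow> real" where "GV x = (\<Sum>a\<in>Basis. (V [a] x)\<^sup>2)"
definition VW :: "'a \<Rightarrow> real" where "VW x = V [] x * W [] x"

lemma energy_C0: "C0bar \<Omega> N3" "C0bar \<Omega> TV" "C0bar \<Omega> GW" "C0bar \<Omega> GV" "C0bar \<Omega> VW" "C0bar \<Omega> (T [])"
  unfolding N3_def[abs_def] TV_def[abs_def] GW_def[abs_def] GV_def[abs_def] VW_def[abs_def]
  by (intro C0_rules; simp)+

lemma integral_add_zero: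
  assumes "C0bar \<Omega> f" "C0bar \<Omega> g" "integral \<Omega> (\<lambda>x. f x + g x) = 0"
  shows "integral \<Omega> f = - integral \<Omega> g"
  using assms integral_add[OF integrable_C0[OF assms(1)] integrable_C0[OF assms(2)]] by simp

lemma integral_N3: "integral \<Omega> N3 = - integral \<Omega> TV"
proof (rule integral_add_zero[OF energy_C0(1,2)])
  show "integral \<Omega> (\<lambda>x. N3 x + TV x) = 0"
  proof (rule divergence_zero_grad[OF opn bdd])
    show "grad_bar \<Omega> (\<lambda>x. \<Sum>b\<in>Basis. \<Sum>c\<in>Basis. T [b, c] x * T [a, b, c] x)
       (\<lambda>i x. \<Sum>b\<in>Basis. \<Sum>c\<in>Basis. T [b, c] x * T [i, a, b, c] x + T [i, b, c] x * T [a, b, c] x)" for a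
      by (intro grad_intros) simp_all
    show "zero_bdry \<Omega> (\<lambda>x. \<Sum>b\<in>Basis. \<Sum>c\<in>Basis. T [b, c] x * T [a, b, c] x)" for a
      by (intro zero_bdry_sum zero_bdry_mult[OF opn T2_zero_bdry] T_C0) simp
    show "N3 x + TV x = (\<Sum>a\<in>Basis. \<Sum>b\<in>Basis. \<Sum>c\<in>Basis. T [b, c] x * T [a, a, b, c] x + T [a, b, c] x * T [a, b, c] x)" for x
      unfolding sum.distrib
      by (subst sum_rot3) (simp add: N3_def TV_def T_tr power2_eq_square flip: sum_distrib_left)
  qed
qed

lemma integral_TV: "integral \<Omega> TV = - integral \<Omega> GW"
proof (rule integral_add_zero[OF energy_C0(2,3)])
  show "integral \<Omega> (\<lambda>x. TV x + GW x) = 0"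
  proof (rule divergence_zero_grad[OF opn bdd])
    show "grad_bar \<Omega> (\<lambda>x. \<Sum>b\<in>Basis. T [b] x * V [a, b] x)
       (\<lambda>i x. \<Sum>b\<in>Basis. T [b] x * V [i, a, b] x + T [i, b] x * V [a, b] x)" for a
      by (intro grad_intros) simp_all
    show "zero_bdry \<Omega> (\<lambda>x. \<Sum>b\<in>Basis. T [b] x * V [a, b] x)" for a
      by (intro zero_bdry_sum zero_bdry_mult[OF opn T1_zero_bdry] V_C0) simp
    show "TV x + GW x = (\<Sum>a\<in>Basis. \<Sum>b\<in>Basis. T [b] x * V [a, a, b] x + T [a, b] x * V [a, b] x)" for x
      unfolding sum.distrib
      by (subst sum.swap[of "\<lambda>a b. T [b] x * V [a, a, b] x"]) (simp add: GW_def TV_def V_tr flip: sum_distrib_left)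
  qed
qed

lemma integral_GW: "integral \<Omega> GW = integral \<Omega> (T [])"
proof -
  have "integral \<Omega> GW = - integral \<Omega> (\<lambda>x. - T [] x)"
  proof (rule integral_add_zero)
    show "integral \<Omega> (\<lambda>x. GW x + - T [] x) = 0"
    proof (rule divergence_zero_grad[OF opn bdd])
      show "grad_bar \<Omega> (\<lambda>x. T [] x * W [a] x) (\<lambda>i x. T [] x * W [i, a] x + T [i] x * W [a] x)" for a
        by (intro grad_intros) simp_all
      show "zero_bdry \<Omega> (\<lambda>x. T [] x * W [a] x)" for a
        by (intro zero_bdry_mult[OF opn T0_zero_bdry] W_C0) simp
      show "GW x + - T [] x = (\<Sum>a\<in>Basis. T [] x * W [a, a] x + T [a] x * W [a] x)" if "x \<in> \<Omega>" for x
        using W_trace[OF that] by (simp add: GW_def sum.distrib flip: sum_distrib_left)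
    qed
  qed (use energy_C0 in auto)
  then show ?thesis by simp
qed

lemma integral_VW: "integral \<Omega> VW = - integral \<Omega> GW"
proof (rule integral_add_zero[OF energy_C0(5,3)])
  show "integral \<Omega> (\<lambda>x. VW x + GW x) = 0"
  proof (rule divergence_zero_grad[OF opn bdd])
    show "grad_bar \<Omega> (\<lambda>x. T [a] x * W [] x) (\<lambda>i x. T [a] x * W [i] x + T [i, a] x * W [] x)" for a
      by (intro grad_intros) simp_all
    show "zero_bdry \<Omega> (\<lambda>x. T [a] x * W [] x)" for a
      by (intro zero_bdry_mult[OF opn T1_zero_bdry] W_C0) simp
    show "VW x + GW x = (\<Sum>a\<in>Basis. T [a] x * W [a] x + T [a, a] x * W [] x)" for x
      by (simp add: GW_def VW_def sum.distrib T_tr flip: sum_distrib_right)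
  qed
qed

lemma integral_GV: "integral \<Omega> GV = - integral \<Omega> VW"
proof (rule integral_add_zero[OF energy_C0(4,5)])
  show "integral \<Omega> (\<lambda>x. GV x + VW x) = 0"
  proof (rule divergence_zero_grad[OF opn bdd])
    show "grad_bar \<Omega> (\<lambda>x. V [] x * V [a] x) (\<lambda>i x. V [] x * V [i, a] x + V [i] x * V [a] x)" for a
      by (intro grad_intros) simp_all
    show "zero_bdry \<Omega> (\<lambda>x. V [] x * V [a] x)" for a
      by (intro zero_bdry_mult[OF opn V0_zero_bdry] V_C0) simp
    show "GV x + VW x = (\<Sum>a\<in>Basis. V [] x * V [a, a] x + V [a] x * V [a] x)" for x
      by (simp add: GV_def VW_def sum.distrib V_tr power2_eq_square flip: sum_distrib_left)
  qed
qed

text \<open>Every flux involved contains one of u, \<nabla>u, D^2 u, v as a factor, all zero on the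
  boundary, so each integration by parts only changes a sign. The chain ends in the integral of u
  because \<Delta>w = -1.\<close>

lemma integral_energies:
  "integral \<Omega> N3 = integral \<Omega> (T [])" "integral \<Omega> TV = - integral \<Omega> (T [])"
  "integral \<Omega> GW = integral \<Omega> (T [])" "integral \<Omega> VW = - integral \<Omega> (T [])" "integral \<Omega> GV = integral \<Omega> (T [])"
  using integral_N3 integral_TV integral_GW integral_VW integral_GV by auto

text \<open>The Pohozaev identity.  The flux of \<open>A\<^sub>i\<^sub>j \<partial>\<^sub>i v\<close> with
  \<open>A\<^sub>i\<^sub>j = x\<^sub>i \<partial>\<^sub>j v - x\<^sub>j \<partial>\<^sub>i v\<close> through the boundary vanishes because \<open>A\<close> is
  antisymmetric: up to a divergence-free term it is the flux of \<open>- v \<partial>\<^sub>i A\<^sub>i\<^sub>j\<close>.  So only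
  vector fields vanishing on the boundary have to be integrated.\<close>

definition xT :: "'a \<Rightarrow> real" where "xT x = (\<Sum>i\<in>Basis. (x \<bullet> i) * T [i] x)"
definition xTW :: "'a \<Rightarrow> real" where "xTW x = (\<Sum>a\<in>Basis. (\<Sum>i\<in>Basis. (x \<bullet> i) * T [a, i] x) * W [a] x)"
definition xVW :: "'a \<Rightarrow> real" where "xVW x = (\<Sum>i\<in>Basis. (x \<bullet> i) * V [i] x) * W [] x"
definition xVV :: "'a \<Rightarrow> real" where "xVV x = (\<Sum>a\<in>Basis. (\<Sum>i\<in>Basis. (x \<bullet> i) * V [a, i] x) * V [a] x)"

lemma pohozaev_C0: "C0bar \<Omega> xT" "C0bar \<Omega> xTW" "C0bar \<Omega> xVW" "C0bar \<Omega> xVV"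
  unfolding xT_def[abs_def] xTW_def[abs_def] xVW_def[abs_def] xVV_def[abs_def]
  by (intro C0_rules; simp)+

lemma integral_xT: "integral \<Omega> xT = - n * integral \<Omega> (T [])"
proof -
  have "integral \<Omega> xT = - integral \<Omega> (\<lambda>x. n * T [] x)"
  proof (rule integral_add_zero)
    show "integral \<Omega> (\<lambda>x. xT x + n * T [] x) = 0"
    proof (rule divergence_zero_grad[OF opn bdd])
      show "grad_bar \<Omega> (\<lambda>x. T [] x * (x \<bullet> a)) (\<lambda>i x. T [] x * (i \<bullet> a) + T [i] x * (x \<bullet> a))" for a
        by (intro grad_intros) simp_all
      show "zero_bdry \<Omega> (\<lambda>x. T [] x * (x \<bullet> a))" for a
        by (intro zero_bdry_mult[OF opn T0_zero_bdry] C0bar_inner)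
      show "xT x + n * T [] x = (\<Sum>a\<in>Basis. T [] x * (a \<bullet> a) + T [a] x * (x \<bullet> a))" for x
        by (simp add: xT_def sum.distrib n_def mult.commute inner_same_Basis)
    qed
  qed (use energy_C0 pohozaev_C0 in auto)
  then show ?thesis by simp
qed

lemma integral_xTW: "integral \<Omega> xTW = integral \<Omega> xT - integral \<Omega> GW"
proof -
  have "integral \<Omega> xTW = - integral \<Omega> (\<lambda>x. GW x - xT x)"
  proof (rule integral_add_zero)
    show "integral \<Omega> (\<lambda>x. xTW x + (GW x - xT x)) = 0"
    proof (rule divergence_zero_grad[OF opn bdd])
      show "grad_bar \<Omega> (\<lambda>x. (\<Sum>i\<in>Basis. (x \<bullet> i) * T [i] x) * W [a] x)
         (\<lambda>j x. (\<Sum>i\<in>Basis. (x \<bullet> i) * T [i] x) * W [j, a] x + (\<Sum>i\<in>Basis. (x \<bullet> i) * T [j, i] x + (j \<bullet> i) * T [i] x) * W [a] x)" for a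
        by (intro grad_intros) simp_all
      show "zero_bdry \<Omega> (\<lambda>x. (\<Sum>i\<in>Basis. (x \<bullet> i) * T [i] x) * W [a] x)" for a
        by (intro zero_bdry_mult[OF opn] zero_bdry_sum zero_bdry_mult2[OF opn _ T1_zero_bdry] C0bar_inner W_C0) simp
      show "xTW x + (GW x - xT x) = (\<Sum>a\<in>Basis. (\<Sum>i\<in>Basis. (x \<bullet> i) * T [i] x) * W [a, a] x
          + (\<Sum>i\<in>Basis. (x \<bullet> i) * T [a, i] x + (a \<bullet> i) * T [i] x) * W [a] x)" if "x \<in> \<Omega>" for x
        using W_trace[OF that]
        by (simp add: xT_def xTW_def GW_def sum.distrib sum_Basis_inner_delta distrib_right flip: sum_distrib_left)
    qed
  qed (use energy_C0 pohozaev_C0 in auto)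
  then show ?thesis
    using integral_diff[OF integrable_C0[OF energy_C0(3)] integrable_C0[OF pohozaev_C0(1)]] by simp
qed

lemma integral_xVW: "integral \<Omega> xVW = - (integral \<Omega> VW + integral \<Omega> xTW)"
proof -
  have "integral \<Omega> xVW = - integral \<Omega> (\<lambda>x. VW x + xTW x)"
  proof (rule integral_add_zero)
    show "integral \<Omega> (\<lambda>x. xVW x + (VW x + xTW x)) = 0"
    proof (rule divergence_zero_grad[OF opn bdd])
      show "grad_bar \<Omega> (\<lambda>x. (\<Sum>i\<in>Basis. (x \<bullet> i) * T [a, i] x) * W [] x)
         (\<lambda>j x. (\<Sum>i\<in>Basis. (x \<bullet> i) * T [a, i] x) * W [j] x + (\<Sum>i\<in>Basis. (x \<bullet> i) * T [j, a, i] x + (j \<bullet> i) * T [a, i] x) * W [] x)" for a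
        by (intro grad_intros) simp_all
      show "zero_bdry \<Omega> (\<lambda>x. (\<Sum>i\<in>Basis. (x \<bullet> i) * T [a, i] x) * W [] x)" for a
        by (intro zero_bdry_mult[OF opn] zero_bdry_sum zero_bdry_mult2[OF opn _ T2_zero_bdry] C0bar_inner W_C0) simp
      fix x
      have "(\<Sum>a\<in>Basis. \<Sum>i\<in>Basis. (x \<bullet> i) * T [a, a, i] x) = (\<Sum>i\<in>Basis. (x \<bullet> i) * V [i] x)"
        by (subst sum.swap) (simp add: T_tr flip: sum_distrib_left)
      then show "xVW x + (VW x + xTW x) = (\<Sum>a\<in>Basis. (\<Sum>i\<in>Basis. (x \<bullet> i) * T [a, i] x) * W [a] x
          + (\<Sum>i\<in>Basis. (x \<bullet> i) * T [a, a, i] x + (a \<bullet> i) * T [a, i] x) * W [] x)"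
        by (simp add: xVW_def xTW_def VW_def sum.distrib sum_Basis_inner_delta distrib_right T_tr flip: sum_distrib_right)
    qed
  qed (use energy_C0 pohozaev_C0 in auto)
  then show ?thesis
    using integral_add[OF integrable_C0[OF energy_C0(5)] integrable_C0[OF pohozaev_C0(2)]] by simp
qed

lemma GV_bdry: "p \<in> frontier \<Omega> \<Longrightarrow> (GV \<longlongrightarrow> c\<^sup>2) (at p within \<Omega>)"
proof -
  assume p: "p \<in> frontier \<Omega>"
  have "(GV \<longlongrightarrow> (\<Sum>a\<in>Basis. (c * (\<nu> p \<bullet> a))\<^sup>2)) (at p within \<Omega>)"
    unfolding GV_def[abs_def] by (intro tendsto_sum tendsto_power V1_bdry[OF p])
  moreover have "(\<Sum>a\<in>Basis. (c * (\<nu> p \<bullet> a))\<^sup>2) = c\<^sup>2"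
  proof -
    have "(\<Sum>a\<in>Basis. (c * (\<nu> p \<bullet> a))\<^sup>2) = (\<Sum>a\<in>Basis. c\<^sup>2 * ((\<nu> p \<bullet> a) * (\<nu> p \<bullet> a)))"
      by (simp add: power2_eq_square ac_simps)
    then show ?thesis using nu_sum[OF p] by (simp flip: sum_distrib_left)
  qed
  ultimately show ?thesis by simp
qed

text \<open>Here |\<nabla>v| = |c| on the boundary enters: after subtracting c^2 the field
  (|\<nabla>v|^2 - c^2) x vanishes there, and the subtracted constant leaves the volume term
  behind.\<close>

lemma integral_xVV: "2 * integral \<Omega> xVV = n * c\<^sup>2 * measure lebesgue \<Omega> - n * integral \<Omega> GV"
proof -
  have "integral \<Omega> (\<lambda>x. 2 * xVV x) = - integral \<Omega> (\<lambda>x. n * GV x - n * c\<^sup>2)"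
  proof (rule integral_add_zero)
    show "integral \<Omega> (\<lambda>x. 2 * xVV x + (n * GV x - n * c\<^sup>2)) = 0"
    proof (rule divergence_zero_grad[OF opn bdd])
      show "grad_bar \<Omega> (\<lambda>x. (GV x - c\<^sup>2) * (x \<bullet> a))
         (\<lambda>j x. (GV x - c\<^sup>2) * (j \<bullet> a) + ((\<Sum>i\<in>Basis. 2 * (V [i] x * V [j, i] x)) - 0) * (x \<bullet> a))" for a
        unfolding GV_def[abs_def] by (intro grad_intros) simp_all
      show "zero_bdry \<Omega> (\<lambda>x. (GV x - c\<^sup>2) * (x \<bullet> a))" for a
      proof (rule zero_bdry_mult[OF opn _ C0bar_inner])
        show "zero_bdry \<Omega> (\<lambda>x. GV x - c\<^sup>2)" unfolding zero_bdry_def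
          using tendsto_diff[OF GV_bdry tendsto_const[of "c\<^sup>2"]] by simp
      qed
      show "2 * xVV x + (n * GV x - n * c\<^sup>2) = (\<Sum>a\<in>Basis. (GV x - c\<^sup>2) * (a \<bullet> a)
          + ((\<Sum>i\<in>Basis. 2 * (V [i] x * V [a, i] x)) - 0) * (x \<bullet> a))" for x
      proof -
        have "(\<Sum>a\<in>Basis. (\<Sum>i\<in>Basis. V [i] x * V [a, i] x) * (x \<bullet> a)) = xVV x"
          unfolding xVV_def sum_distrib_right
          by (subst sum.swap[of "\<lambda>a i. V [i] x * V [a, i] x * (x \<bullet> a)"], intro sum.cong refl)
            (simp add: V_sym2 ac_simps)
        then show ?thesis
          by (simp add: sum.distrib n_def inner_same_Basis right_diff_distrib flip: sum_distrib_left)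
            (simp add: mult.assoc sum_distrib_left[symmetric])
      qed
    qed
  qed (intro C0bar_add C0bar_diff C0bar_minus C0bar_mult C0bar_const energy_C0 pohozaev_C0)+
  moreover have "integral \<Omega> (\<lambda>x. n * GV x - n * c\<^sup>2) = n * integral \<Omega> GV - n * c\<^sup>2 * measure lebesgue \<Omega>"
    by (subst integral_diff) (auto intro!: integrable_C0 energy_C0 simp: integral_const_open[OF opn bdd])
  ultimately show ?thesis by simp
qed

text \<open>With A as above, the bracket multiplying v in the field is the divergence of A. It is
  itself divergence free, as a double divergence of an antisymmetric tensor, so only its product
  with \<nabla>v survives.\<close>

lemma integral_antisym: "(n - 1) * integral \<Omega> GV + integral \<Omega> xVV = integral \<Omega> xVW"
proof -
  have "integral \<Omega> (\<lambda>x. (n - 1) * GV x + xVV x) = - integral \<Omega> (\<lambda>x. - xVW x)"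
  proof (rule integral_add_zero)
    show "integral \<Omega> (\<lambda>x. ((n - 1) * GV x + xVV x) + - xVW x) = 0"
    proof (rule divergence_zero_grad[OF opn bdd])
      show "grad_bar \<Omega> (\<lambda>x. V [] x * ((n - 1) * V [j] x + (\<Sum>i\<in>Basis. (x \<bullet> i) * V [i, j] x) - (x \<bullet> j) * W [] x))
         (\<lambda>k x. V [] x * (((n - 1) * V [k, j] x + 0 * V [j] x) + (\<Sum>i\<in>Basis. (x \<bullet> i) * V [k, i, j] x + (k \<bullet> i) * V [i, j] x)
             - ((x \<bullet> j) * W [k] x + (k \<bullet> j) * W [] x))
           + V [k] x * ((n - 1) * V [j] x + (\<Sum>i\<in>Basis. (x \<bullet> i) * V [i, j] x) - (x \<bullet> j) * W [] x))" for j
        by (intro grad_intros) simp_all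
      show "zero_bdry \<Omega> (\<lambda>x. V [] x * ((n - 1) * V [j] x + (\<Sum>i\<in>Basis. (x \<bullet> i) * V [i, j] x) - (x \<bullet> j) * W [] x))" for j
        by (intro zero_bdry_mult[OF opn V0_zero_bdry] C0_rules) simp_all
      fix x
      have 1: "(\<Sum>j\<in>Basis. \<Sum>i\<in>Basis. (x \<bullet> i) * V [j, i, j] x) = (\<Sum>i\<in>Basis. (x \<bullet> i) * W [i] x)"
        by (subst sum.swap) (simp add: V_trace flip: sum_distrib_left)
      have 2: "(\<Sum>j\<in>Basis. V [j] x * (\<Sum>i\<in>Basis. (x \<bullet> i) * V [i, j] x)) = xVV x"
        unfolding xVV_def by (intro sum.cong refl) (simp add: V_sym2 mult.commute)
      have "(\<Sum>j\<in>Basis. V [] x * (((n - 1) * V [j, j] x + 0 * V [j] x) + (\<Sum>i\<in>Basis. (x \<bullet> i) * V [j, i, j] x + (j \<bullet> i) * V [i, j] x)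
             - ((x \<bullet> j) * W [j] x + (j \<bullet> j) * W [] x))
           + V [j] x * ((n - 1) * V [j] x + (\<Sum>i\<in>Basis. (x \<bullet> i) * V [i, j] x) - (x \<bullet> j) * W [] x))
        = V [] x * (\<Sum>j\<in>Basis. (n - 1) * V [j, j] x + (\<Sum>i\<in>Basis. (x \<bullet> i) * V [j, i, j] x + (j \<bullet> i) * V [i, j] x)
             - ((x \<bullet> j) * W [j] x + W [] x))
          + (n - 1) * GV x + (\<Sum>j\<in>Basis. V [j] x * (\<Sum>i\<in>Basis. (x \<bullet> i) * V [i, j] x)) - xVW x"
        by (simp add: sum.distrib sum_subtractf GV_def xVW_def right_diff_distrib distrib_left power2_eq_square
            sum_distrib_left sum_distrib_right inner_same_Basis ac_simps)
      also have "(\<Sum>j\<in>Basis. (n - 1) * V [j, j] x + (\<Sum>i\<in>Basis. (x \<bullet> i) * V [j, i, j] x + (j \<bullet> i) * V [i, j] x)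
             - ((x \<bullet> j) * W [j] x + W [] x)) = 0"
        by (simp add: sum.distrib sum_subtractf 1 sum_Basis_inner_delta V_tr n_def flip: sum_distrib_left)
          (simp add: algebra_simps)
      finally show "((n - 1) * GV x + xVV x) + - xVW x = (\<Sum>j\<in>Basis. V [] x * (((n - 1) * V [j, j] x + 0 * V [j] x) + (\<Sum>i\<in>Basis. (x \<bullet> i) * V [j, i, j] x + (j \<bullet> i) * V [i, j] x)
             - ((x \<bullet> j) * W [j] x + (j \<bullet> j) * W [] x))
           + V [j] x * ((n - 1) * V [j] x + (\<Sum>i\<in>Basis. (x \<bullet> i) * V [i, j] x) - (x \<bullet> j) * W [] x))"
        using 2 by simp
    qed
  qed (intro C0bar_add C0bar_diff C0bar_minus C0bar_mult C0bar_const energy_C0 pohozaev_C0)+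
  then show ?thesis
    using integral_add[OF integrable_C0[OF C0bar_mult[OF C0bar_const energy_C0(4), of "n - 1"]] integrable_C0[OF pohozaev_C0(4)]] by simp
qed

text \<open>Write U for the integral of u. The integral of \<open>xVW\<close> is (n + 2) U, so
  \<open>integral_antisym\<close> makes that of \<open>xVV\<close> equal to 3 U. Comparison with
  \<open>integral_xVV\<close> gives 6 U = n (c^2 |\<Omega>| - U), whence the factor n + 6.\<close>

lemma pohozaev: "(n + 6) * integral \<Omega> (T []) = n * c\<^sup>2 * measure lebesgue \<Omega>"
proof -
  have "integral \<Omega> xVW = (n + 2) * integral \<Omega> (T [])"
    using integral_xVW integral_xTW integral_xT integral_energies by (simp add: algebra_simps)
  then show ?thesis
    using integral_antisym integral_xVV integral_energies by (simp add: algebra_simps)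
qed

end

section \<open>The trace-free part of a symmetric four-tensor\<close>

definition delta :: "'b \<Rightarrow> 'b \<Rightarrow> real" where "delta a b = (if a = b then 1 else 0)"

lemma delta_commute: "delta a b = delta b a" by (simp add: delta_def)

lemma sum_delta_collapse: "finite B \<Longrightarrow> a \<in> B \<Longrightarrow> (\<Sum>b\<in>B. delta a b * f b) = f a"
  "finite B \<Longrightarrow> a \<in> B \<Longrightarrow> (\<Sum>b\<in>B. delta b a * f b) = f a"
  by (simp_all add: delta_def if_distrib[of "\<lambda>x. x * _"] cong: if_cong)

text \<open>The symmetrisation of \<delta> \<otimes> m, one term for each choice of the two slots of
  \<delta>; \<open>sym3\<close> is the analogue for \<delta> \<otimes> \<delta>, with its three
  pairings. Together they build the part of a symmetric four-tensor that carries the traces.\<close>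

definition sym6 :: "('b \<Rightarrow> 'b \<Rightarrow> real) \<Rightarrow> 'b \<Rightarrow> 'b \<Rightarrow> 'b \<Rightarrow> 'b \<Rightarrow> real" where
  "sym6 m a b c d = delta a b * m c d + delta a c * m b d + delta a d * m b c
     + delta b c * m a d + delta b d * m a c + delta c d * m a b"

definition sym3 :: "'b \<Rightarrow> 'b \<Rightarrow> 'b \<Rightarrow> 'b \<Rightarrow> real" where
  "sym3 a b c d = delta a b * delta c d + delta a c * delta b d + delta a d * delta b c"

lemma sum4_cong:
  assumes "\<And>a b c d. a \<in> B \<Longrightarrow> b \<in> B \<Longrightarrow> c \<in> B \<Longrightarrow> d \<in> B \<Longrightarrow> f a b c d = g a b c d"
  shows "(\<Sum>a\<in>B. \<Sum>b\<in>B. \<Sum>c\<in>B. \<Sum>d\<in>B. f a b c d) = (\<Sum>a\<in>B. \<Sum>b\<in>B. \<Sum>c\<in>B. \<Sum>d\<in>B. (g a b c d :: real))"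
  using assms by (intro sum.cong refl)

lemma swap34: "(\<Sum>a\<in>B. \<Sum>b\<in>B. \<Sum>c\<in>B. \<Sum>d\<in>B. f a b c d) = (\<Sum>a\<in>B. \<Sum>b\<in>B. \<Sum>c\<in>B. \<Sum>d\<in>B. (f a b d c :: real))"
  by (intro sum.cong refl sum.swap)

lemma swap23: "(\<Sum>a\<in>B. \<Sum>b\<in>B. \<Sum>c\<in>B. \<Sum>d\<in>B. f a b c d) = (\<Sum>a\<in>B. \<Sum>b\<in>B. \<Sum>c\<in>B. \<Sum>d\<in>B. (f a c b d :: real))"
  by (rule sum.cong[OF refl], rule sum.swap)

lemma swap12: "(\<Sum>a\<in>B. \<Sum>b\<in>B. \<Sum>c\<in>B. \<Sum>d\<in>B. f a b c d) = (\<Sum>a\<in>B. \<Sum>b\<in>B. \<Sum>c\<in>B. \<Sum>d\<in>B. (f b a c d :: real))"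
  by (rule sum.swap)

context
  fixes B :: "'b set" and g :: "'b \<Rightarrow> 'b \<Rightarrow> 'b \<Rightarrow> 'b \<Rightarrow> real"
  assumes fin: "finite B"
    and s12: "\<And>a b c d. g a b c d = g b a c d" and s23: "\<And>a b c d. g a b c d = g a c b d"
    and s34: "\<And>a b c d. g a b c d = g a b d c"
begin

lemma contract_ab: "(\<Sum>a\<in>B. \<Sum>b\<in>B. \<Sum>c\<in>B. \<Sum>d\<in>B. delta a b * m c d * g a b c d) = (\<Sum>c\<in>B. \<Sum>d\<in>B. m c d * (\<Sum>a\<in>B. g a a c d))"
proof -
  have "(\<Sum>a\<in>B. \<Sum>b\<in>B. \<Sum>c\<in>B. \<Sum>d\<in>B. delta a b * m c d * g a b c d)
      = (\<Sum>a\<in>B. \<Sum>b\<in>B. delta a b * (\<Sum>c\<in>B. \<Sum>d\<in>B. m c d * g a b c d))"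
    by (simp add: sum_distrib_left mult.assoc)
  also have "\<dots> = (\<Sum>a\<in>B. \<Sum>c\<in>B. \<Sum>d\<in>B. m c d * g a a c d)"
    by (intro sum.cong refl sum_delta_collapse fin)
  also have "\<dots> = (\<Sum>c\<in>B. \<Sum>d\<in>B. \<Sum>a\<in>B. m c d * g a a c d)" by (rule sum_rot3)
  finally show ?thesis by (simp add: sum_distrib_left)
qed

text \<open>Because g is totally symmetric, renaming summation indices carries each of the six terms
  into the one computed in \<open>contract_ab\<close>.\<close>

lemma contract_sym6:
  "(\<Sum>a\<in>B. \<Sum>b\<in>B. \<Sum>c\<in>B. \<Sum>d\<in>B. sym6 m a b c d * g a b c d) = 6 * (\<Sum>c\<in>B. \<Sum>d\<in>B. m c d * (\<Sum>a\<in>B. g a a c d))"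
    (is "_ = 6 * ?R")
proof -
  note ab = contract_ab[of m]
  have ac: "(\<Sum>a\<in>B. \<Sum>b\<in>B. \<Sum>c\<in>B. \<Sum>d\<in>B. delta a c * m b d * g a b c d) = ?R"
    unfolding ab[symmetric] by (subst swap23, rule sum4_cong, subst s23, rule refl)
  have ad: "(\<Sum>a\<in>B. \<Sum>b\<in>B. \<Sum>c\<in>B. \<Sum>d\<in>B. delta a d * m b c * g a b c d) = ?R"
    unfolding ac[symmetric] by (subst swap34, rule sum4_cong, subst s34, rule refl)
  have bc: "(\<Sum>a\<in>B. \<Sum>b\<in>B. \<Sum>c\<in>B. \<Sum>d\<in>B. delta b c * m a d * g a b c d) = ?R"
    unfolding ac[symmetric] by (subst swap12, rule sum4_cong, subst s12, rule refl)
  have bd: "(\<Sum>a\<in>B. \<Sum>b\<in>B. \<Sum>c\<in>B. \<Sum>d\<in>B. delta b d * m a c * g a b c d) = ?R"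
    unfolding ad[symmetric] by (subst swap12, rule sum4_cong, subst s12, rule refl)
  have cd: "(\<Sum>a\<in>B. \<Sum>b\<in>B. \<Sum>c\<in>B. \<Sum>d\<in>B. delta c d * m a b * g a b c d) = ?R"
    unfolding bd[symmetric] by (subst swap23, rule sum4_cong, subst s23, rule refl)
  show ?thesis by (simp add: sym6_def distrib_right sum.distrib ab ac ad bc bd cd)
qed

lemma contract_sym3:
  "(\<Sum>a\<in>B. \<Sum>b\<in>B. \<Sum>c\<in>B. \<Sum>d\<in>B. sym3 a b c d * g a b c d) = 3 * (\<Sum>c\<in>B. \<Sum>a\<in>B. g a a c c)"
    (is "_ = 3 * ?R")
proof -
  have ab: "(\<Sum>a\<in>B. \<Sum>b\<in>B. \<Sum>c\<in>B. \<Sum>d\<in>B. delta a b * delta c d * g a b c d) = ?R"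
    unfolding contract_ab by (intro sum.cong refl sum_delta_collapse fin)
  have ac: "(\<Sum>a\<in>B. \<Sum>b\<in>B. \<Sum>c\<in>B. \<Sum>d\<in>B. delta a c * delta b d * g a b c d) = ?R"
    unfolding ab[symmetric] by (subst swap23, rule sum4_cong, subst s23, rule refl)
  have ad: "(\<Sum>a\<in>B. \<Sum>b\<in>B. \<Sum>c\<in>B. \<Sum>d\<in>B. delta a d * delta b c * g a b c d) = ?R"
    unfolding ac[symmetric] by (subst swap34, rule sum4_cong, subst s34, rule refl)
  show ?thesis by (simp add: sym3_def distrib_right sum.distrib ab ac ad)
qed

end

text \<open>Tracing \<open>sym6 v\<close> gives (N + 4) v + w \<delta> and tracing
  \<open>sym3\<close> gives (N + 2) \<delta>; the coefficients in h are those that make every trace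
  of h vanish. Hence h is orthogonal to both corrections, so |h|^2 = t : h, and expanding h once
  more yields the formula.\<close>

lemma trace_free_part:
  fixes t :: "'b \<Rightarrow> 'b \<Rightarrow> 'b \<Rightarrow> 'b \<Rightarrow> real" and B :: "'b set"
  assumes fin: "finite B" and s12: "\<And>a b c d. t a b c d = t b a c d" and s23: "\<And>a b c d. t a b c d = t a c b d"
    and s34: "\<And>a b c d. t a b c d = t a b d c" and tr: "\<And>c d. (\<Sum>a\<in>B. t a a c d) = v c d" and w: "(\<Sum>c\<in>B. v c c) = w"
  defines "N \<equiv> real (card B)"
  defines "h \<equiv> (\<lambda>a b c d. t a b c d - 1 / (N + 4) * sym6 v a b c d + w / ((N + 2) * (N + 4)) * sym3 a b c d)"
  shows "(\<Sum>a\<in>B. \<Sum>b\<in>B. \<Sum>c\<in>B. \<Sum>d\<in>B. (h a b c d)\<^sup>2)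
    = (\<Sum>a\<in>B. \<Sum>b\<in>B. \<Sum>c\<in>B. \<Sum>d\<in>B. (t a b c d)\<^sup>2) - 6 / (N + 4) * (\<Sum>c\<in>B. \<Sum>d\<in>B. (v c d)\<^sup>2)
      + 3 / ((N + 2) * (N + 4)) * w\<^sup>2"
proof -
  let ?S = "\<lambda>f. \<Sum>a\<in>B. \<Sum>b\<in>B. \<Sum>c\<in>B. \<Sum>d\<in>B. (f a b c d :: real)"
  have N: "N \<ge> 0" by (simp add: N_def)
  have N0: "N + 4 \<noteq> 0" "N + 2 \<noteq> 0" using N by auto
  have vs: "v a b = v b a" for a b unfolding tr[symmetric] using s34 by simp
  have h12: "h a b c d = h b a c d" and h23: "h a b c d = h a c b d" and h34: "h a b c d = h a b d c" for a b c d
  proof -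
    have "sym6 v a b c d = sym6 v b a c d" by (simp add: sym6_def delta_commute[of b a] vs[of b a])
    moreover have "sym3 a b c d = sym3 b a c d" by (simp add: sym3_def delta_commute[of b a] algebra_simps)
    ultimately show "h a b c d = h b a c d" using s12[of a b c d] by (simp add: h_def)
    have "sym6 v a b c d = sym6 v a c b d" by (simp add: sym6_def delta_commute[of c b] vs[of c b])
    moreover have "sym3 a b c d = sym3 a c b d" by (simp add: sym3_def delta_commute[of c b] algebra_simps)
    ultimately show "h a b c d = h a c b d" using s23[of a b c d] by (simp add: h_def)
    have "sym6 v a b c d = sym6 v a b d c" by (simp add: sym6_def delta_commute[of d c] vs[of d c])
    moreover have "sym3 a b c d = sym3 a b d c" by (simp add: sym3_def delta_commute[of d c] algebra_simps)
    ultimately show "h a b c d = h a b d c" using s34[of a b c d] by (simp add: h_def)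
  qed
  have htr: "(\<Sum>a\<in>B. h a a c d) = 0" if "c \<in> B" "d \<in> B" for c d
  proof -
    have 1: "(\<Sum>a\<in>B. delta a a * v c d) = N * v c d" by (simp add: delta_def N_def)
    have 2: "(\<Sum>a\<in>B. delta a c * v a d) = v c d" "(\<Sum>a\<in>B. delta a d * v a c) = v c d"
      using sum_delta_collapse(2)[OF fin that(1), of "\<lambda>a. v a d"] sum_delta_collapse(2)[OF fin that(2), of "\<lambda>a. v a c"] vs by auto
    have 3: "(\<Sum>a\<in>B. delta c d * v a a) = delta c d * w" by (simp add: w flip: sum_distrib_left)
    have 4: "(\<Sum>a\<in>B. sym6 v a a c d) = (N + 4) * v c d + delta c d * w"
      by (simp only: sym6_def sum.distrib 1 2 3) (simp add: algebra_simps)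
    have 5: "(\<Sum>a\<in>B. delta a a * delta c d) = N * delta c d" by (simp add: delta_def N_def)
    have 6: "(\<Sum>a\<in>B. delta a c * delta a d) = delta c d" "(\<Sum>a\<in>B. delta a d * delta a c) = delta c d"
      using sum_delta_collapse(2)[OF fin that(1), of "\<lambda>a. delta a d"] sum_delta_collapse(2)[OF fin that(2), of "\<lambda>a. delta a c"]
      by (simp_all add: delta_commute)
    have 7: "(\<Sum>a\<in>B. sym3 a a c d) = (N + 2) * delta c d"
      by (simp only: sym3_def sum.distrib 5 6) (simp add: algebra_simps)
    have "(\<Sum>a\<in>B. h a a c d) = v c d - 1 / (N + 4) * ((N + 4) * v c d + delta c d * w) + w / ((N + 2) * (N + 4)) * ((N + 2) * delta c d)"
      by (simp add: h_def sum.distrib sum_subtractf tr 4 7 flip: sum_distrib_left sum_divide_distrib)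
    also have "1 / (N + 4) * ((N + 4) * v c d + delta c d * w) = v c d + delta c d * w / (N + 4)"
      using N0 by (simp add: distrib_left)
    also have "w / ((N + 2) * (N + 4)) * ((N + 2) * delta c d) = delta c d * w / (N + 4)"
      using N0 by simp
    also have "v c d - (v c d + delta c d * w / (N + 4)) + delta c d * w / (N + 4) = 0" by simp
    finally show ?thesis .
  qed
  have h6: "?S (\<lambda>a b c d. sym6 v a b c d * h a b c d) = 0"
    by (subst contract_sym6[OF fin h12 h23 h34]) (simp add: htr)
  have h3: "?S (\<lambda>a b c d. sym3 a b c d * h a b c d) = 0"
    by (subst contract_sym3[OF fin h12 h23 h34]) (simp add: htr)
  have t6: "?S (\<lambda>a b c d. sym6 v a b c d * t a b c d) = 6 * (\<Sum>c\<in>B. \<Sum>d\<in>B. (v c d)\<^sup>2)"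
    by (subst contract_sym6[OF fin s12 s23 s34]) (simp add: tr power2_eq_square)
  have t3: "?S (\<lambda>a b c d. sym3 a b c d * t a b c d) = 3 * w"
    by (subst contract_sym3[OF fin s12 s23 s34]) (simp add: tr w)
  have "?S (\<lambda>a b c d. (h a b c d)\<^sup>2) = ?S (\<lambda>a b c d. t a b c d * h a b c d
      - 1 / (N + 4) * (sym6 v a b c d * h a b c d) + w / ((N + 2) * (N + 4)) * (sym3 a b c d * h a b c d))"
    by (rule sum4_cong) (simp add: h_def power2_eq_square algebra_simps)
  also have "\<dots> = ?S (\<lambda>a b c d. t a b c d * h a b c d)"
    using h6 h3 by (simp only: sum.distrib sum_subtractf sum_distrib_left[symmetric])
  also have "\<dots> = ?S (\<lambda>a b c d. (t a b c d)\<^sup>2 - 1 / (N + 4) * (sym6 v a b c d * t a b c d)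
      + w / ((N + 2) * (N + 4)) * (sym3 a b c d * t a b c d))"
    by (rule sum4_cong) (simp add: h_def power2_eq_square algebra_simps)
  also have "\<dots> = ?S (\<lambda>a b c d. (t a b c d)\<^sup>2) - 1 / (N + 4) * (6 * (\<Sum>c\<in>B. \<Sum>d\<in>B. (v c d)\<^sup>2))
      + w / ((N + 2) * (N + 4)) * (3 * w)"
    using t6 t3 by (simp only: sum.distrib sum_subtractf sum_distrib_left[symmetric])
  finally show ?thesis by (simp add: power2_eq_square)
qed

context overdetermined begin

section \<open>The P-function\<close>

text \<open>The value for which 1 - 2 \<beta> = 12 / (n + 4). By \<open>trace_free_part\<close> this
  is what 2 |H|^2 subtracts of |D^2 v|^2, so \<Delta>P contains D^4 u and D^2 v only through 2
  |H|^2. The constant \<kappa> collects the remaining multiples of w^2: it equals 6 / ((n + 2) (n +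
  4)) + 1/4 + \<beta>.\<close>

definition \<beta> :: real where "\<beta> = (n - 8) / (2 * (n + 4))"

definition \<kappa> :: real where "\<kappa> = 3 * n * (n - 2) / (4 * (n + 2) * (n + 4))"

text \<open>Each coefficient removes one product from \<Delta>P: D^3 u : D^3 v cancels between the
  first two terms, the factor 1/2 cancels D^2 u : D^2 w, and 1/4 + \<beta> on v w cancels \<nabla>v
  \<cdot> \<nabla>w. The summand u absorbs the -v that comes from v \<Delta>w. What is left is 2
  |D^4 u|^2 - (1 - 2 \<beta>) |D^2 v|^2 - (1/4 + \<beta>) w^2.\<close>

definition P :: "'a \<Rightarrow> real" where
  "P x = N3 x - TV x + 1/2 * GW x + \<beta> * GV x - (1/4 + \<beta>) * (VW x + T [] x)"

definition H :: "'a \<Rightarrow> 'a \<Rightarrow> 'a \<Rightarrow> 'a \<Rightarrow> 'a \<Rightarrow> real" where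
  "H i j k l x = T [i, j, k, l] x - 1 / (n + 4) * sym6 (\<lambda>i j. V [i, j] x) i j k l
     + W [] x / ((n + 2) * (n + 4)) * sym3 i j k l"

text \<open>Stands for \<Delta>P, which need not exist pointwise; the link to P is made by
  \<open>div_G\<close> and \<open>test_P\<close>.\<close>

definition E :: "'a \<Rightarrow> real" where
  "E x = 2 * (\<Sum>a\<in>Basis. \<Sum>b\<in>Basis. \<Sum>c\<in>Basis. \<Sum>d\<in>Basis. (H a b c d x)\<^sup>2) - \<kappa> * (W [] x)\<^sup>2"

definition dN3 :: "'a \<Rightarrow> 'a \<Rightarrow> real" where "dN3 j x = (\<Sum>a\<in>Basis. \<Sum>b\<in>Basis. \<Sum>c\<in>Basis. 2 * (T [a, b, c] x * T [j, a, b, c] x))"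
definition dTV :: "'a \<Rightarrow> 'a \<Rightarrow> real" where "dTV j x = (\<Sum>a\<in>Basis. \<Sum>b\<in>Basis. T [a, b] x * V [j, a, b] x + T [j, a, b] x * V [a, b] x)"
definition dGW :: "'a \<Rightarrow> 'a \<Rightarrow> real" where "dGW j x = (\<Sum>a\<in>Basis. T [a] x * W [j, a] x + T [j, a] x * W [a] x)"
definition dGV :: "'a \<Rightarrow> 'a \<Rightarrow> real" where "dGV j x = (\<Sum>a\<in>Basis. 2 * (V [a] x * V [j, a] x))"
definition dVW :: "'a \<Rightarrow> 'a \<Rightarrow> real" where "dVW j x = V [] x * W [j] x + V [j] x * W [] x"

definition dP :: "'a \<Rightarrow> 'a \<Rightarrow> real" where
  "dP j x = dN3 j x - dTV j x + 1/2 * dGW j x + \<beta> * dGV j x - (1/4 + \<beta>) * (dVW j x + T [j] x)"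

lemma grad_energies: "grad_bar \<Omega> N3 dN3" "grad_bar \<Omega> TV dTV" "grad_bar \<Omega> GW dGW" "grad_bar \<Omega> GV dGV" "grad_bar \<Omega> VW dVW"
  unfolding N3_def[abs_def] dN3_def[abs_def] TV_def[abs_def] dTV_def[abs_def] GW_def[abs_def] dGW_def[abs_def]
    GV_def[abs_def] dGV_def[abs_def] VW_def[abs_def] dVW_def[abs_def]
  by ((intro grad_intros; simp)+)

lemma P_grad: "grad_bar \<Omega> P dP"
  unfolding P_def[abs_def] dP_def[abs_def]
  by (intro grad_bar_add grad_bar_diff grad_bar_cmult grad_energies T_grad) simp

text \<open>Since \<open>w = \<Delta>\<^sup>2 u\<close> is only C2, the gradient of \<open>\<nabla>u \<cdot> \<nabla>w\<close> is not known to be C1.  It is replaced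
  by a C1 field \<open>G\<close> that differs from it by the divergence of the antisymmetric
  tensor \<open>\<partial>\<^sub>i u \<partial>\<^sub>j w - \<partial>\<^sub>j u \<partial>\<^sub>i w\<close>, which is orthogonal to gradients of test functions.\<close>

definition G :: "'a \<Rightarrow> 'a \<Rightarrow> real" where
  "G j x = dN3 j x - dTV j x + (\<Sum>a\<in>Basis. T [j, a] x * W [a] x) - 1/2 * (V [] x * W [j] x) - 1/2 * T [j] x
     + \<beta> * dGV j x - (1/4 + \<beta>) * (dVW j x + T [j] x)"

definition ddN3 :: "'a \<Rightarrow> 'a \<Rightarrow> 'a \<Rightarrow> real" where "ddN3 i j x = (\<Sum>a\<in>Basis. \<Sum>b\<in>Basis. \<Sum>c\<in>Basis. 2 * (T [a, b, c] x * T [i, j, a, b, c] x + T [i, a, b, c] x * T [j, a, b, c] x))"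
definition ddTV :: "'a \<Rightarrow> 'a \<Rightarrow> 'a \<Rightarrow> real" where "ddTV i j x = (\<Sum>a\<in>Basis. \<Sum>b\<in>Basis. (T [a, b] x * V [i, j, a, b] x + T [i, a, b] x * V [j, a, b] x) + (T [j, a, b] x * V [i, a, b] x + T [i, j, a, b] x * V [a, b] x))"
definition ddGW :: "'a \<Rightarrow> 'a \<Rightarrow> 'a \<Rightarrow> real" where "ddGW i j x = (\<Sum>a\<in>Basis. T [j, a] x * W [i, a] x + T [i, j, a] x * W [a] x)"
definition ddGV :: "'a \<Rightarrow> 'a \<Rightarrow> 'a \<Rightarrow> real" where "ddGV i j x = (\<Sum>a\<in>Basis. 2 * (V [a] x * V [i, j, a] x + V [i, a] x * V [j, a] x))"
definition ddVW :: "'a \<Rightarrow> 'a \<Rightarrow> 'a \<Rightarrow> real" where "ddVW i j x = (V [] x * W [i, j] x + V [i] x * W [j] x) + (V [j] x * W [i] x + V [i, j] x * W [] x)"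

definition dG :: "'a \<Rightarrow> 'a \<Rightarrow> 'a \<Rightarrow> real" where
  "dG i j x = ddN3 i j x - ddTV i j x + ddGW i j x - 1/2 * (V [] x * W [i, j] x + V [i] x * W [j] x) - 1/2 * T [i, j] x
     + \<beta> * ddGV i j x - (1/4 + \<beta>) * (ddVW i j x + T [i, j] x)"

lemma grad_dN3: "grad_bar \<Omega> (dN3 j) (\<lambda>i. ddN3 i j)"
  unfolding dN3_def[abs_def] ddN3_def[abs_def] by (intro grad_bar_sum grad_bar_cmult grad_bar_mult T_grad) simp_all

lemma grad_dTV: "grad_bar \<Omega> (dTV j) (\<lambda>i. ddTV i j)"
  unfolding dTV_def[abs_def] ddTV_def[abs_def] by (intro grad_intros) simp_all

lemma grad_dGV: "grad_bar \<Omega> (dGV j) (\<lambda>i. ddGV i j)"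
  unfolding dGV_def[abs_def] ddGV_def[abs_def] by (intro grad_bar_sum grad_bar_cmult grad_bar_mult V_grad) simp_all

lemma grad_dVW: "grad_bar \<Omega> (dVW j) (\<lambda>i. ddVW i j)"
  unfolding dVW_def[abs_def] ddVW_def[abs_def] by (intro grad_intros) simp_all

lemma grad_dGW: "grad_bar \<Omega> (\<lambda>x. \<Sum>a\<in>Basis. T [j, a] x * W [a] x) (\<lambda>i. ddGW i j)"
  unfolding ddGW_def[abs_def] by (intro grad_intros) simp_all

lemma G_grad: "grad_bar \<Omega> (G j) (\<lambda>i. dG i j)"
  unfolding G_def[abs_def] dG_def[abs_def]
  by (intro grad_bar_add grad_bar_diff grad_bar_cmult grad_bar_mult grad_dN3 grad_dTV grad_dGV grad_dVW grad_dGW T_grad V_grad W_grad) simp_all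

definition N4 :: "'a \<Rightarrow> real" where "N4 x = (\<Sum>a\<in>Basis. \<Sum>b\<in>Basis. \<Sum>c\<in>Basis. \<Sum>d\<in>Basis. (T [a, b, c, d] x)\<^sup>2)"
definition NV :: "'a \<Rightarrow> real" where "NV x = (\<Sum>a\<in>Basis. \<Sum>b\<in>Basis. (V [a, b] x)\<^sup>2)"

lemma E_eq: "E x = 2 * N4 x - (1 - 2 * \<beta>) * NV x - (1/4 + \<beta>) * (W [] x)\<^sup>2"
proof -
  have 1: "(\<Sum>a\<in>Basis. \<Sum>b\<in>Basis. \<Sum>c\<in>Basis. \<Sum>d\<in>Basis. (H a b c d x)\<^sup>2) = N4 x - 6 / (n + 4) * NV x + 3 / ((n + 2) * (n + 4)) * (W [] x)\<^sup>2"
    unfolding H_def N4_def NV_def n_def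
  proof (rule trace_free_part)
    show "T [a, b, k, d] x = T [b, a, k, d] x" "T [a, b, k, d] x = T [a, k, b, d] x" "T [a, b, k, d] x = T [a, b, d, k] x" for a b k d
      by (rule fun_cong[OF T_perm]; simp)+
    show "(\<Sum>a\<in>Basis. T [a, a, k, d] x) = V [k, d] x" for k d by (simp add: T_tr)
    show "(\<Sum>c\<in>Basis. V [c, c] x) = W [] x" by (simp add: V_tr)
  qed simp
  have 2: "n + 4 \<noteq> 0" "n + 2 \<noteq> 0" using n_ge_2 by auto
  have 3: "1 - 2 * \<beta> = 12 / (n + 4)" using 2 by (simp add: \<beta>_def field_simps)
  have 4: "6 / ((n + 2) * (n + 4)) - \<kappa> = - (1/4 + \<beta>)"
    using 2 by (simp add: \<beta>_def \<kappa>_def divide_simps) (simp add: algebra_simps)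
  have "E x = 2 * N4 x - 12 / (n + 4) * NV x + (6 / ((n + 2) * (n + 4)) - \<kappa>) * (W [] x)\<^sup>2"
    unfolding E_def 1 by (simp add: algebra_simps)
  then show ?thesis unfolding 3 4 by (simp add: algebra_simps)
qed

lemma div_G:
  assumes x: "x \<in> \<Omega>"
  shows "(\<Sum>j\<in>Basis. dG j j x) = E x"
proof -
  \<comment> \<open>A, B, C are D^3 u : D^3 v, D^2 u : D^2 w and \<nabla>v \<cdot> \<nabla>w, the
    three products that cancel in the final sum.\<close>
  define A where "A = (\<Sum>a\<in>Basis. \<Sum>b\<in>Basis. \<Sum>c\<in>Basis. T [a, b, c] x * V [a, b, c] x)"
  define B where "B = (\<Sum>a\<in>Basis. \<Sum>b\<in>Basis. T [a, b] x * W [a, b] x)"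
  define C where "C = (\<Sum>a\<in>Basis. V [a] x * W [a] x)"
  have tr: "(\<Sum>j\<in>Basis. W [j, j] x) = -1" "(\<Sum>j\<in>Basis. V [j, j] x) = W [] x" "(\<Sum>j\<in>Basis. T [j, j] x) = V [] x"
    using W_trace[OF x] V_tr[of "[]"] T_tr[of "[]"] by auto
  have 1: "(\<Sum>j\<in>Basis. ddN3 j j x) = 2 * A + 2 * N4 x"
  proof -
    have "(\<Sum>j\<in>Basis. \<Sum>a\<in>Basis. \<Sum>b\<in>Basis. \<Sum>c\<in>Basis. T [a, b, c] x * T [j, j, a, b, c] x) = A"
      by (subst sum_rot4) (simp add: T_tr A_def flip: sum_distrib_left)
    then show ?thesis
      by (simp add: ddN3_def N4_def sum.distrib distrib_left power2_eq_square flip: sum_distrib_left)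
  qed
  have 2: "(\<Sum>j\<in>Basis. ddTV j j x) = B + 2 * A + NV x"
  proof -
    have a: "(\<Sum>j\<in>Basis. \<Sum>a\<in>Basis. \<Sum>b\<in>Basis. T [a, b] x * V [j, j, a, b] x) = B"
      by (subst sum_rot3) (simp add: V_tr B_def flip: sum_distrib_left)
    have b: "(\<Sum>j\<in>Basis. \<Sum>a\<in>Basis. \<Sum>b\<in>Basis. T [j, j, a, b] x * V [a, b] x) = NV x"
      by (subst sum_rot3) (simp add: T_tr NV_def power2_eq_square flip: sum_distrib_right)
    show ?thesis unfolding ddTV_def sum.distrib a b A_def by linarith
  qed
  have 3: "(\<Sum>j\<in>Basis. ddGW j j x) = B + C"
  proof -
    have "(\<Sum>j\<in>Basis. \<Sum>a\<in>Basis. T [j, j, a] x * W [a] x) = C"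
      by (subst sum.swap) (simp add: C_def T_tr flip: sum_distrib_right)
    then show ?thesis by (simp add: ddGW_def sum.distrib B_def)
  qed
  have 4: "(\<Sum>j\<in>Basis. V [] x * W [j, j] x) = - V [] x" "(\<Sum>j\<in>Basis. V [j] x * W [j] x) = C"
    by (simp_all add: C_def tr flip: sum_distrib_left)
  have 5: "(\<Sum>j\<in>Basis. ddGV j j x) = 2 * C + 2 * NV x"
  proof -
    have "(\<Sum>j\<in>Basis. \<Sum>a\<in>Basis. V [a] x * V [j, j, a] x) = C"
      by (subst sum.swap) (simp add: C_def V_tr flip: sum_distrib_left)
    then show ?thesis by (simp add: ddGV_def NV_def sum.distrib distrib_left power2_eq_square flip: sum_distrib_left)
  qed
  have 6: "(\<Sum>j\<in>Basis. ddVW j j x) = - V [] x + 2 * C + (W [] x)\<^sup>2"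
    by (simp add: ddVW_def sum.distrib C_def tr power2_eq_square flip: sum_distrib_left sum_distrib_right)
  have "(\<Sum>j\<in>Basis. dG j j x) = (2 * A + 2 * N4 x) - (B + 2 * A + NV x) + (B + C) - 1/2 * (- V [] x + C) - 1/2 * V [] x
      + \<beta> * (2 * C + 2 * NV x) - (1/4 + \<beta>) * (- V [] x + 2 * C + (W [] x)\<^sup>2 + V [] x)"
    unfolding dG_def sum.distrib sum_subtractf sum_distrib_left[symmetric, of "1/2"] sum_distrib_left[symmetric, of \<beta>]
      sum_distrib_left[symmetric, of "1/4 + \<beta>"] 1 2 3 4 5 6 tr(3) ..
  also have "\<dots> = E x" unfolding E_eq by (simp add: algebra_simps)
  finally show ?thesis .
qed

lemma E_C0: "C0bar \<Omega> E"
proof (rule C0bar_cong)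
  show "C0bar \<Omega> (\<lambda>x. \<Sum>j\<in>Basis. dG j j x)" by (rule C0bar_sum) (rule grad_barD(3)[OF G_grad])
qed (simp add: div_G)

text \<open>The weak form of \<Delta>P = E. With G in place of \<nabla>P it is the divergence
  theorem; the difference of the two fields is half the divergence of the antisymmetric part
  \<open>b i j - b j i\<close>, whose integral against \<nabla>\<psi> vanishes by
  \<open>integral_null_lagrangian\<close>.\<close>

lemma test_P:
  assumes K: "compact K" "K \<subseteq> \<Omega>" and psi: "C1bar \<Omega> \<psi>" and z: "\<And>x. x \<in> \<Omega> \<Longrightarrow> x \<notin> K \<Longrightarrow> \<psi> x = 0"
  shows "integral \<Omega> (\<lambda>x. \<Sum>j\<in>Basis. dir_deriv \<psi> j x * dP j x) = - integral \<Omega> (\<lambda>x. \<psi> x * E x)"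
proof -
  have psi_grad: "grad_bar \<Omega> \<psi> (\<lambda>j. dir_deriv \<psi> j)" using psi by (simp add: grad_bar_def)
  define b where "b i j x = T [i] x * W [j] x" for i j x
  have b_grad: "grad_bar \<Omega> (b i j) (\<lambda>k x. T [i] x * W [k, j] x + T [k, i] x * W [j] x)" for i j
    unfolding b_def[abs_def] by (intro grad_intros) simp_all
  have C0: "C0bar \<Omega> (dir_deriv \<psi> k)" "C0bar \<Omega> (dir_deriv (b i j) k)" "C0bar \<Omega> (G k)" if "k \<in> Basis" for i j k
    using C1barD(3)[OF psi that] C1barD(3)[OF grad_barD(1)[OF b_grad] that] C1barD(1)[OF grad_barD(1)[OF G_grad]] by auto
  have "integral \<Omega> (\<lambda>x. \<psi> x * E x + (\<Sum>j\<in>Basis. dir_deriv \<psi> j x * G j x)) = 0"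
  proof (rule divergence_zero_grad[OF opn bdd])
    show "grad_bar \<Omega> (\<lambda>x. \<psi> x * G j x) (\<lambda>i x. \<psi> x * dG i j x + dir_deriv \<psi> i x * G j x)" for j
      by (intro grad_bar_mult psi_grad G_grad)
    show "zero_bdry \<Omega> (\<lambda>x. \<psi> x * G j x)" for j
      by (rule zero_bdry_mult[OF opn compact_support_bar(2)[OF opn K C0bar_continuous_on[OF C1barD(1)[OF psi]] z]])
        (simp_all add: C1barD(1)[OF grad_barD(1)[OF G_grad]])
    show "\<psi> x * E x + (\<Sum>j\<in>Basis. dir_deriv \<psi> j x * G j x) = (\<Sum>j\<in>Basis. \<psi> x * dG j j x + dir_deriv \<psi> j x * G j x)" if "x \<in> \<Omega>" for x
      using div_G[OF that] by (simp add: sum.distrib flip: sum_distrib_left)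
  qed
  then have "integral \<Omega> (\<lambda>x. \<psi> x * E x) = - integral \<Omega> (\<lambda>x. \<Sum>j\<in>Basis. dir_deriv \<psi> j x * G j x)"
    by (rule integral_add_zero[rotated 2]) (intro C0bar_sum C0bar_mult C0 C1barD(1)[OF psi] E_C0; assumption)+
  then have 1: "integral \<Omega> (\<lambda>x. \<Sum>j\<in>Basis. dir_deriv \<psi> j x * G j x) = - integral \<Omega> (\<lambda>x. \<psi> x * E x)"
    by simp
  have null: "integral \<Omega> (\<lambda>x. dir_deriv \<psi> j x * dir_deriv (b i j) i x) = integral \<Omega> (\<lambda>x. dir_deriv \<psi> i x * dir_deriv (b i j) j x)"
    if "i \<in> Basis" "j \<in> Basis" for i j
    using integral_null_lagrangian[OF opn bdd K psi z grad_barD(1)[OF b_grad] that] by blast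
  have cb: "C0bar \<Omega> (\<lambda>x. \<Sum>j\<in>Basis. \<Sum>i\<in>Basis. dir_deriv \<psi> j x * dir_deriv (b i j) i x)"
    "C0bar \<Omega> (\<lambda>x. \<Sum>j\<in>Basis. \<Sum>i\<in>Basis. dir_deriv \<psi> j x * dir_deriv (b j i) i x)"
    "C0bar \<Omega> (\<lambda>x. \<Sum>j\<in>Basis. dir_deriv \<psi> j x * G j x)"
    by (intro C0bar_sum C0bar_mult C0; assumption)+
  have i1: "integral \<Omega> (\<lambda>x. \<Sum>j\<in>Basis. \<Sum>i\<in>Basis. dir_deriv \<psi> j x * dir_deriv (b i j) i x)
      = (\<Sum>j\<in>Basis. \<Sum>i\<in>Basis. integral \<Omega> (\<lambda>x. dir_deriv \<psi> j x * dir_deriv (b i j) i x))"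
    by (subst integral_sum; (intro finite_Basis integrable_C0 C0bar_sum C0bar_mult C0; assumption)?)
      (intro sum.cong refl integral_sum finite_Basis integrable_C0 C0bar_mult C0; assumption)
  have i2: "integral \<Omega> (\<lambda>x. \<Sum>j\<in>Basis. \<Sum>i\<in>Basis. dir_deriv \<psi> j x * dir_deriv (b j i) i x)
      = (\<Sum>j\<in>Basis. \<Sum>i\<in>Basis. integral \<Omega> (\<lambda>x. dir_deriv \<psi> j x * dir_deriv (b j i) i x))"
    by (subst integral_sum; (intro finite_Basis integrable_C0 C0bar_sum C0bar_mult C0; assumption)?)
      (intro sum.cong refl integral_sum finite_Basis integrable_C0 C0bar_mult C0; assumption)
  have eq: "integral \<Omega> (\<lambda>x. \<Sum>j\<in>Basis. \<Sum>i\<in>Basis. dir_deriv \<psi> j x * dir_deriv (b i j) i x)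
      = integral \<Omega> (\<lambda>x. \<Sum>j\<in>Basis. \<Sum>i\<in>Basis. dir_deriv \<psi> j x * dir_deriv (b j i) i x)"
    unfolding i1 i2 using null by (subst sum.swap) (auto intro!: sum.cong)
  have "dP j x = G j x + 1/2 * ((\<Sum>i\<in>Basis. dir_deriv (b i j) i x) - (\<Sum>i\<in>Basis. dir_deriv (b j i) i x))"
    if x: "x \<in> \<Omega>" and j: "j \<in> Basis" for j x
  proof -
    have "(\<Sum>i\<in>Basis. dir_deriv (b i j) i x) = (\<Sum>i\<in>Basis. T [i] x * W [i, j] x + T [i, i] x * W [j] x)"
      by (intro sum.cong refl) (simp add: grad_barD(2)[OF b_grad x])
    also have "\<dots> = (\<Sum>i\<in>Basis. T [i] x * W [j, i] x) + V [] x * W [j] x"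
    proof -
      have "W [i, j] x = W [j, i] x" for i by (rule fun_cong[OF W_perm]) auto
      then show ?thesis by (simp add: sum.distrib T_tr flip: sum_distrib_right)
    qed
    finally have b1: "(\<Sum>i\<in>Basis. dir_deriv (b i j) i x) = (\<Sum>i\<in>Basis. T [i] x * W [j, i] x) + V [] x * W [j] x" .
    have "(\<Sum>i\<in>Basis. dir_deriv (b j i) i x) = (\<Sum>i\<in>Basis. T [j] x * W [i, i] x + T [i, j] x * W [i] x)"
      by (intro sum.cong refl) (simp add: grad_barD(2)[OF b_grad x])
    also have "\<dots> = - T [j] x + (\<Sum>i\<in>Basis. T [j, i] x * W [i] x)"
    proof -
      have "T [i, j] x = T [j, i] x" for i by (rule fun_cong[OF T_perm]) auto
      then show ?thesis using W_trace[OF x] by (simp add: sum.distrib flip: sum_distrib_left)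
    qed
    finally have b2: "(\<Sum>i\<in>Basis. dir_deriv (b j i) i x) = - T [j] x + (\<Sum>i\<in>Basis. T [j, i] x * W [i] x)" .
    show ?thesis unfolding b1 b2 dP_def G_def dGW_def sum.distrib by (simp add: algebra_simps)
  qed
  then have "integral \<Omega> (\<lambda>x. \<Sum>j\<in>Basis. dir_deriv \<psi> j x * dP j x)
     = integral \<Omega> (\<lambda>x. (\<Sum>j\<in>Basis. dir_deriv \<psi> j x * G j x) + 1/2 * ((\<Sum>j\<in>Basis. \<Sum>i\<in>Basis. dir_deriv \<psi> j x * dir_deriv (b i j) i x)
        - (\<Sum>j\<in>Basis. \<Sum>i\<in>Basis. dir_deriv \<psi> j x * dir_deriv (b j i) i x)))"
    by (intro integral_cong)
      (simp add: sum.distrib sum_subtractf distrib_left right_diff_distrib sum_distrib_left mult.left_commute)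
  also have "\<dots> = integral \<Omega> (\<lambda>x. \<Sum>j\<in>Basis. dir_deriv \<psi> j x * G j x) + 1/2 * (integral \<Omega> (\<lambda>x. \<Sum>j\<in>Basis. \<Sum>i\<in>Basis. dir_deriv \<psi> j x * dir_deriv (b i j) i x)
        - integral \<Omega> (\<lambda>x. \<Sum>j\<in>Basis. \<Sum>i\<in>Basis. dir_deriv \<psi> j x * dir_deriv (b j i) i x))"
    by (subst integral_add, (intro integrable_C0 C0bar_mult C0bar_diff C0bar_const cb)+)
      (simp add: integral_diff[OF integrable_C0[OF cb(1)] integrable_C0[OF cb(2)]])
  finally show ?thesis using eq 1 by simp
qed

end

section \<open>Truncated test functions, the deficit Q and the planar case\<close>

lemma trunc_nonneg: "e > 0 \<Longrightarrow> 0 \<le> trunc e t" "e > 0 \<Longrightarrow> 0 \<le> trunc' e t"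
  by (auto simp: trunc_def trunc'_def intro!: mult_nonneg_nonneg add_nonneg_nonneg divide_nonneg_nonneg)

lemma compact_support_grad_bar:
  fixes f :: "'a::euclidean_space \<Rightarrow> real"
  assumes S: "open S" and K: "compact K" "K \<subseteq> S"
    and f: "\<And>x. x \<in> S \<Longrightarrow> f differentiable (at x)" "\<And>x i. x \<in> S \<Longrightarrow> i \<in> Basis \<Longrightarrow> dir_deriv f i x = D i x"
    and D: "\<And>i. i \<in> Basis \<Longrightarrow> continuous_on S (D i)" and z: "\<And>x. x \<in> S \<Longrightarrow> x \<notin> K \<Longrightarrow> f x = 0"
  shows "grad_bar S f D" "zero_bdry S f"
proof -
  have fc: "continuous_on S f"
    using f(1) by (simp add: continuous_at_imp_continuous_on differentiable_imp_continuous_within)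
  show "zero_bdry S f" by (rule compact_support_bar(2)[OF S K fc z])
  have "D i x = 0" if "x \<in> S" "x \<notin> K" "i \<in> Basis" for x i
  proof -
    have "open (S \<inter> - K)" using S K(1) compact_imp_closed by blast
    then have "dir_deriv f i x = dir_deriv (\<lambda>x. 0) i x"
      by (rule dir_deriv_cong) (use that z in auto)
    then show ?thesis using f(2)[OF that(1,3)] by simp
  qed
  then have "C0bar S (D i)" if "i \<in> Basis" for i
    using compact_support_bar(1)[OF S K D[OF that]] that by blast
  then have "C0bar S (dir_deriv f i)" if "i \<in> Basis" for i
    using C0bar_cong[of S "D i" "dir_deriv f i"] f(2) that by blast
  then show "grad_bar S f D"
    using compact_support_bar(1)[OF S K fc z] f by (simp add: grad_bar_def C1bar_def)
qed

text \<open>Only interior regularity and a compact superlevel set are asked of f. So the lemma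
  serves \<gamma>, whose gradient is not controlled near the boundary, as well as - Q and polynomial
  bumps.\<close>

lemma trunc_test_function:
  fixes f :: "'a::euclidean_space \<Rightarrow> real"
  assumes S: "open S" and e: "e > 0" and K: "compact {x \<in> S. e \<le> f x}"
    and f: "\<And>x. x \<in> S \<Longrightarrow> f differentiable (at x)" and D: "\<And>i. i \<in> Basis \<Longrightarrow> continuous_on S (dir_deriv f i)"
  shows "grad_bar S (\<lambda>x. trunc e (f x)) (\<lambda>i x. trunc' e (f x) * dir_deriv f i x)" "zero_bdry S (\<lambda>x. trunc e (f x))"
proof -
  have fc: "continuous_on S f"
    using f by (simp add: continuous_at_imp_continuous_on differentiable_imp_continuous_within)
  have c: "continuous_on S (\<lambda>x. trunc' e (f x) * dir_deriv f i x)" if "i \<in> Basis" for i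
    by (intro continuous_on_mult D[OF that] continuous_on_compose2[OF trunc_continuous(2)[OF e, of UNIV] fc]) auto
  have z: "trunc e (f x) = 0" if "x \<in> S" "x \<notin> {x \<in> S. e \<le> f x}" for x
    using trunc_zero[OF e, of "f x"] that by auto
  have d: "(\<lambda>x. trunc e (f x)) differentiable (at x)" "dir_deriv (\<lambda>x. trunc e (f x)) i x = trunc' e (f x) * dir_deriv f i x"
    if "x \<in> S" for x i
    using dir_deriv_compose[OF trunc_deriv[OF e] f[OF that]] by auto
  show "grad_bar S (\<lambda>x. trunc e (f x)) (\<lambda>i x. trunc' e (f x) * dir_deriv f i x)"
    by (rule compact_support_grad_bar(1)[OF S K _ d c z]) auto
  show "zero_bdry S (\<lambda>x. trunc e (f x))"
    by (rule compact_support_grad_bar(2)[OF S K _ d c z]) auto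
qed

lemma sum_squares_dist: "(\<Sum>i\<in>Basis. ((y \<bullet> i) - (x \<bullet> i))\<^sup>2) = (dist x (y::'a::euclidean_space))\<^sup>2"
proof -
  have "(dist x y)\<^sup>2 = (y - x) \<bullet> (y - x)" by (metis dist_commute dist_norm power2_norm_eq_inner)
  also have "\<dots> = (\<Sum>i\<in>Basis. ((y - x) \<bullet> i) * ((y - x) \<bullet> i))" by (rule euclidean_inner)
  finally show ?thesis by (simp add: inner_diff_left power2_eq_square)
qed

context overdetermined begin

lemma P_C0: "C0bar \<Omega> P" by (rule C1barD(1)[OF grad_barD(1)[OF P_grad]])

lemma integral_P: "integral \<Omega> P = (5/2 + \<beta>) * integral \<Omega> (T [])"
proof -
  note i = energy_C0[THEN integrable_C0]
  have "integral \<Omega> P = integral \<Omega> N3 - integral \<Omega> TV + 1/2 * integral \<Omega> GW + \<beta> * integral \<Omega> GV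
      - (1/4 + \<beta>) * (integral \<Omega> VW + integral \<Omega> (T []))"
    unfolding P_def[abs_def]
    by (subst integral_diff integral_add, (intro integrable_C0 C0bar_add C0bar_diff C0bar_mult C0bar_const energy_C0)+)+
      (simp add: integral_add[OF i(5,6)])
  then show ?thesis using integral_energies by (simp add: algebra_simps)
qed

lemma P_bdry:
  assumes p: "p \<in> frontier \<Omega>"
  shows "(P \<longlongrightarrow> c\<^sup>2 * (1 + \<beta>)) (at p within \<Omega>)"
proof -
  have zero: "(f \<longlongrightarrow> 0) (at p within \<Omega>)" if "zero_bdry \<Omega> f" for f using that p by (simp add: zero_bdry_def)
  have "(N3 \<longlongrightarrow> (\<Sum>i\<in>Basis. \<Sum>j\<in>Basis. \<Sum>k\<in>Basis. (c * (\<nu> p \<bullet> i) * (\<nu> p \<bullet> j) * (\<nu> p \<bullet> k))\<^sup>2)) (at p within \<Omega>)"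
    unfolding N3_def[abs_def] by (intro tendsto_sum tendsto_power bval_T3[OF p])
  moreover have "(\<Sum>i\<in>Basis. \<Sum>j\<in>Basis. \<Sum>k\<in>Basis. (c * (\<nu> p \<bullet> i) * (\<nu> p \<bullet> j) * (\<nu> p \<bullet> k))\<^sup>2) = c\<^sup>2"
  proof -
    have "(\<Sum>i\<in>Basis. \<Sum>j\<in>Basis. \<Sum>k\<in>Basis. (c * (\<nu> p \<bullet> i) * (\<nu> p \<bullet> j) * (\<nu> p \<bullet> k))\<^sup>2)
      = (\<Sum>i\<in>Basis. c\<^sup>2 * ((\<nu> p \<bullet> i) * (\<nu> p \<bullet> i)) * (\<Sum>j\<in>Basis. ((\<nu> p \<bullet> j) * (\<nu> p \<bullet> j)) * (\<Sum>k\<in>Basis. (\<nu> p \<bullet> k) * (\<nu> p \<bullet> k))))"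
      unfolding sum_distrib_left by (intro sum.cong refl) (simp add: power2_eq_square ac_simps)
    also have "\<dots> = c\<^sup>2" using nu_sum[OF p] by (simp flip: sum_distrib_left)
    finally show ?thesis .
  qed
  ultimately have N3: "(N3 \<longlongrightarrow> c\<^sup>2) (at p within \<Omega>)" by simp
  have TV: "(TV \<longlongrightarrow> 0) (at p within \<Omega>)" unfolding TV_def[abs_def]
    by (rule zero, intro zero_bdry_sum zero_bdry_mult[OF opn T2_zero_bdry] V_C0) simp
  have GW: "(GW \<longlongrightarrow> 0) (at p within \<Omega>)" unfolding GW_def[abs_def]
    by (rule zero, intro zero_bdry_sum zero_bdry_mult[OF opn T1_zero_bdry] W_C0) simp
  have VW: "(VW \<longlongrightarrow> 0) (at p within \<Omega>)" unfolding VW_def[abs_def]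
    by (rule zero, intro zero_bdry_mult[OF opn V0_zero_bdry] W_C0) simp
  have "(P \<longlongrightarrow> c\<^sup>2 - 0 + 1/2 * 0 + \<beta> * c\<^sup>2 - (1/4 + \<beta>) * (0 + 0)) (at p within \<Omega>)"
    unfolding P_def[abs_def] by (intro tendsto_intros N3 TV GW VW GV_bdry[OF p] zero T0_zero_bdry)
  then show ?thesis by (simp add: algebra_simps)
qed

definition Q :: "'a \<Rightarrow> real" where "Q x = c\<^sup>2 * (1 + \<beta>) - P x"

lemma Q_grad: "grad_bar \<Omega> Q (\<lambda>j x. 0 - dP j x)"
  unfolding Q_def[abs_def] by (intro grad_bar_diff grad_bar_const P_grad)

lemma Q_C0: "C0bar \<Omega> Q" by (rule C1barD(1)[OF grad_barD(1)[OF Q_grad]])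

lemma Q_zero_bdry: "zero_bdry \<Omega> Q"
  unfolding zero_bdry_def Q_def[abs_def] using tendsto_diff[OF tendsto_const P_bdry, of _ "c\<^sup>2 * (1 + \<beta>)"] by simp

text \<open>Arithmetic from \<open>integral_P\<close> and the Pohozaev value of the integral of u.
  The factor next to -\<kappa> is precisely the bound assumed for the integral of w^2 \<gamma>; when
  \<kappa> = 0 the mean of Q is zero.\<close>

lemma integral_Q: "integral \<Omega> Q = - \<kappa> * (2 * (n + 2) * c\<^sup>2 * measure lebesgue \<Omega> / (n + 6))"
proof -
  define A where "A = c\<^sup>2 * measure lebesgue \<Omega>"
  have nz: "n + 6 \<noteq> 0" "n + 4 \<noteq> 0" "n + 2 \<noteq> 0" using n_ge_2 by auto
  have U: "integral \<Omega> (T []) = n * A / (n + 6)" using pohozaev nz(1) by (simp add: A_def field_simps)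
  have "integral \<Omega> Q = c\<^sup>2 * (1 + \<beta>) * measure lebesgue \<Omega> - integral \<Omega> P"
    unfolding Q_def[abs_def]
    by (subst integral_diff) (simp_all add: integral_const_open[OF opn bdd] integrable_C0 P_C0)
  also have "\<dots> = (1 + \<beta>) * A - (5/2 + \<beta>) * (n * A / (n + 6))"
    unfolding integral_P U by (simp add: A_def)
  also have "\<dots> = - \<kappa> * (2 * (n + 2) * A / (n + 6))"
    using nz by (simp add: \<beta>_def \<kappa>_def divide_simps) (simp add: algebra_simps)
  finally show ?thesis by (simp add: A_def mult.assoc)
qed

lemma H_zero_of_E_zero:
  assumes "E x + \<kappa> * (W [] x)\<^sup>2 = 0" "a \<in> Basis" "b \<in> Basis" "i \<in> Basis" "d \<in> Basis"
  shows "H a b i d x = 0"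
proof -
  have fin: "finite (Basis :: 'a set)" by simp
  have "(\<Sum>a\<in>Basis. \<Sum>b\<in>Basis. \<Sum>c\<in>Basis. \<Sum>d\<in>Basis. (H a b c d x)\<^sup>2) = 0" using assms(1) by (simp add: E_def)
  then have "(\<Sum>b\<in>Basis. \<Sum>c\<in>Basis. \<Sum>d\<in>Basis. (H a b c d x)\<^sup>2) = 0" using assms(2)
    by (subst (asm) sum_nonneg_eq_0_iff) (auto intro!: sum_nonneg)
  then have "(\<Sum>c\<in>Basis. \<Sum>d\<in>Basis. (H a b c d x)\<^sup>2) = 0" using assms(3)
    by (subst (asm) sum_nonneg_eq_0_iff) (auto intro!: sum_nonneg)
  then have "(\<Sum>d\<in>Basis. (H a b i d x)\<^sup>2) = 0" using assms(4)
    by (subst (asm) sum_nonneg_eq_0_iff) (auto intro!: sum_nonneg)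
  then have "(H a b i d x)\<^sup>2 = 0" using assms(5)
    by (subst (asm) sum_nonneg_eq_0_iff) auto
  then show ?thesis by simp
qed

lemma E_nonneg: "0 \<le> E x + \<kappa> * (W [] x)\<^sup>2"
  by (simp add: E_def sum_nonneg)

text \<open>A weak maximum principle. For \<psi> a truncation of P - c^2 (1 + \<beta>), the product
  \<nabla>\<psi> \<cdot> \<nabla>P is \<open>trunc'\<close> times |\<nabla>P|^2 and hence \<ge> 0,
  whereas \<open>test_P\<close> makes its integral minus that of \<psi> E, with E \<ge> 0. So
  \<nabla>\<psi> = 0, and \<psi>, being zero on the boundary, vanishes.\<close>

lemma Q_nonneg_2d:
  assumes "\<kappa> = 0" and x: "x \<in> \<Omega>"
  shows "0 \<le> Q x"
proof (rule ccontr)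
  assume neg: "\<not> 0 \<le> Q x"
  define e where "e = - Q x / 2"
  have e: "e > 0" "e < - Q x" using neg by (auto simp: e_def)
  define f where "f x = - Q x" for x
  have fg: "grad_bar \<Omega> f dP"
    unfolding f_def[abs_def] Q_def[abs_def] using grad_bar_diff[OF P_grad grad_bar_const[of \<Omega> "c\<^sup>2 * (1 + \<beta>)"]] by simp
  have fz: "zero_bdry \<Omega> f"
    using zero_bdry_diff[OF zero_bdry_const Q_zero_bdry] by (simp add: f_def[abs_def])
  have K: "compact {x \<in> \<Omega>. e \<le> f x}"
    by (rule compact_superlevel[OF opn bdd C1barD(1)[OF grad_barD(1)[OF fg]] fz e(1)])
  note tt = trunc_test_function[OF opn e(1) K C1barD(2)[OF grad_barD(1)[OF fg]]
      C0bar_continuous_on[OF C1barD(3)[OF grad_barD(1)[OF fg]]]]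
  define \<psi> where "\<psi> x = trunc e (f x)" for x
  have pg: "grad_bar \<Omega> \<psi> (\<lambda>i x. trunc' e (f x) * dir_deriv f i x)" using tt(1) by (simp add: \<psi>_def[abs_def])
  have dpsi: "dir_deriv \<psi> j y = trunc' e (f y) * dP j y" if "y \<in> \<Omega>" "j \<in> Basis" for j y
    using grad_barD(2)[OF pg that] grad_barD(2)[OF fg that] by simp
  have "integral \<Omega> (\<lambda>x. \<Sum>j\<in>Basis. dir_deriv \<psi> j x * dP j x) = - integral \<Omega> (\<lambda>x. \<psi> x * E x)"
    by (rule test_P[OF K _ grad_barD(1)[OF pg]]) (use trunc_zero[OF e(1)] in \<open>auto simp: \<psi>_def\<close>)
  moreover have "integral \<Omega> (\<lambda>x. \<psi> x * E x) \<ge> 0"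
    by (rule integral_nonneg[OF integrable_C0[OF C0bar_mult[OF C1barD(1)[OF grad_barD(1)[OF pg]] E_C0]]])
      (use E_nonneg assms(1) trunc_nonneg[OF e(1)] in \<open>simp add: \<psi>_def\<close>)
  ultimately have le: "integral \<Omega> (\<lambda>x. \<Sum>j\<in>Basis. dir_deriv \<psi> j x * dP j x) \<le> 0" by linarith
  have nn: "0 \<le> dir_deriv \<psi> j y * dP j y" if "y \<in> \<Omega>" "j \<in> Basis" for j y
    using dpsi[OF that] trunc_nonneg(2)[OF e(1)] by (simp add: mult.assoc)
  have "dir_deriv \<psi> j y = 0" if y: "y \<in> \<Omega>" and j: "j \<in> Basis" for y j
  proof -
    have "(\<Sum>j\<in>Basis. dir_deriv \<psi> j y * dP j y) = 0"
    proof (rule integral_nonneg_zero_imp[OF opn bdd _ _ le y])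
      show "C0bar \<Omega> (\<lambda>x. \<Sum>j\<in>Basis. dir_deriv \<psi> j x * dP j x)"
        by (intro C0bar_sum C0bar_mult C1barD(3)[OF grad_barD(1)[OF pg]] grad_barD(3)[OF P_grad])
    qed (use nn in \<open>auto intro!: sum_nonneg\<close>)
    then have "dir_deriv \<psi> j y * dP j y = 0" using nn y j
      by (subst (asm) sum_nonneg_eq_0_iff) auto
    then show ?thesis using dpsi[OF y j] by auto
  qed
  then have "\<psi> x = 0"
    using zero_of_zero_gradient[OF opn conn bdd grad_barD(1)[OF pg] tt(2)[folded \<psi>_def] _ x] by blast
  moreover have "\<psi> x > 0" unfolding \<psi>_def by (rule trunc_pos[OF e(1)]) (use e in \<open>simp add: f_def\<close>)
  ultimately show False by simp
qed

text \<open>Q \<ge> 0 with integral 0 gives Q = 0, so \<nabla>P = 0. As E is tied to P only weakly,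
  this is turned into E = 0 at x by testing with a bump around x and using E \<ge> 0.\<close>

lemma E_zero_2d:
  assumes k: "\<kappa> = 0" and x: "x \<in> \<Omega>"
  shows "E x = 0"
proof -
  have "Q y = 0" if "y \<in> \<Omega>" for y
    by (rule integral_nonneg_zero_imp[OF opn bdd Q_C0 Q_nonneg_2d[OF k] _ that]) (simp_all add: integral_Q k)
  then have dP0: "dP j y = 0" if "y \<in> \<Omega>" "j \<in> Basis" for y j
    using dir_deriv_cong[OF opn that(1), of Q "\<lambda>x. 0" j] grad_barD(2)[OF Q_grad that] by simp
  obtain r where r: "r > 0" "cball x r \<subseteq> \<Omega>" using opn x open_contains_cball by blast
  \<comment> \<open>Shifted by 1 so that truncation at level 1 is positive exactly on the open ball
    of radius r about x.\<close>
  define f where "f y = 1 + r\<^sup>2 - (\<Sum>i\<in>Basis. ((y \<bullet> i) - (x \<bullet> i))\<^sup>2)" for y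
  have fg: "grad_bar \<Omega> f (\<lambda>j y. 0 - (\<Sum>i\<in>Basis. 2 * (((y \<bullet> i) - (x \<bullet> i)) * ((j \<bullet> i) - 0))))"
    unfolding f_def[abs_def] by (intro grad_intros)
  have fd: "f y = 1 + r\<^sup>2 - (dist x y)\<^sup>2" for y
    by (simp add: f_def sum_squares_dist)
  have "{y \<in> \<Omega>. 1 \<le> f y} = cball x r"
    using r by (auto simp: fd abs_le_square_iff[symmetric])
  then have K: "compact {y \<in> \<Omega>. 1 \<le> f y}" by simp
  note tt = trunc_test_function[OF opn zero_less_one K C1barD(2)[OF grad_barD(1)[OF fg]]
      C0bar_continuous_on[OF C1barD(3)[OF grad_barD(1)[OF fg]]]]
  let ?\<psi> = "\<lambda>y. trunc 1 (f y)"
  have "integral \<Omega> (\<lambda>x. \<Sum>j\<in>Basis. dir_deriv ?\<psi> j x * dP j x) = - integral \<Omega> (\<lambda>x. ?\<psi> x * E x)"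
    by (rule test_P[OF K _ grad_barD(1)[OF tt(1)]]) (use trunc_zero[of 1] in auto)
  moreover have "integral \<Omega> (\<lambda>x. \<Sum>j\<in>Basis. dir_deriv ?\<psi> j x * dP j x) = integral \<Omega> (\<lambda>x. 0)"
    by (rule integral_cong) (simp add: dP0)
  ultimately have i: "integral \<Omega> (\<lambda>x. ?\<psi> x * E x) \<le> 0" by simp
  have E0: "0 \<le> E y" for y using E_nonneg[of y] k by simp
  have "?\<psi> x * E x = 0"
    by (rule integral_nonneg_zero_imp[OF opn bdd C0bar_mult[OF C1barD(1)[OF grad_barD(1)[OF tt(1)]] E_C0] _ i x])
      (use E0 in \<open>auto intro!: mult_nonneg_nonneg trunc_nonneg(1) simp: E0\<close>)
  moreover have "?\<psi> x > 0" by (rule trunc_pos) (use r in \<open>simp_all add: fd\<close>)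
  ultimately show ?thesis by simp
qed

end

section \<open>The torsion function as a weight\<close>

lemma C0bar_abs: "C0bar S f \<Longrightarrow> C0bar S (\<lambda>x. \<bar>f x\<bar>)"
  unfolding C0bar_def by (metis (no_types, lifting) continuous_on_rabs)

lemma zero_bdry_abs: "zero_bdry S f \<Longrightarrow> zero_bdry S (\<lambda>x. \<bar>f x\<bar>)"
  unfolding zero_bdry_def using tendsto_rabs_zero by blast

text \<open>On the compact set where |f| \<ge> \<eta> the positive continuous g has a positive
  minimum; elsewhere |f| is below \<eta>. Applied to Q and \<gamma>, it takes the place of a bound
  of Q by a multiple of \<gamma>, which would require an estimate of \<gamma> from below near the
  boundary.\<close>

lemma bound_by_positive:
  fixes f g :: "'a::euclidean_space \<Rightarrow> real"
  assumes S: "open S" "bounded S" and f: "C0bar S f" "zero_bdry S f" and g: "continuous_on S g" "\<And>x. x \<in> S \<Longrightarrow> 0 < g x"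
    and \<eta>: "\<eta> > 0"
  obtains C where "0 \<le> C" "\<And>x. x \<in> S \<Longrightarrow> \<bar>f x\<bar> \<le> \<eta> + C * g x"
proof -
  let ?K = "{x \<in> S. \<eta> \<le> \<bar>f x\<bar>}"
  have K: "compact ?K" by (rule compact_superlevel[OF S C0bar_abs[OF f(1)] zero_bdry_abs[OF f(2)] \<eta>])
  obtain M where M: "0 < M" "\<And>x. x \<in> S \<Longrightarrow> \<bar>f x\<bar> \<le> M" using C0bar_bounded[OF S(2) f(1)] by blast
  show ?thesis
  proof (cases "?K = {}")
    case True
    then show ?thesis using that[of 0] by force
  next
    case False
    have "continuous_on ?K g" using g(1) by (rule continuous_on_subset) auto
    then obtain y where y: "y \<in> ?K" "\<And>x. x \<in> ?K \<Longrightarrow> g y \<le> g x"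
      using continuous_attains_inf[OF K False] by blast
    have gy: "0 < g y" using y(1) g(2) by auto
    show ?thesis
    proof (rule that[of "M / g y"])
      show "0 \<le> M / g y" using M gy by simp
      fix x assume x: "x \<in> S"
      show "\<bar>f x\<bar> \<le> \<eta> + M / g y * g x"
      proof (cases "x \<in> ?K")
        case True
        have "\<bar>f x\<bar> \<le> M / g y * g y" using M(2)[OF x] gy by simp
        also have "\<dots> \<le> M / g y * g x" using y(2)[OF True] M gy by (intro mult_left_mono) auto
        finally show ?thesis using \<eta> by simp
      next
        case False
        moreover have "0 \<le> M / g y * g x" using M gy g(2)[OF x] by simp
        ultimately show ?thesis using x by simp
      qed
    qed
  qed
qed

locale torsion =
  fixes S :: "'a::euclidean_space set" and \<gamma> :: "'a \<Rightarrow> real"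
  assumes opn: "open S" and bdd: "bounded S" and ne: "S \<noteq> {}" and tors: "torsion_function S \<gamma>"
begin

lemma gamma_differentiable: "x \<in> S \<Longrightarrow> \<gamma> differentiable (at x)"
  using tors unfolding torsion_function_def Ck_on_def
  by (metis (no_types, lifting) empty_subsetI iter_deriv.simps(1) list.set(1) list.size(3) zero_less_numeral)

lemma gamma_deriv_differentiable: "x \<in> S \<Longrightarrow> i \<in> Basis \<Longrightarrow> dir_deriv \<gamma> i differentiable (at x)"
proof -
  assume x: "x \<in> S" "i \<in> Basis"
  have "\<forall>vs. length vs < 2 \<longrightarrow> set vs \<subseteq> Basis \<longrightarrow> (\<forall>x\<in>S. iter_deriv vs \<gamma> differentiable (at x))"
    using tors unfolding torsion_function_def Ck_on_def by blast
  from this[rule_format, of "[i]" x] show ?thesis using x by simp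
qed

lemma gamma_continuous: "continuous_on S \<gamma>" "i \<in> Basis \<Longrightarrow> continuous_on S (dir_deriv \<gamma> i)"
  "i \<in> Basis \<Longrightarrow> j \<in> Basis \<Longrightarrow> continuous_on S (dir_deriv (dir_deriv \<gamma> j) i)"
proof -
  have "\<forall>vs. length vs \<le> 2 \<longrightarrow> set vs \<subseteq> Basis \<longrightarrow> continuous_on S (iter_deriv vs \<gamma>)"
    using tors unfolding torsion_function_def Ck_on_def by blast
  from this[rule_format, of "[]"] this[rule_format, of "[i]"] this[rule_format, of "[i, j]"]
  show "continuous_on S \<gamma>" "i \<in> Basis \<Longrightarrow> continuous_on S (dir_deriv \<gamma> i)"
    "i \<in> Basis \<Longrightarrow> j \<in> Basis \<Longrightarrow> continuous_on S (dir_deriv (dir_deriv \<gamma> j) i)" by auto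
qed

lemma gamma_laplacian: "x \<in> S \<Longrightarrow> (\<Sum>i\<in>Basis. dir_deriv (dir_deriv \<gamma> i) i x) = -1"
  using tors unfolding torsion_function_def laplacian_def by blast

lemma gamma_C0: "C0bar S \<gamma>"
  using tors unfolding torsion_function_def by (auto intro: C0barI)

lemma gamma_zero_bdry: "zero_bdry S \<gamma>"
  unfolding zero_bdry_def
proof
  fix p assume p: "p \<in> frontier S"
  have "(\<gamma> \<longlongrightarrow> \<gamma> p) (at p within closure S)"
    using tors p unfolding torsion_function_def by (auto simp: continuous_on_def frontier_def)
  then have "(\<gamma> \<longlongrightarrow> \<gamma> p) (at p within S)" using tendsto_within_subset[OF _ closure_subset] by blast
  then show "(\<gamma> \<longlongrightarrow> 0) (at p within S)" using tors p unfolding torsion_function_def by simp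
qed

text \<open>At an interior minimum all pure second derivatives are \<ge> 0, against \<Delta>\<gamma>
  = -1. So the minimum over the closure lies on the frontier and is 0, and an interior zero would
  again be an interior minimum.\<close>

lemma gamma_pos:
  assumes x: "x \<in> S" shows "0 < \<gamma> x"
proof -
  have no_min: False if y: "y \<in> S" and m: "\<And>z. z \<in> S \<Longrightarrow> \<gamma> y \<le> \<gamma> z" for y
  proof -
    have "0 \<le> (\<Sum>i\<in>Basis. dir_deriv (dir_deriv \<gamma> i) i y)"
      by (intro sum_nonneg second_deriv_nonneg_at_min[OF opn y gamma_differentiable gamma_deriv_differentiable[OF y] m])
    then show False using gamma_laplacian[OF y] by simp
  qed
  have a: "compact (closure S)" using bdd by (simp add: compact_closure)
  have b: "continuous_on (closure S) \<gamma>" using tors unfolding torsion_function_def by blast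
  have d: "closure S \<noteq> {}" using x closure_subset by blast
  obtain y where y: "y \<in> closure S" "\<And>z. z \<in> closure S \<Longrightarrow> \<gamma> y \<le> \<gamma> z"
    using continuous_attains_inf[OF a d b] by blast
  have yz: "\<gamma> y \<le> \<gamma> z" if "z \<in> S" for z using y(2) that closure_subset by blast
  have "y \<in> frontier S"
    using y(1) no_min[OF _ yz] opn by (auto simp: frontier_def interior_open)
  then have "\<gamma> y = 0" using tors unfolding torsion_function_def by blast
  then have nn: "0 \<le> \<gamma> z" if "z \<in> S" for z using yz[OF that] by simp
  have "\<gamma> x \<noteq> 0"
  proof
    assume "\<gamma> x = 0"
    then show False using no_min[OF x] nn by simp
  qed
  then show ?thesis using nn[OF x] by simp
qed

lemma gamma_superlevel: "e > 0 \<Longrightarrow> compact {x \<in> S. e \<le> \<gamma> x}"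
  by (rule compact_superlevel[OF opn bdd gamma_C0 gamma_zero_bdry])

definition g2 :: "'a \<Rightarrow> real" where "g2 x = (\<Sum>j\<in>Basis. (dir_deriv \<gamma> j x)\<^sup>2)"

lemma compose_cont: "continuous_on UNIV f \<Longrightarrow> continuous_on S (\<lambda>x. f (\<gamma> x))"
  by (rule continuous_on_compose2[OF _ gamma_continuous(1)]) auto

lemma field_grad:
  assumes e: "e > 0" and g: "\<And>t. (g has_real_derivative g' t) (at t)" "continuous_on UNIV g'" "\<And>t. t \<le> e \<Longrightarrow> g t = 0"
    and j: "j \<in> Basis"
  shows "grad_bar S (\<lambda>x. g (\<gamma> x) * dir_deriv \<gamma> j x)
      (\<lambda>i x. g (\<gamma> x) * dir_deriv (dir_deriv \<gamma> j) i x + g' (\<gamma> x) * dir_deriv \<gamma> i x * dir_deriv \<gamma> j x)"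
    "zero_bdry S (\<lambda>x. g (\<gamma> x) * dir_deriv \<gamma> j x)"
proof -
  note d = dir_deriv_compose[OF g(1) gamma_differentiable]
  have gc: "continuous_on UNIV g"
    using g(1) DERIV_isCont by (intro continuous_at_imp_continuous_on) blast
  have df: "(\<lambda>x. g (\<gamma> x) * dir_deriv \<gamma> j x) differentiable (at x)" if "x \<in> S" for x
    by (intro differentiable_mult d(1) gamma_deriv_differentiable that j)
  have dd: "dir_deriv (\<lambda>x. g (\<gamma> x) * dir_deriv \<gamma> j x) i x
      = g (\<gamma> x) * dir_deriv (dir_deriv \<gamma> j) i x + g' (\<gamma> x) * dir_deriv \<gamma> i x * dir_deriv \<gamma> j x"
    if "x \<in> S" "i \<in> Basis" for x i
    using dir_deriv_mult[OF d(1)[OF that(1)] gamma_deriv_differentiable[OF that(1) j]] d(2)[OF that(1)] by simp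
  have c: "continuous_on S (\<lambda>x. g (\<gamma> x) * dir_deriv (dir_deriv \<gamma> j) i x + g' (\<gamma> x) * dir_deriv \<gamma> i x * dir_deriv \<gamma> j x)"
    if "i \<in> Basis" for i
    by (intro continuous_on_add continuous_on_mult compose_cont gc g(2) gamma_continuous that j)
  have z: "g (\<gamma> x) * dir_deriv \<gamma> j x = 0" if "x \<in> S" "x \<notin> {x \<in> S. e \<le> \<gamma> x}" for x
    using g(3)[of "\<gamma> x"] that by auto
  show "grad_bar S (\<lambda>x. g (\<gamma> x) * dir_deriv \<gamma> j x)
      (\<lambda>i x. g (\<gamma> x) * dir_deriv (dir_deriv \<gamma> j) i x + g' (\<gamma> x) * dir_deriv \<gamma> i x * dir_deriv \<gamma> j x)"
    by (rule compact_support_grad_bar(1)[OF opn gamma_superlevel[OF e] _ df dd c z]) auto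
  show "zero_bdry S (\<lambda>x. g (\<gamma> x) * dir_deriv \<gamma> j x)"
    by (rule compact_support_grad_bar(2)[OF opn gamma_superlevel[OF e] _ df dd c z]) auto
qed

lemma C0bar_g2:
  assumes "e > 0" "continuous_on UNIV g" "\<And>t. t \<le> e \<Longrightarrow> g t = 0"
  shows "C0bar S (\<lambda>x. g (\<gamma> x) * g2 x)"
  unfolding g2_def
  by (rule compact_support_bar(1)[OF opn gamma_superlevel[OF assms(1)]])
    (use assms(3) in \<open>auto intro!: continuous_on_mult continuous_on_sum continuous_on_power compose_cont assms gamma_continuous\<close>)

lemma C0bar_compose:
  assumes "e > 0" "continuous_on UNIV g" "\<And>t. t \<le> e \<Longrightarrow> g t = 0"
  shows "C0bar S (\<lambda>x. g (\<gamma> x))"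
  by (rule compact_support_bar(1)[OF opn gamma_superlevel[OF assms(1)]])
    (use assms(3) in \<open>auto intro!: compose_cont assms\<close>)

text \<open>This is -\<Delta>\<gamma> = 1 tested with g(\<gamma>). As g vanishes up to e, the field
  g(\<gamma>) \<nabla>\<gamma> has compact support, whatever \<nabla>\<gamma> does near the
  boundary.\<close>

lemma integral_energy:
  assumes e: "e > 0" and g: "\<And>t. (g has_real_derivative g' t) (at t)" "continuous_on UNIV g'" "\<And>t. t \<le> e \<Longrightarrow> g t = 0"
    "\<And>t. t \<le> e \<Longrightarrow> g' t = 0"
  shows "integral S (\<lambda>x. g' (\<gamma> x) * g2 x) = integral S (\<lambda>x. g (\<gamma> x))"
proof -
  have gc: "continuous_on UNIV g"
    using g(1) DERIV_isCont by (intro continuous_at_imp_continuous_on) blast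
  note c = C0bar_g2[OF e g(2,4)] C0bar_compose[OF e gc g(3)]
  have "integral S (\<lambda>x. g' (\<gamma> x) * g2 x - g (\<gamma> x)) = 0"
  proof (rule divergence_zero_grad[OF opn bdd field_grad[OF e g(1-3)]])
    show "g' (\<gamma> x) * g2 x - g (\<gamma> x) = (\<Sum>j\<in>Basis. g (\<gamma> x) * dir_deriv (dir_deriv \<gamma> j) j x + g' (\<gamma> x) * dir_deriv \<gamma> j x * dir_deriv \<gamma> j x)"
      if "x \<in> S" for x
      using gamma_laplacian[OF that] by (simp add: g2_def sum.distrib power2_eq_square mult.assoc flip: sum_distrib_left)
  qed
  then show ?thesis using integral_diff[OF C0bar_integrable[OF opn bdd c(1)] C0bar_integrable[OF opn bdd c(2)]] by simp
qed

end

context overdetermined begin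

text \<open>\<open>test_P\<close> with the truncated \<gamma>, followed by a second integration by
  parts that moves the derivative from Q onto \<open>trunc'\<close> times \<nabla>\<gamma>. The
  divergence of that field is - \<open>trunc'\<close> + \<open>trunc''\<close> |\<nabla>\<gamma>|^2
  because \<Delta>\<gamma> = -1.\<close>

lemma test_torsion:
  assumes t: "torsion_function \<Omega> \<gamma>" and e: "e > 0"
  shows "integral \<Omega> (\<lambda>x. trunc e (\<gamma> x) * E x)
    = integral \<Omega> (\<lambda>x. Q x * trunc' e (\<gamma> x)) - integral \<Omega> (\<lambda>x. Q x * (trunc'' e (\<gamma> x) * torsion.g2 \<gamma> x))"
proof -
  interpret torsion \<Omega> \<gamma> using opn bdd ne t by unfold_locales
  note tt = trunc_test_function[OF opn e gamma_superlevel[OF e] gamma_differentiable gamma_continuous(2)]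
  have "integral \<Omega> (\<lambda>x. \<Sum>j\<in>Basis. dir_deriv (\<lambda>x. trunc e (\<gamma> x)) j x * dP j x) = - integral \<Omega> (\<lambda>x. trunc e (\<gamma> x) * E x)"
    by (rule test_P[OF gamma_superlevel[OF e] _ grad_barD(1)[OF tt(1)]]) (use trunc_zero[OF e] in auto)
  moreover have "integral \<Omega> (\<lambda>x. \<Sum>j\<in>Basis. dir_deriv (\<lambda>x. trunc e (\<gamma> x)) j x * dP j x)
      = integral \<Omega> (\<lambda>x. \<Sum>j\<in>Basis. trunc' e (\<gamma> x) * dir_deriv \<gamma> j x * dP j x)"
    by (intro integral_cong sum.cong refl) (simp add: grad_barD(2)[OF tt(1)])
  ultimately have 1: "integral \<Omega> (\<lambda>x. \<Sum>j\<in>Basis. trunc' e (\<gamma> x) * dir_deriv \<gamma> j x * dP j x) = - integral \<Omega> (\<lambda>x. trunc e (\<gamma> x) * E x)"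
    by simp
  note fg = field_grad[OF e trunc'_deriv[OF e] trunc''_continuous[OF e] trunc_zero(2)[OF e]]
  have cc1: "C0bar \<Omega> (\<lambda>x. trunc'' e (\<gamma> x) * g2 x)" by (rule C0bar_g2[OF e trunc''_continuous[OF e] trunc_zero(3)[OF e]])
  have cc2: "C0bar \<Omega> (\<lambda>x. trunc' e (\<gamma> x))" by (rule C0bar_compose[OF e trunc_continuous(2)[OF e] trunc_zero(2)[OF e]])
  have cc3: "C0bar \<Omega> (\<lambda>x. \<Sum>j\<in>Basis. trunc' e (\<gamma> x) * dir_deriv \<gamma> j x * dP j x)"
    by (intro C0bar_sum C0bar_mult[OF _ grad_barD(3)[OF P_grad]] grad_barD(3)[OF tt(1)])
  have "integral \<Omega> (\<lambda>x. (Q x * (trunc'' e (\<gamma> x) * g2 x) - Q x * trunc' e (\<gamma> x)) - (\<Sum>j\<in>Basis. trunc' e (\<gamma> x) * dir_deriv \<gamma> j x * dP j x)) = 0"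
  proof (rule divergence_zero_grad[OF opn bdd grad_bar_mult[OF Q_grad fg(1)] zero_bdry_mult[OF opn Q_zero_bdry C1barD(1)[OF grad_barD(1)[OF fg(1)]]]])
    fix x assume x: "x \<in> \<Omega>"
    have "(\<Sum>j\<in>Basis. Q x * (trunc' e (\<gamma> x) * dir_deriv (dir_deriv \<gamma> j) j x + trunc'' e (\<gamma> x) * dir_deriv \<gamma> j x * dir_deriv \<gamma> j x)
        + (0 - dP j x) * (trunc' e (\<gamma> x) * dir_deriv \<gamma> j x))
      = Q x * (trunc' e (\<gamma> x) * (\<Sum>j\<in>Basis. dir_deriv (dir_deriv \<gamma> j) j x)) + Q x * (trunc'' e (\<gamma> x) * g2 x)
        - (\<Sum>j\<in>Basis. trunc' e (\<gamma> x) * dir_deriv \<gamma> j x * dP j x)"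
      by (simp add: g2_def sum.distrib sum_subtractf sum_negf sum_distrib_left power2_eq_square distrib_left ac_simps)
    then show "(Q x * (trunc'' e (\<gamma> x) * g2 x) - Q x * trunc' e (\<gamma> x)) - (\<Sum>j\<in>Basis. trunc' e (\<gamma> x) * dir_deriv \<gamma> j x * dP j x)
      = (\<Sum>j\<in>Basis. Q x * (trunc' e (\<gamma> x) * dir_deriv (dir_deriv \<gamma> j) j x + trunc'' e (\<gamma> x) * dir_deriv \<gamma> j x * dir_deriv \<gamma> j x)
        + (0 - dP j x) * (trunc' e (\<gamma> x) * dir_deriv \<gamma> j x))"
      using gamma_laplacian[OF x] by simp
  qed
  moreover note integral_diff[OF C0bar_integrable[OF opn bdd C0bar_diff[OF C0bar_mult[OF Q_C0 cc1] C0bar_mult[OF Q_C0 cc2]]] C0bar_integrable[OF opn bdd cc3]]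
    integral_diff[OF C0bar_integrable[OF opn bdd C0bar_mult[OF Q_C0 cc1]] C0bar_integrable[OF opn bdd C0bar_mult[OF Q_C0 cc2]]]
  ultimately show ?thesis using 1 by simp
qed

end

context overdetermined begin

lemma kappa_nonneg: "0 \<le> \<kappa>" using n_ge_2 by (simp add: \<kappa>_def)

text \<open>As e tends to 0, the truncation tends to \<gamma> and \<open>trunc'\<close> to 1, so the
  point is that the term with \<open>trunc''\<close> disappears. It is controlled by |Q| \<le>
  \<eta> + C \<gamma> and two cases of \<open>integral_energy\<close>: the weight
  \<open>trunc''\<close> has energy equal to the integral of \<open>trunc'\<close>, at most
  |\<Omega>|, and the weight t \<open>trunc''\<close> has energy equal to the integral of t
  \<open>trunc'\<close> - \<open>trunc\<close>, at most 3 e |\<Omega>|.\<close>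

lemma torsion_identity:
  assumes t: "torsion_function \<Omega> \<gamma>"
  shows "integral \<Omega> (\<lambda>x. \<gamma> x * E x) = integral \<Omega> Q"
proof -
  interpret torsion \<Omega> \<gamma> using opn bdd ne t by unfold_locales
  define M where "M = measure lebesgue \<Omega>"
  have M0: "0 \<le> M" by (simp add: M_def)
  have I1: "integral \<Omega> (\<lambda>x. k) = k * M" for k unfolding M_def by (rule integral_const_open[OF opn bdd])
  define e where "e m = inverse (real (Suc m))" for m
  have e: "e m > 0" for m by (simp add: e_def)
  have el: "e \<longlonglongrightarrow> 0" unfolding e_def by (rule LIMSEQ_inverse_real_of_nat)
  have tC0: "C0bar \<Omega> (\<lambda>x. trunc (e m) (\<gamma> x))" "C0bar \<Omega> (\<lambda>x. trunc' (e m) (\<gamma> x))" for m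
    using C0bar_compose[OF e trunc_continuous(1)[OF e] trunc_zero(1)[OF e]]
      C0bar_compose[OF e trunc_continuous(2)[OF e] trunc_zero(2)[OF e]] by blast+
  note int = C0bar_integrable[OF opn bdd]
  have g0: "0 \<le> \<gamma> x" if "x \<in> \<Omega>" for x using gamma_pos[OF that] by simp
  obtain ME where ME: "0 < ME" "\<And>x. x \<in> \<Omega> \<Longrightarrow> \<bar>E x\<bar> \<le> ME" using C0bar_bounded[OF bdd E_C0] by blast
  have L1: "(\<lambda>m. integral \<Omega> (\<lambda>x. trunc (e m) (\<gamma> x) * E x)) \<longlonglongrightarrow> integral \<Omega> (\<lambda>x. \<gamma> x * E x)"
  proof -
    have b: "norm (integral \<Omega> (\<lambda>x. trunc (e m) (\<gamma> x) * E x) - integral \<Omega> (\<lambda>x. \<gamma> x * E x)) \<le> 3 * e m * ME * M" for m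
    proof -
      have "integral \<Omega> (\<lambda>x. trunc (e m) (\<gamma> x) * E x) - integral \<Omega> (\<lambda>x. \<gamma> x * E x)
        = integral \<Omega> (\<lambda>x. trunc (e m) (\<gamma> x) * E x - \<gamma> x * E x)"
        by (rule integral_diff[symmetric]) (intro int C0bar_mult tC0 gamma_C0 E_C0)+
      also have "norm \<dots> \<le> integral \<Omega> (\<lambda>x. 3 * e m * ME)"
      proof (rule integral_norm_bound_integral)
        fix x assume x: "x \<in> \<Omega>"
        have "\<bar>trunc (e m) (\<gamma> x) - \<gamma> x\<bar> \<le> 3 * e m"
          using trunc_bounds(2,3)[OF e g0[OF x], of m] e[of m] by simp
        then have "\<bar>trunc (e m) (\<gamma> x) - \<gamma> x\<bar> * \<bar>E x\<bar> \<le> 3 * e m * ME"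
          using ME(2)[OF x] e[of m] by (intro mult_mono) auto
        then show "norm (trunc (e m) (\<gamma> x) * E x - \<gamma> x * E x) \<le> 3 * e m * ME"
          by (simp add: left_diff_distrib[symmetric] abs_mult)
      qed (intro int C0bar_diff C0bar_mult tC0 gamma_C0 E_C0 C0bar_const)+
      finally show ?thesis unfolding I1 .
    qed
    have "(\<lambda>m. 3 * e m * ME * M) \<longlonglongrightarrow> 3 * 0 * ME * M" by (intro tendsto_intros el)
    then have "(\<lambda>m. integral \<Omega> (\<lambda>x. trunc (e m) (\<gamma> x) * E x) - integral \<Omega> (\<lambda>x. \<gamma> x * E x)) \<longlonglongrightarrow> 0"
      by (intro Lim_null_comparison[OF always_eventually[OF allI[OF b]]]) simp
    then show ?thesis by (simp add: LIM_zero_iff)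
  qed
  have L2: "(\<lambda>m. integral \<Omega> (\<lambda>x. Q x * trunc' (e m) (\<gamma> x))) \<longlonglongrightarrow> integral \<Omega> Q"
  proof (rule dominated_convergence(2)[where h = "\<lambda>x. \<bar>Q x\<bar>"])
    show "(\<lambda>x. Q x * trunc' (e m) (\<gamma> x)) integrable_on \<Omega>" for m by (intro int C0bar_mult Q_C0 tC0)
    show "(\<lambda>x. \<bar>Q x\<bar>) integrable_on \<Omega>" by (intro int C0bar_abs Q_C0)
    show "norm (Q x * trunc' (e m) (\<gamma> x)) \<le> \<bar>Q x\<bar>" if "x \<in> \<Omega>" for m x
      using trunc_bounds(4,5)[OF e g0[OF that], of m] by (simp add: abs_mult mult_left_le)
    show "(\<lambda>m. Q x * trunc' (e m) (\<gamma> x)) \<longlonglongrightarrow> Q x" if x: "x \<in> \<Omega>" for x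
    proof -
      have "(\<lambda>m. Q x * trunc' (e m) (\<gamma> x)) \<longlonglongrightarrow> Q x * ((1 - 0 / max 0 (\<gamma> x))\<^sup>2 * (1 + 2 * (0 / max 0 (\<gamma> x))))"
        unfolding trunc'_def using gamma_pos[OF x] by (intro tendsto_intros el) auto
      then show ?thesis by simp
    qed
  qed
  have L3: "(\<lambda>m. integral \<Omega> (\<lambda>x. Q x * (trunc'' (e m) (\<gamma> x) * g2 x))) \<longlonglongrightarrow> 0"
  proof (rule LIMSEQ_I)
    fix r :: real assume r: "0 < r"
    \<comment> \<open>M + 1 is positive without a lower bound for the measure, so \<eta> can be
      chosen with \<eta> k = r / 2.\<close>
    define k where "k = M + 1"
    have k: "k > 0" using M0 by (simp add: k_def)
    define \<eta> where "\<eta> = r / (2 * k)"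
    have eta0: "\<eta> > 0" "\<eta> * k = r / 2" using r k by (simp_all add: \<eta>_def)
    have eta: "\<eta> > 0" "\<eta> * M < r / 2 + r / 4" using r eta0 by (simp_all add: k_def distrib_left)
    obtain C where C: "0 \<le> C" "\<And>x. x \<in> \<Omega> \<Longrightarrow> \<bar>Q x\<bar> \<le> \<eta> + C * \<gamma> x"
      using bound_by_positive[OF opn bdd Q_C0 Q_zero_bdry gamma_continuous(1) gamma_pos eta(1)] by blast
    have bd: "norm (integral \<Omega> (\<lambda>x. Q x * (trunc'' (e m) (\<gamma> x) * g2 x))) \<le> \<eta> * M + C * (3 * e m * M)" for m
    proof -
      let ?t = "\<lambda>x. trunc'' (e m) (\<gamma> x) * g2 x"
      have g2n: "0 \<le> g2 x" for x by (simp add: g2_def sum_nonneg)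
      have tz: "trunc'' (e m) t = 0" if "t \<le> e m" for t by (rule trunc_zero(3)[OF e that])
      have tC: "C0bar \<Omega> ?t" by (rule C0bar_g2[OF e trunc''_continuous[OF e] tz])
      have "norm (integral \<Omega> (\<lambda>x. Q x * ?t x)) \<le> integral \<Omega> (\<lambda>x. \<eta> * ?t x + C * (\<gamma> x * ?t x))"
      proof (rule integral_norm_bound_integral)
        fix x assume x: "x \<in> \<Omega>"
        have "\<bar>Q x\<bar> * ?t x \<le> (\<eta> + C * \<gamma> x) * ?t x"
          using C(2)[OF x] trunc_bounds(6)[OF e g0[OF x]] g2n by (intro mult_right_mono) auto
        then show "norm (Q x * ?t x) \<le> \<eta> * ?t x + C * (\<gamma> x * ?t x)"
          using trunc_bounds(6)[OF e g0[OF x]] g2n by (simp add: abs_mult algebra_simps)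
      qed (intro int C0bar_add C0bar_mult C0bar_const Q_C0 tC gamma_C0)+
      also have "\<dots> = \<eta> * integral \<Omega> ?t + C * integral \<Omega> (\<lambda>x. \<gamma> x * ?t x)"
        by (subst integral_add) (simp_all add: int C0bar_mult tC gamma_C0)
      also have "integral \<Omega> ?t = integral \<Omega> (\<lambda>x. trunc' (e m) (\<gamma> x))"
        by (rule integral_energy[OF e trunc'_deriv[OF e] trunc''_continuous[OF e] trunc_zero(2)[OF e] tz])
      also have "integral \<Omega> (\<lambda>x. \<gamma> x * ?t x) = integral \<Omega> (\<lambda>x. \<gamma> x * trunc' (e m) (\<gamma> x) - trunc (e m) (\<gamma> x))"
      proof -
        have d: "((\<lambda>t. t * trunc' (e m) t - trunc (e m) t) has_real_derivative t * trunc'' (e m) t) (at t)" for t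
          by (rule derivative_eq_intros trunc_deriv[OF e] trunc'_deriv[OF e] | simp)+
        have c: "continuous_on UNIV (\<lambda>t. t * trunc'' (e m) t)"
          by (intro continuous_intros trunc''_continuous[OF e])
        have "integral \<Omega> (\<lambda>x. (\<gamma> x * trunc'' (e m) (\<gamma> x)) * g2 x) = integral \<Omega> (\<lambda>x. \<gamma> x * trunc' (e m) (\<gamma> x) - trunc (e m) (\<gamma> x))"
          by (rule integral_energy[OF e[of m] d c]) (use trunc_zero[OF e] in auto)
        then show ?thesis by (simp add: mult.assoc)
      qed
      also have "\<eta> * integral \<Omega> (\<lambda>x. trunc' (e m) (\<gamma> x)) + C * integral \<Omega> (\<lambda>x. \<gamma> x * trunc' (e m) (\<gamma> x) - trunc (e m) (\<gamma> x))
          \<le> \<eta> * integral \<Omega> (\<lambda>x. 1) + C * integral \<Omega> (\<lambda>x. 3 * e m)"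
        using eta C(1) trunc_bounds(5,7)[OF e g0]
        by (intro add_mono mult_left_mono integral_le int C0bar_diff C0bar_mult C0bar_const tC0 gamma_C0) auto
      finally show ?thesis unfolding I1 by simp
    qed
    have "(\<lambda>m. C * (3 * e m * M)) \<longlonglongrightarrow> C * (3 * 0 * M)" by (intro tendsto_intros el)
    then have "\<forall>\<^sub>F m in sequentially. C * (3 * e m * M) < r / 4"
      using r by (intro order_tendstoD(2)) auto
    then obtain m0 where m0: "\<And>m. m \<ge> m0 \<Longrightarrow> C * (3 * e m * M) < r / 4" by (auto simp: eventually_sequentially)
    show "\<exists>no. \<forall>m\<ge>no. norm (integral \<Omega> (\<lambda>x. Q x * (trunc'' (e m) (\<gamma> x) * g2 x)) - 0) < r"
    proof (intro exI allI impI)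
      fix m assume "m0 \<le> m"
      then show "norm (integral \<Omega> (\<lambda>x. Q x * (trunc'' (e m) (\<gamma> x) * g2 x)) - 0) < r"
        using bd[of m] m0[of m] eta(2) by simp
    qed
  qed
  have "(\<lambda>m. integral \<Omega> (\<lambda>x. trunc (e m) (\<gamma> x) * E x)) \<longlonglongrightarrow> integral \<Omega> Q - 0"
    unfolding test_torsion[OF t e] by (intro tendsto_diff L2 L3)
  then show ?thesis using LIMSEQ_unique[OF L1] by simp
qed

text \<open>The quantity is 2 |H|^2. Weighted with \<gamma> > 0, its integral is that of Q plus
  \<kappa> times that of w^2 \<gamma>, which the assumed bound makes \<le> 0.\<close>

lemma E_zero_torsion:
  assumes t: "torsion_function \<Omega> \<gamma>"
    and le: "integral \<Omega> (\<lambda>x. (laplacian (laplacian u) x)\<^sup>2 * \<gamma> x) \<le> 2 * (n + 2) * c\<^sup>2 * measure lebesgue \<Omega> / (n + 6)"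
    and x: "x \<in> \<Omega>"
  shows "E x + \<kappa> * (W [] x)\<^sup>2 = 0"
proof -
  interpret torsion \<Omega> \<gamma> using opn bdd ne t by unfold_locales
  have W: "C0bar \<Omega> (\<lambda>x. (W [] x)\<^sup>2)" by (intro C0bar_power W_C0) simp
  have "integral \<Omega> (\<lambda>x. \<gamma> x * (E x + \<kappa> * (W [] x)\<^sup>2)) = integral \<Omega> (\<lambda>x. \<gamma> x * E x + \<kappa> * ((W [] x)\<^sup>2 * \<gamma> x))"
    by (rule integral_cong) (simp add: algebra_simps)
  also have "\<dots> = integral \<Omega> Q + \<kappa> * integral \<Omega> (\<lambda>x. (W [] x)\<^sup>2 * \<gamma> x)"
    by (subst integral_add) (simp_all add: C0bar_integrable[OF opn bdd] C0bar_mult gamma_C0 E_C0 W torsion_identity[OF t])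
  also have "integral \<Omega> (\<lambda>x. (W [] x)\<^sup>2 * \<gamma> x) = integral \<Omega> (\<lambda>x. (laplacian (laplacian u) x)\<^sup>2 * \<gamma> x)"
    by (rule integral_cong) (simp add: laplacian_laplacian_u)
  also have "integral \<Omega> Q + \<kappa> * integral \<Omega> (\<lambda>x. (laplacian (laplacian u) x)\<^sup>2 * \<gamma> x) \<le> 0"
    using mult_left_mono[OF le kappa_nonneg] unfolding integral_Q by simp
  finally have i: "integral \<Omega> (\<lambda>x. \<gamma> x * (E x + \<kappa> * (W [] x)\<^sup>2)) \<le> 0" .
  have "\<gamma> x * (E x + \<kappa> * (W [] x)\<^sup>2) = 0"
  proof (rule integral_nonneg_zero_imp[OF opn bdd _ _ i x])
    show "C0bar \<Omega> (\<lambda>x. \<gamma> x * (E x + \<kappa> * (W [] x)\<^sup>2))" by (intro C0bar_mult C0bar_add gamma_C0 E_C0 W C0bar_const)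
    show "0 \<le> \<gamma> x * (E x + \<kappa> * (W [] x)\<^sup>2)" if "x \<in> \<Omega>" for x
      using gamma_pos[OF that] E_nonneg[of x] by simp
  qed
  then show ?thesis using gamma_pos[OF x] by simp
qed

end

section \<open>Rigidity: consequences of H = 0\<close>

locale rigid = overdetermined +
  assumes H0: "\<And>x a b i d. x \<in> \<Omega> \<Longrightarrow> a \<in> Basis \<Longrightarrow> b \<in> Basis \<Longrightarrow> i \<in> Basis \<Longrightarrow> d \<in> Basis \<Longrightarrow> H a b i d x = 0"
begin

lemma dir_deriv_eq_of_eq:
  assumes "grad_bar \<Omega> f f'" "grad_bar \<Omega> g g'" "\<And>x. x \<in> \<Omega> \<Longrightarrow> f x = g x" "x \<in> \<Omega>" "i \<in> Basis"
  shows "f' i x = g' i x"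
  using dir_deriv_cong[OF opn assms(4,3)] grad_barD(2)[OF assms(1,4,5)] grad_barD(2)[OF assms(2,4,5)] by simp

lemma sum_delta: "a \<in> Basis \<Longrightarrow> (\<Sum>b\<in>Basis. delta a b * f b) = f a" "a \<in> Basis \<Longrightarrow> (\<Sum>b\<in>Basis. delta b a * f b) = f a"
  "a \<in> Basis \<Longrightarrow> (\<Sum>b\<in>Basis. f b * delta a b) = f a"
  using sum_delta_collapse[OF finite_Basis, of a f] by (simp_all add: mult.commute)

text \<open>Differentiating H = 0 expresses D^5 u by D^3 v and \<nabla>w. Contracting the new index
  with the last one turns the left side into D^3 v again and gives X = \<alpha> (S3 + 3 X) -
  \<delta> S3 for each entry X of D^3 v, solvable because 1 - 3 \<alpha> = (n + 1) / (n +
  4).\<close>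

lemma V3_eq:
  assumes x: "x \<in> \<Omega>" and ijk: "i \<in> Basis" "j \<in> Basis" "k \<in> Basis"
  shows "V [i, j, k] x = 1 / (n + 2) * (delta i j * W [k] x + delta i k * W [j] x + delta j k * W [i] x)"
proof -
  define \<alpha> where "\<alpha> = 1 / (n + 4)"
  define \<delta> where "\<delta> = 1 / ((n + 2) * (n + 4))"
  have T5: "T [m, i, j, k, l] x = \<alpha> * sym6 (\<lambda>p q. V [m, p, q] x) i j k l - \<delta> * sym3 i j k l * W [m] x"
    if "l \<in> Basis" "m \<in> Basis" for l m
  proof (rule dir_deriv_eq_of_eq[OF _ _ _ x that(2)])
    show "grad_bar \<Omega> (T [i, j, k, l]) (\<lambda>m. T [m, i, j, k, l])" by (rule T_grad) simp
    show "grad_bar \<Omega> (\<lambda>x. \<alpha> * sym6 (\<lambda>p q. V [p, q] x) i j k l - \<delta> * sym3 i j k l * W [] x)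
      (\<lambda>m x. \<alpha> * sym6 (\<lambda>p q. V [m, p, q] x) i j k l - \<delta> * sym3 i j k l * W [m] x)"
      unfolding sym6_def by (intro grad_bar_diff grad_bar_cmult grad_bar_add V_grad W_grad) simp_all
    show "T [i, j, k, l] y = \<alpha> * sym6 (\<lambda>p q. V [p, q] y) i j k l - \<delta> * sym3 i j k l * W [] y" if "y \<in> \<Omega>" for y
      using H0[OF that ijk \<open>l \<in> Basis\<close>] by (simp add: H_def \<alpha>_def \<delta>_def mult.commute)
  qed
  define S3 where "S3 = delta i j * W [k] x + delta i k * W [j] x + delta j k * W [i] x"
  have perm: "V [j, i, k] x = V [i, j, k] x" "V [k, i, j] x = V [i, j, k] x"
    by (rule fun_cong[OF V_perm]; simp)+
  have tr: "(\<Sum>l\<in>Basis. V [l, p, l] x) = W [p] x" for p by (rule V_trace) auto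
  have 6: "(\<Sum>l\<in>Basis. sym6 (\<lambda>p q. V [l, p, q] x) i j k l) = S3 + 3 * V [i, j, k] x"
    by (simp add: sym6_def sum.distrib sum_delta ijk perm tr S3_def flip: sum_distrib_left)
  have 3: "(\<Sum>l\<in>Basis. sym3 i j k l * W [l] x) = S3"
  proof -
    have "(\<Sum>l\<in>Basis. sym3 i j k l * W [l] x) = (\<Sum>l\<in>Basis. delta i j * (delta k l * W [l] x) + delta i k * (delta j l * W [l] x) + delta j k * (delta i l * W [l] x))"
      by (simp add: sym3_def algebra_simps)
    then show ?thesis by (simp add: S3_def sum.distrib sum_delta ijk flip: sum_distrib_left)
  qed
  have "V [i, j, k] x = (\<Sum>l\<in>Basis. T [l, i, j, k, l] x)" by (rule T_trace[symmetric]) auto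
  also have "\<dots> = (\<Sum>l\<in>Basis. \<alpha> * sym6 (\<lambda>p q. V [l, p, q] x) i j k l - \<delta> * (sym3 i j k l * W [l] x))"
    by (intro sum.cong refl) (simp add: T5)
  also have "\<dots> = \<alpha> * (S3 + 3 * V [i, j, k] x) - \<delta> * S3"
    by (simp only: sum_subtractf sum_distrib_left[symmetric] 6 3)
  finally have eq: "V [i, j, k] x = \<alpha> * (S3 + 3 * V [i, j, k] x) - \<delta> * S3" .
  have nz: "n + 4 \<noteq> 0" "n + 2 \<noteq> 0" "n + 1 \<noteq> 0" using n_ge_2 by auto
  have "V [i, j, k] x * (1 - 3 * \<alpha>) = (\<alpha> - \<delta>) * S3" using eq by (simp add: algebra_simps)
  moreover have "1 - 3 * \<alpha> = (n + 1) / (n + 4)" using nz by (simp add: \<alpha>_def field_simps)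
  moreover have "\<alpha> - \<delta> = (n + 1) / (n + 4) * (1 / (n + 2))" using nz by (simp add: \<alpha>_def \<delta>_def divide_simps)
  ultimately have "(n + 1) / (n + 4) * V [i, j, k] x = (n + 1) / (n + 4) * (1 / (n + 2) * S3)" by (simp only: ac_simps)
  then show ?thesis using nz unfolding S3_def by (metis divide_eq_0_iff mult_left_cancel)
qed

text \<open>Differentiating \<open>V3_eq\<close> and contracting the new index with the last one
  gives (n + 2) D^2 w = - I + 2 D^2 w, where - I comes from the trace of D^2 w being -1.\<close>

lemma W2_eq:
  assumes x: "x \<in> \<Omega>" and ij: "i \<in> Basis" "j \<in> Basis"
  shows "W [i, j] x = - delta i j / n"
proof -
  have V4: "V [m, i, j, k] x = 1 / (n + 2) * (delta i j * W [m, k] x + delta i k * W [m, j] x + delta j k * W [m, i] x)"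
    if "k \<in> Basis" "m \<in> Basis" for k m
    by (rule dir_deriv_eq_of_eq[OF V_grad _ V3_eq[OF _ ij that(1)] x that(2)], simp)
      (intro grad_bar_cmult grad_bar_add W_grad; simp)
  have "W [i, j] x = (\<Sum>k\<in>Basis. V [k, i, j, k] x)" by (rule V_trace[symmetric]) auto
  also have "\<dots> = (\<Sum>k\<in>Basis. 1 / (n + 2) * (delta i j * W [k, k] x + delta i k * W [k, j] x + delta j k * W [k, i] x))"
    by (intro sum.cong refl V4)
  also have "\<dots> = 1 / (n + 2) * (- delta i j + W [i, j] x + W [j, i] x)"
    using W_trace[OF x] by (simp add: sum.distrib sum_delta ij flip: sum_distrib_left sum_divide_distrib)
  also have "W [j, i] x = W [i, j] x" by (rule fun_cong[OF W_perm]) auto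
  finally have "(n + 2) * W [i, j] x = - delta i j + 2 * W [i, j] x" using n_ge_2 by (simp add: field_simps)
  then have "n * W [i, j] x = - delta i j" by (simp add: algebra_simps)
  then show ?thesis using n_ge_2 by (simp add: field_simps)
qed

lemma delta_inner: "i \<in> Basis \<Longrightarrow> j \<in> Basis \<Longrightarrow> i \<bullet> j = delta i j"
  by (simp add: inner_Basis delta_def)

lemma center_exists: "\<exists>x0. \<forall>x\<in>\<Omega>. \<forall>j\<in>Basis. W [j] x = - ((x \<bullet> j) - (x0 \<bullet> j)) / n"
proof -
  have n0: "n \<noteq> 0" using n_ge_2 by auto
  obtain z where z: "z \<in> \<Omega>" using ne by blast
  \<comment> \<open>Chosen so that \<nabla>w = - (z - x0) / n at z; since \<nabla>w + x / n is
    constant by \<open>W2_eq\<close>, the relation spreads to all of \<Omega>.\<close>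
  define x0 where "x0 = z + (\<Sum>j\<in>Basis. (n * W [j] z) *\<^sub>R j)"
  have "W [j] x = - ((x \<bullet> j) - (x0 \<bullet> j)) / n" if x: "x \<in> \<Omega>" and j: "j \<in> Basis" for x j
  proof -
    have g: "grad_bar \<Omega> (\<lambda>x. W [j] x + 1 / n * (x \<bullet> j)) (\<lambda>i x. W [i, j] x + 1 / n * (i \<bullet> j))"
      by (intro grad_bar_add grad_bar_cmult grad_bar_inner W_grad) simp
    have "W [j] x + 1 / n * (x \<bullet> j) = W [j] z + 1 / n * (z \<bullet> j)"
    proof (rule constant_of_zero_gradient[OF opn conn C1barD(2)[OF grad_barD(1)[OF g]] _ x z])
      show "dir_deriv (\<lambda>x. W [j] x + 1 / n * (x \<bullet> j)) i y = 0" if "y \<in> \<Omega>" "i \<in> Basis" for y i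
        using grad_barD(2)[OF g that] W2_eq[OF that j] by (simp add: delta_inner that j)
    qed
    moreover have "x0 \<bullet> j = z \<bullet> j + n * W [j] z"
      using j by (simp add: x0_def inner_add_left inner_sum_left sum_Basis_inner_delta)
    ultimately show ?thesis using n0 by (simp add: field_simps)
  qed
  then show ?thesis by blast
qed

end

text \<open>In dimension \<ge> 2 the exterior of the closed ball is connected and misses the
  frontier, so it is contained in S or disjoint from it, and boundedness leaves the latter. The same
  dichotomy for the open ball, which meets S, shows that S fills it.\<close>

lemma bounded_open_frontier_in_sphere:
  fixes S :: "'a::euclidean_space set"
  assumes d: "2 \<le> DIM('a)" and S: "open S" "bounded S" "S \<noteq> {}" and f: "frontier S \<subseteq> sphere a r" and r: "0 < r"
  shows "S = ball a r"
proof -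
  have "connected (- cball a r)"
    by (rule connected_complement_bounded_convex[OF bounded_cball convex_cball d])
  moreover have "(- cball a r) \<inter> frontier S = {}" using f by auto
  ultimately have "(- cball a r) \<inter> S = {} \<or> - cball a r - S = {}"
    using connected_Int_frontier[of "- cball a r" S] by blast
  moreover have "\<not> - cball a r - S = {}"
  proof
    assume "- cball a r - S = {}"
    then have "UNIV \<subseteq> S \<union> cball a r" by auto
    then have "bounded (UNIV :: 'a set)" using S(2) by (meson bounded_Un bounded_cball bounded_subset)
    then show False using not_bounded_UNIV by blast
  qed
  ultimately have sub: "S \<subseteq> cball a r" by auto
  then have sb: "S \<subseteq> ball a r" using interior_maximal[OF sub S(1)] by simp
  have "ball a r \<inter> frontier S = {}" using f by auto
  moreover have "ball a r \<inter> S \<noteq> {}" using sb S(3) by auto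
  ultimately have "ball a r - S = {}" using connected_Int_frontier[OF connected_ball, of a r S] by blast
  then show ?thesis using sb by auto
qed

context overdetermined begin

text \<open>For c = 0 the Pohozaev identity makes the integral of u zero, which equals that of
  |\<nabla>v|^2. Then \<nabla>v and all further derivatives vanish, against \<Delta>w = -1.\<close>

lemma c_nonzero: "c \<noteq> 0"
proof
  assume c: "c = 0"
  have "integral \<Omega> GV = 0" using pohozaev integral_energies(5) n_ge_2 c by simp
  then have GV: "GV x = 0" if "x \<in> \<Omega>" for x
    by (intro integral_nonneg_zero_imp[OF opn bdd energy_C0(4) _ _ that]) (simp_all add: GV_def sum_nonneg)
  have V1: "V [j] x = 0" if x: "x \<in> \<Omega>" and j: "j \<in> Basis" for x j
  proof -
    have "(V [j] x)\<^sup>2 = 0" using GV[OF x] j unfolding GV_def by (subst (asm) sum_nonneg_eq_0_iff) auto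
    then show ?thesis by simp
  qed
  have V2: "V [i, j] x = 0" if x: "x \<in> \<Omega>" and ij: "i \<in> Basis" "j \<in> Basis" for x i j
    using dir_deriv_cong[OF opn x, of "V [j]" "\<lambda>x. 0" i] V1[OF _ ij(2)] grad_barD(2)[OF V_grad x ij(1), of "[j]"] by simp
  have W0: "W [] x = 0" if "x \<in> \<Omega>" for x using V2[OF that] by (simp add: W_def)
  have W1: "W [j] x = 0" if x: "x \<in> \<Omega>" and j: "j \<in> Basis" for x j
    using dir_deriv_cong[OF opn x, of "W []" "\<lambda>x. 0" j] W0 grad_barD(2)[OF W_grad x j, of "[]"] by simp
  have W2: "W [j, j] x = 0" if x: "x \<in> \<Omega>" and j: "j \<in> Basis" for x j
    using dir_deriv_cong[OF opn x, of "W [j]" "\<lambda>x. 0" j] W1[OF _ j] grad_barD(2)[OF W_grad x j, of "[j]"] by simp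
  obtain x where "x \<in> \<Omega>" using ne by blast
  then show False using W_trace[of x] W2 by simp
qed

end

section \<open>The radial form of v and the boundary sphere\<close>

locale centered = rigid +
  fixes x0 :: 'a
  assumes W1: "\<And>x j. x \<in> \<Omega> \<Longrightarrow> j \<in> Basis \<Longrightarrow> W [j] x = - ((x \<bullet> j) - (x0 \<bullet> j)) / n"
begin

lemma n_pos: "0 < n" "n \<noteq> 0" "n + 2 \<noteq> 0" "n + 4 \<noteq> 0" "n - 1 \<noteq> 0" using n_ge_2 by auto

definition y :: "'a \<Rightarrow> 'a \<Rightarrow> real" where "y j x = (x \<bullet> j) - (x0 \<bullet> j)"

text \<open>Given as a polynomial in the coordinates and not through \<open>dist\<close>, so that
  the gradient rules apply; \<open>s_dist\<close> is the link.\<close>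

definition s :: "'a \<Rightarrow> real" where "s x = (\<Sum>i\<in>Basis. (y i x)\<^sup>2)"

lemma s_dist: "s x = (dist x x0)\<^sup>2"
  by (simp add: s_def y_def sum_squares_dist dist_commute)

lemma y_grad: "j \<in> Basis \<Longrightarrow> grad_bar \<Omega> (y j) (\<lambda>i x. delta i j)"
proof -
  assume j: "j \<in> Basis"
  have "grad_bar \<Omega> (y j) (\<lambda>i x. i \<bullet> j - 0)" unfolding y_def[abs_def] by (intro grad_intros)
  then show ?thesis by (auto simp: grad_bar_def delta_inner j)
qed

lemma s_grad: "grad_bar \<Omega> s (\<lambda>i x. 2 * y i x)"
proof -
  have "grad_bar \<Omega> s (\<lambda>i x. \<Sum>k\<in>Basis. 2 * (y k x * delta i k))"
    unfolding s_def[abs_def] by (intro grad_bar_sum grad_bar_power2 y_grad)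
  then show ?thesis by (auto simp: grad_bar_def sum_delta mult.assoc simp flip: sum_distrib_left)
qed

lemma W1': "x \<in> \<Omega> \<Longrightarrow> j \<in> Basis \<Longrightarrow> W [j] x = - y j x / n"
  using W1 by (simp add: y_def)

lemma W0_eq: "\<exists>C. \<forall>x\<in>\<Omega>. W [] x = C - s x / (2 * n)"
proof -
  obtain z where z: "z \<in> \<Omega>" using ne by blast
  have g: "grad_bar \<Omega> (\<lambda>x. W [] x + 1 / (2 * n) * s x) (\<lambda>i x. W [i] x + 1 / (2 * n) * (2 * y i x))"
    by (intro grad_bar_add grad_bar_cmult s_grad W_grad) simp
  have "W [] x + 1 / (2 * n) * s x = W [] z + 1 / (2 * n) * s z" if x: "x \<in> \<Omega>" for x
  proof (rule constant_of_zero_gradient[OF opn conn C1barD(2)[OF grad_barD(1)[OF g]] _ x z])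
    show "dir_deriv (\<lambda>x. W [] x + 1 / (2 * n) * s x) i w = 0" if "w \<in> \<Omega>" "i \<in> Basis" for w i
      using grad_barD(2)[OF g that] by (simp add: W1' that)
  qed
  then show ?thesis by (intro exI[of _ "W [] z + 1 / (2 * n) * s z"]) (auto simp: algebra_simps)
qed

text \<open>The angular derivative \<open>\<zeta> = x\<^sub>i \<partial>\<^sub>j u - x\<^sub>j \<partial>\<^sub>i u\<close> is biharmonic, because \<open>\<Delta>\<^sup>2 u\<close> is radial, and has
  vanishing Dirichlet data.\<close>

lemma V_radial:
  assumes x: "x \<in> \<Omega>" and ij: "i \<in> Basis" "j \<in> Basis"
  shows "y i x * V [j] x = y j x * V [i] x"
proof -
  define z where "z x = y i x * T [j] x - y j x * T [i] x" for x
  define dz where "dz k x = (y i x * T [k, j] x + delta k i * T [j] x) - (y j x * T [k, i] x + delta k j * T [i] x)" for k x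
  define ddz where "ddz l k x = ((y i x * T [l, k, j] x + delta l i * T [k, j] x) + delta k i * T [l, j] x)
      - ((y j x * T [l, k, i] x + delta l j * T [k, i] x) + delta k j * T [l, i] x)" for l k x
  define L where "L x = y i x * V [j] x - y j x * V [i] x" for x
  define dL where "dL k x = (y i x * V [k, j] x + delta k i * V [j] x) - (y j x * V [k, i] x + delta k j * V [i] x)" for k x
  define ddL where "ddL l k x = ((y i x * V [l, k, j] x + delta l i * V [k, j] x) + delta k i * V [l, j] x)
      - ((y j x * V [l, k, i] x + delta l j * V [k, i] x) + delta k j * V [l, i] x)" for l k x
  note g = grad_bar_diff grad_bar_add grad_bar_cmult grad_bar_mult y_grad[OF ij(1)] y_grad[OF ij(2)] T_grad V_grad
  have gz: "grad_bar \<Omega> z dz" unfolding z_def[abs_def] dz_def[abs_def] by (intro g) simp_all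
  have gdz: "grad_bar \<Omega> (dz k) (\<lambda>l. ddz l k)" for k unfolding dz_def[abs_def] ddz_def[abs_def] by (intro g) simp_all
  have gL: "grad_bar \<Omega> L dL" unfolding L_def[abs_def] dL_def[abs_def] by (intro g) simp_all
  have gdL: "grad_bar \<Omega> (dL k) (\<lambda>l. ddL l k)" for k unfolding dL_def[abs_def] ddL_def[abs_def] by (intro g) simp_all
  have yC: "C0bar \<Omega> (y k)" for k unfolding y_def[abs_def] by (intro C0bar_diff C0bar_inner C0bar_const)
  have zz: "zero_bdry \<Omega> z" unfolding z_def[abs_def]
    by (intro zero_bdry_diff zero_bdry_mult2[OF opn] yC T1_zero_bdry)
  have zdz: "zero_bdry \<Omega> (dz k)" for k unfolding dz_def[abs_def]
    by (intro zero_bdry_diff zero_bdry_add zero_bdry_mult2[OF opn] yC T1_zero_bdry T2_zero_bdry C0bar_const)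
  have perm: "V [p, q] w = V [q, p] w" "T [p, q] w = T [q, p] w" for p q w
    by (rule V_sym2) (rule fun_cong[OF T_perm], simp_all)
  \<comment> \<open>L = \<Delta>z and \<Delta>L = 0, so the Green field L \<nabla>z - z \<nabla>L
    has divergence L^2; it vanishes on the boundary because z and \<nabla>z do.\<close>
  have i: "integral \<Omega> (\<lambda>x. (L x)\<^sup>2) = 0"
  proof (rule divergence_zero_grad[OF opn bdd])
    show "grad_bar \<Omega> (\<lambda>x. L x * dz k x - z x * dL k x)
       (\<lambda>l x. (L x * ddz l k x + dL l x * dz k x) - (z x * ddL l k x + dz l x * dL k x))" for k
      by (intro grad_bar_diff grad_bar_mult gL gdz gz gdL)
    show "zero_bdry \<Omega> (\<lambda>x. L x * dz k x - z x * dL k x)" for k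
      by (intro zero_bdry_diff zero_bdry_mult2[OF opn _ zdz] zero_bdry_mult[OF opn zz] C1barD(1)[OF grad_barD(1)[OF gL]] C1barD(1)[OF grad_barD(1)[OF gdL]])
    fix x assume x: "x \<in> \<Omega>"
    have 1: "(\<Sum>k\<in>Basis. ddz k k x) = L x"
      by (simp add: ddz_def L_def sum.distrib sum_subtractf sum_delta ij T_tr perm flip: sum_distrib_left)
    have 2: "(\<Sum>k\<in>Basis. ddL k k x) = 0"
      by (simp add: ddL_def sum.distrib sum_subtractf sum_delta ij V_tr W1' x perm flip: sum_distrib_left)
    have "(\<Sum>k\<in>Basis. (L x * ddz k k x + dL k x * dz k x) - (z x * ddL k k x + dz k x * dL k x))
        = L x * (\<Sum>k\<in>Basis. ddz k k x) - z x * (\<Sum>k\<in>Basis. ddL k k x)"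
      by (simp add: sum.distrib sum_subtractf sum_distrib_left mult.commute)
    then show "(L x)\<^sup>2 = (\<Sum>k\<in>Basis. (L x * ddz k k x + dL k x * dz k x) - (z x * ddL k k x + dz k x * dL k x))"
      unfolding 1 2 by (simp add: power2_eq_square)
  qed
  have "(L x)\<^sup>2 = 0"
    by (rule integral_nonneg_zero_imp[OF opn bdd C0bar_power[OF C1barD(1)[OF grad_barD(1)[OF gL]]] _ _ x]) (use i in simp_all)
  then show ?thesis by (simp add: L_def)
qed

text \<open>Obtained by differentiating the relation of \<open>V_radial\<close> in direction i and
  summing over i.\<close>

lemma V1_eq0:
  assumes x: "x \<in> \<Omega>" and j: "j \<in> Basis"
  shows "(n - 1) * V [j] x = y j x * W [] x - (\<Sum>i\<in>Basis. y i x * V [i, j] x)"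
proof -
  have d: "y i x * V [i, j] x + delta i i * V [j] x = y j x * V [i, i] x + delta i j * V [i] x" if i: "i \<in> Basis" for i
  proof (rule dir_deriv_eq_of_eq[where f = "\<lambda>x. y i x * V [j] x" and g = "\<lambda>x. y j x * V [i] x"
        and f' = "\<lambda>k x. y i x * V [k, j] x + delta k i * V [j] x" and g' = "\<lambda>k x. y j x * V [k, i] x + delta k j * V [i] x"])
    show "grad_bar \<Omega> (\<lambda>x. y i x * V [j] x) (\<lambda>k x. y i x * V [k, j] x + delta k i * V [j] x)"
      "grad_bar \<Omega> (\<lambda>x. y j x * V [i] x) (\<lambda>k x. y j x * V [k, i] x + delta k j * V [i] x)"
      by (intro grad_bar_mult y_grad V_grad i j; simp)+
  qed (use V_radial i j x in auto)
  have "(\<Sum>i\<in>Basis. y i x * V [i, j] x + delta i i * V [j] x) = (\<Sum>i\<in>Basis. y j x * V [i, i] x + delta i j * V [i] x)"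
    by (intro sum.cong refl d)
  moreover have "(\<Sum>i\<in>(Basis::'a set). delta i i * V [j] x) = n * V [j] x" by (simp add: delta_def n_def)
  ultimately show ?thesis
    by (simp add: sum.distrib sum_delta j V_tr algebra_simps flip: sum_distrib_left)
qed

text \<open>Differentiating \<open>V1_eq0\<close> leaves third derivatives of v, which
  \<open>V3_eq\<close> and \<nabla>w = - y / n turn into polynomials in y; the resulting equation is
  linear in D^2 v.\<close>

lemma V2_eq:
  assumes x: "x \<in> \<Omega>" and jl: "j \<in> Basis" "l \<in> Basis"
  shows "n * V [l, j] x = delta l j * (W [] x + s x / (n * (n + 2))) - y l x * y j x / (n + 2)"
proof -
  have d: "(n - 1) * V [l, j] x = (y j x * W [l] x + delta l j * W [] x) - (\<Sum>i\<in>Basis. y i x * V [l, i, j] x + delta l i * V [i, j] x)"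
  proof (rule dir_deriv_eq_of_eq[where f = "\<lambda>x. (n - 1) * V [j] x" and g = "\<lambda>x. y j x * W [] x - (\<Sum>i\<in>Basis. y i x * V [i, j] x)"
        and f' = "\<lambda>l x. (n - 1) * V [l, j] x"
        and g' = "\<lambda>l x. (y j x * W [l] x + delta l j * W [] x) - (\<Sum>i\<in>Basis. y i x * V [l, i, j] x + delta l i * V [i, j] x)"])
    show "grad_bar \<Omega> (\<lambda>x. (n - 1) * V [j] x) (\<lambda>l x. (n - 1) * V [l, j] x)" by (intro grad_bar_cmult V_grad) simp
    show "grad_bar \<Omega> (\<lambda>x. y j x * W [] x - (\<Sum>i\<in>Basis. y i x * V [i, j] x))
        (\<lambda>l x. (y j x * W [l] x + delta l j * W [] x) - (\<Sum>i\<in>Basis. y i x * V [l, i, j] x + delta l i * V [i, j] x))"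
      by (intro grad_bar_diff grad_bar_sum grad_bar_mult y_grad V_grad W_grad jl) simp_all
  qed (use V1_eq0 jl x in auto)
  have "(\<Sum>i\<in>Basis. y i x * V [l, i, j] x) = (\<Sum>i\<in>Basis. - 1 / (n * (n + 2)) * (delta l i * (y i x * y j x) + delta l j * (y i x)\<^sup>2 + delta i j * (y i x * y l x)))"
  proof (intro sum.cong refl)
    fix i :: 'a assume i: "i \<in> Basis"
    show "y i x * V [l, i, j] x = - 1 / (n * (n + 2)) * (delta l i * (y i x * y j x) + delta l j * (y i x)\<^sup>2 + delta i j * (y i x * y l x))"
      unfolding V3_eq[OF x jl(2) i jl(1)] W1'[OF x i] W1'[OF x jl(1)] W1'[OF x jl(2)]
      using n_pos by (simp add: divide_simps power2_eq_square) (simp add: algebra_simps)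
  qed
  also have "\<dots> = - 1 / (n * (n + 2)) * (2 * (y l x * y j x) + delta l j * s x)"
  proof -
    have "(\<Sum>i\<in>Basis. delta l i * (y i x * y j x)) = y l x * y j x" "(\<Sum>i\<in>Basis. delta i j * (y i x * y l x)) = y l x * y j x"
      using sum_delta(1)[OF jl(2), of "\<lambda>i. y i x * y j x"] sum_delta(2)[OF jl(1), of "\<lambda>i. y i x * y l x"] by (simp_all add: mult.commute)
    then show ?thesis
      unfolding sum_distrib_left[symmetric] sum.distrib s_def by (simp add: algebra_simps)
  qed
  finally have 3: "(\<Sum>i\<in>Basis. y i x * V [l, i, j] x) = - 1 / (n * (n + 2)) * (2 * (y l x * y j x) + delta l j * s x)" .
  have eq: "(n - 1) * V [l, j] x = (y j x * (- y l x / n) + delta l j * W [] x) - (- 1 / (n * (n + 2)) * (2 * (y l x * y j x) + delta l j * s x) + V [l, j] x)"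
    using d unfolding sum.distrib 3 W1'[OF x jl(2)] by (simp add: sum_delta jl)
  have "n * V [l, j] x = (n - 1) * V [l, j] x + V [l, j] x" by (simp add: algebra_simps)
  also have "\<dots> = y j x * (- y l x / n) + delta l j * W [] x + 1 / (n * (n + 2)) * (2 * (y l x * y j x) + delta l j * s x)"
    unfolding eq by simp
  also have "\<dots> = delta l j * (W [] x + s x / (n * (n + 2))) - y l x * y j x / (n + 2)"
    using n_pos by (simp add: divide_simps) (simp add: algebra_simps)
  finally show ?thesis .
qed

text \<open>Inserting \<open>V2_eq\<close> back into \<open>V1_eq0\<close> removes the second
  derivatives, and the factor n - 1 is then cancelled.\<close>

lemma V1_eq:
  assumes x: "x \<in> \<Omega>" and j: "j \<in> Basis"
  shows "V [j] x = y j x * (W [] x / n + s x / (n\<^sup>2 * (n + 2)))"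
proof -
  define A where "A = W [] x + s x / (n * (n + 2))"
  have "n * (\<Sum>i\<in>Basis. y i x * V [i, j] x) = (\<Sum>i\<in>Basis. delta i j * (y i x * A) - y j x / (n + 2) * (y i x)\<^sup>2)"
    unfolding sum_distrib_left
  proof (intro sum.cong refl)
    fix i :: 'a assume i: "i \<in> Basis"
    have "n * (y i x * V [i, j] x) = y i x * (n * V [i, j] x)" by simp
    also have "\<dots> = delta i j * (y i x * A) - y j x / (n + 2) * (y i x)\<^sup>2"
      unfolding V2_eq[OF x j i] A_def by (simp add: algebra_simps power2_eq_square)
    finally show "n * (y i x * V [i, j] x) = delta i j * (y i x * A) - y j x / (n + 2) * (y i x)\<^sup>2" .
  qed
  also have "\<dots> = y j x * A - y j x / (n + 2) * s x"
    unfolding sum_subtractf sum_distrib_left[symmetric] s_def[symmetric] using sum_delta(2)[OF j, of "\<lambda>i. y i x * A"] by simp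
  finally have S: "(\<Sum>i\<in>Basis. y i x * V [i, j] x) = (y j x * A - y j x / (n + 2) * s x) / n"
    using n_pos(2) by (metis nonzero_mult_div_cancel_left)
  have "(n - 1) * V [j] x = (n - 1) * (y j x * (W [] x / n + s x / (n\<^sup>2 * (n + 2))))"
    unfolding V1_eq0[OF x j] S A_def using n_pos by (simp add: divide_simps power2_eq_square) (simp add: algebra_simps)
  then show ?thesis using n_pos by simp
qed


lemma s_tendsto: "(s \<longlongrightarrow> s p) (at p within \<Omega>)"
  unfolding s_dist[abs_def] by (intro tendsto_intros)

text \<open>With w = C - s / (2 n) the factor of y in \<open>V1_eq\<close> becomes affine in s, so v
  has a quadratic primitive in s; f is v minus its nonconstant part.\<close>

lemma V_explicit:
  "\<exists>C d. \<forall>x\<in>\<Omega>. V [] x = d + C / (2 * n) * s x - 1 / (8 * n * (n + 2)) * (s x)\<^sup>2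
     \<and> (\<forall>j\<in>Basis. V [j] x = y j x * (C / n - s x / (2 * n * (n + 2))))"
proof -
  obtain C where C: "\<And>x. x \<in> \<Omega> \<Longrightarrow> W [] x = C - s x / (2 * n)" using W0_eq by blast
  have V1: "V [j] x = y j x * (C / n - s x / (2 * n * (n + 2)))" if "x \<in> \<Omega>" "j \<in> Basis" for x j
  proof -
    have "W [] x / n + s x / (n\<^sup>2 * (n + 2)) = C / n - s x / (2 * n * (n + 2))"
      unfolding C[OF that(1)] using n_pos by (simp add: divide_simps power2_eq_square) (simp add: algebra_simps)
    then show ?thesis using V1_eq[OF that] by simp
  qed
  obtain z where z: "z \<in> \<Omega>" using ne by blast
  define f where "f x = V [] x - C / (2 * n) * s x + 1 / (8 * n * (n + 2)) * (s x)\<^sup>2" for x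
  have g: "grad_bar \<Omega> f (\<lambda>i x. V [i] x - C / (2 * n) * (2 * y i x) + 1 / (8 * n * (n + 2)) * (2 * (s x * (2 * y i x))))"
    unfolding f_def[abs_def] by (intro grad_bar_add grad_bar_diff grad_bar_cmult grad_bar_power2 s_grad V_grad) simp
  have "f x = f z" if x: "x \<in> \<Omega>" for x
  proof (rule constant_of_zero_gradient[OF opn conn C1barD(2)[OF grad_barD(1)[OF g]] _ x z])
    show "dir_deriv f i w = 0" if "w \<in> \<Omega>" "i \<in> Basis" for w i
      unfolding grad_barD(2)[OF g that] V1[OF that] using n_pos by (simp add: divide_simps) (simp add: algebra_simps)
  qed
  moreover have "V [] x = f x + C / (2 * n) * s x - 1 / (8 * n * (n + 2)) * (s x)\<^sup>2" for x
    by (simp add: f_def)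
  ultimately have "V [] x = f z + C / (2 * n) * s x - 1 / (8 * n * (n + 2)) * (s x)\<^sup>2" if "x \<in> \<Omega>" for x
    using that by metis
  then show ?thesis using V1 by blast
qed

lemma GV_eq:
  assumes "x \<in> \<Omega>" "\<And>j. j \<in> Basis \<Longrightarrow> V [j] x = y j x * k"
  shows "GV x = s x * k\<^sup>2"
  unfolding GV_def s_def sum_distrib_right using assms by (intro sum.cong refl) (simp add: power_mult_distrib)

text \<open>Write v = p(s) with p quadratic, so \<nabla>v = k(s) y with k = 2 p'. On the boundary
  p(s) = 0 and s k(s)^2 = c^2. At two distinct roots the derivative of a quadratic takes opposite
  values, so k^2 agrees there, and then c \<noteq> 0 forces the two values of s to agree after
  all.\<close>

lemma frontier_sphere: "\<exists>R>0. frontier \<Omega> \<subseteq> sphere x0 R"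
proof -
  obtain C d where Cd: "\<And>x. x \<in> \<Omega> \<Longrightarrow> V [] x = d + C / (2 * n) * s x - 1 / (8 * n * (n + 2)) * (s x)\<^sup>2"
    "\<And>x j. x \<in> \<Omega> \<Longrightarrow> j \<in> Basis \<Longrightarrow> V [j] x = y j x * (C / n - s x / (2 * n * (n + 2)))"
    using V_explicit by blast
  define k where "k t = C / n - t / (2 * n * (n + 2))" for t
  have bd: "d + C / (2 * n) * s p - 1 / (8 * n * (n + 2)) * (s p)\<^sup>2 = 0" "s p * (k (s p))\<^sup>2 = c\<^sup>2" if p: "p \<in> frontier \<Omega>" for p
  proof -
    note nt = frontier_within_nontrivial[OF opn p]
    have "((\<lambda>x. d + C / (2 * n) * s x - 1 / (8 * n * (n + 2)) * (s x)\<^sup>2) \<longlongrightarrow> d + C / (2 * n) * s p - 1 / (8 * n * (n + 2)) * (s p)\<^sup>2) (at p within \<Omega>)"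
      by (intro tendsto_intros s_tendsto)
    moreover have "((\<lambda>x. d + C / (2 * n) * s x - 1 / (8 * n * (n + 2)) * (s x)\<^sup>2) \<longlongrightarrow> 0) (at p within \<Omega>)"
      using V0_zero_bdry p unfolding zero_bdry_def by (subst tendsto_cong_within[OF Cd(1)[symmetric]]) auto
    ultimately show "d + C / (2 * n) * s p - 1 / (8 * n * (n + 2)) * (s p)\<^sup>2 = 0" by (rule tendsto_unique[OF nt])
    have "((\<lambda>x. s x * (k (s x))\<^sup>2) \<longlongrightarrow> s p * (k (s p))\<^sup>2) (at p within \<Omega>)"
      unfolding k_def using n_pos by (intro tendsto_intros s_tendsto) simp_all
    moreover have "((\<lambda>x. s x * (k (s x))\<^sup>2) \<longlongrightarrow> c\<^sup>2) (at p within \<Omega>)"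
    proof (subst tendsto_cong_within[of \<Omega> _ GV])
      show "s x * (k (s x))\<^sup>2 = GV x" if "x \<in> \<Omega>" for x
        unfolding k_def using GV_eq[OF that Cd(2)[OF that]] by simp
    qed (rule GV_bdry[OF p])
    ultimately show "s p * (k (s p))\<^sup>2 = c\<^sup>2" by (rule tendsto_unique[OF nt])
  qed
  have eq: "s p = s q" if p: "p \<in> frontier \<Omega>" and q: "q \<in> frontier \<Omega>" for p q
  proof (rule ccontr)
    assume ne: "s p \<noteq> s q"
    define a where "a = 1 / (8 * n * (n + 2))"
    have a: "k t = 2 * (C / (2 * n)) - 4 * a * t" for t by (simp add: k_def a_def)
    define m where "m = C / (2 * n)"
    have "(s p - s q) * (m - a * (s p + s q)) = 0"
      using bd(1)[OF p] bd(1)[OF q] unfolding a_def[symmetric] m_def[symmetric] by (simp add: algebra_simps power2_eq_square)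
    then have b: "C / (2 * n) = a * (s p + s q)" using ne by (simp add: m_def)
    have "k (s p) = - k (s q)" unfolding a b by (simp add: algebra_simps)
    then have "s p * (k (s q))\<^sup>2 = s q * (k (s q))\<^sup>2" using bd(2)[OF p] bd(2)[OF q] by simp
    moreover have "(k (s q))\<^sup>2 \<noteq> 0" using bd(2)[OF q] c_nonzero by auto
    ultimately show False using ne by simp
  qed
  have "frontier \<Omega> \<noteq> {}" using ne bdd frontier_eq_empty not_bounded_UNIV by blast
  then obtain p where p: "p \<in> frontier \<Omega>" by blast
  have "s p \<noteq> 0" using bd(2)[OF p] c_nonzero by auto
  then have "dist p x0 > 0" by (simp add: s_dist)
  moreover have "frontier \<Omega> \<subseteq> sphere x0 (dist p x0)"
  proof
    fix q assume "q \<in> frontier \<Omega>"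
    then have "(dist q x0)\<^sup>2 = (dist p x0)\<^sup>2" using eq[OF _ p] by (simp add: s_dist)
    then have "dist q x0 = dist p x0" by (simp add: power2_eq_iff_nonneg)
    then show "q \<in> sphere x0 (dist p x0)" by (simp add: dist_commute)
  qed
  ultimately show ?thesis by blast
qed

end

section \<open>The solution on the ball and its radius\<close>

locale on_ball = centered +
  fixes R :: real
  assumes R: "0 < R" and ball: "\<Omega> = ball x0 R"
begin

definition N :: real where "N = n * (n + 2) * (n + 4)"

lemma N_pos: "0 < N" using n_ge_2 by (simp add: N_def)

definition \<tau> :: "'a \<Rightarrow> real" where "\<tau> x = R\<^sup>2 - s x"

lemma tau_grad: "grad_bar \<Omega> \<tau> (\<lambda>i x. - 2 * y i x)"
proof -
  have "grad_bar \<Omega> \<tau> (\<lambda>i x. 0 - 2 * y i x)" unfolding \<tau>_def[abs_def] by (intro grad_bar_diff grad_bar_const s_grad)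
  then show ?thesis by simp
qed

lemma tau_bdry: "p \<in> frontier \<Omega> \<Longrightarrow> \<tau> p = 0"
  using R by (simp add: \<tau>_def s_dist ball frontier_ball dist_commute)

lemma tau_zero_bdry: "zero_bdry \<Omega> \<tau>"
  unfolding zero_bdry_def
proof
  fix p assume p: "p \<in> frontier \<Omega>"
  have "(\<tau> \<longlongrightarrow> \<tau> p) (at p within \<Omega>)" unfolding \<tau>_def[abs_def] by (intro tendsto_intros s_tendsto)
  then show "(\<tau> \<longlongrightarrow> 0) (at p within \<Omega>)" using tau_bdry[OF p] by simp
qed

lemma sum_y2: "(\<Sum>k\<in>Basis. y k x * y k x) = s x"
  by (simp add: s_def power2_eq_square)

lemma sum_one: "(\<Sum>k\<in>(Basis::'a set). delta k k * f) = n * f"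
  by (simp add: delta_def n_def)

text \<open>Uniqueness of the sixth order Dirichlet problem: \<open>a\<close>, \<open>b\<close>, \<open>e\<close> are the differences of \<open>u\<close>, \<open>\<Delta> u\<close>, \<open>\<Delta>\<^sup>2 u\<close>
  and the corresponding functions for the radial solution \<open>\<tau>\<^sup>3 / (48 N)\<close>.\<close>

definition a :: "'a \<Rightarrow> real" where "a x = T [] x - 1 / (48 * N) * (\<tau> x * (\<tau> x)\<^sup>2)"
definition A :: "'a \<Rightarrow> 'a \<Rightarrow> real" where "A k x = T [k] x + 1 / (8 * N) * (y k x * (\<tau> x)\<^sup>2)"
definition b :: "'a \<Rightarrow> real" where "b x = V [] x - 1 / (2 * N) * (\<tau> x * (s x - n / 4 * \<tau> x))"
definition B :: "'a \<Rightarrow> 'a \<Rightarrow> real" where "B k x = V [k] x - 1 / (2 * N) * (y k x * ((n + 2) * \<tau> x - 2 * s x))"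
definition e :: "'a \<Rightarrow> real" where "e x = W [] x - 1 / (2 * N) * (n * (n + 2) * \<tau> x - (4 * n + 8) * s x)"
definition dA :: "'a \<Rightarrow> 'a \<Rightarrow> 'a \<Rightarrow> real" where
  "dA l k x = T [l, k] x + 1 / (8 * N) * (y k x * (2 * (\<tau> x * (- 2 * y l x))) + delta l k * (\<tau> x)\<^sup>2)"
definition dB :: "'a \<Rightarrow> 'a \<Rightarrow> 'a \<Rightarrow> real" where
  "dB l k x = V [l, k] x - 1 / (2 * N) * (y k x * ((n + 2) * (- 2 * y l x) - 2 * (2 * y l x)) + delta l k * ((n + 2) * \<tau> x - 2 * s x))"

lemma a_grad: "grad_bar \<Omega> a A"
proof (rule grad_bar_cong)
  show "grad_bar \<Omega> a (\<lambda>i x. T [i] x - 1 / (48 * N) * (\<tau> x * (2 * (\<tau> x * (- 2 * y i x))) + (- 2 * y i x) * (\<tau> x)\<^sup>2))"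
    unfolding a_def[abs_def] by (intro grad_bar_diff grad_bar_cmult grad_bar_mult grad_bar_power2 tau_grad T_grad) simp
  show "T [i] x - 1 / (48 * N) * (\<tau> x * (2 * (\<tau> x * (- 2 * y i x))) + (- 2 * y i x) * (\<tau> x)\<^sup>2) = A i x" for x i
    using N_pos by (simp add: A_def field_simps power2_eq_square)
qed

lemma A_grad: "k \<in> Basis \<Longrightarrow> grad_bar \<Omega> (A k) (\<lambda>l. dA l k)"
  unfolding A_def[abs_def] dA_def[abs_def]
  by (intro grad_bar_add grad_bar_cmult grad_bar_mult grad_bar_power2 tau_grad T_grad y_grad) simp_all

lemma b_grad: "grad_bar \<Omega> b B"
proof (rule grad_bar_cong)
  show "grad_bar \<Omega> b (\<lambda>i x. V [i] x - 1 / (2 * N) * (\<tau> x * (2 * y i x - n / 4 * (- 2 * y i x)) + (- 2 * y i x) * (s x - n / 4 * \<tau> x)))"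
    unfolding b_def[abs_def] by (intro grad_bar_diff grad_bar_cmult grad_bar_mult s_grad tau_grad V_grad) simp
  show "V [i] x - 1 / (2 * N) * (\<tau> x * (2 * y i x - n / 4 * (- 2 * y i x)) + (- 2 * y i x) * (s x - n / 4 * \<tau> x)) = B i x" for x i
    using N_pos by (simp add: B_def field_simps)
qed

lemma B_grad: "k \<in> Basis \<Longrightarrow> grad_bar \<Omega> (B k) (\<lambda>l. dB l k)"
  unfolding B_def[abs_def] dB_def[abs_def]
  by (intro grad_bar_diff grad_bar_cmult grad_bar_mult s_grad tau_grad V_grad y_grad) simp_all

text \<open>The radial function subtracted from w has the same gradient - y / n, so e is constant.
  Its value is unknown at this stage.\<close>

lemma e_grad: "grad_bar \<Omega> e (\<lambda>l x. 0)"
proof (rule grad_bar_cong)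
  show "grad_bar \<Omega> e (\<lambda>i x. W [i] x - 1 / (2 * N) * (n * (n + 2) * (- 2 * y i x) - (4 * n + 8) * (2 * y i x)))"
    unfolding e_def[abs_def] by (intro grad_bar_diff grad_bar_cmult s_grad tau_grad W_grad) simp
  show "W [i] x - 1 / (2 * N) * (n * (n + 2) * (- 2 * y i x) - (4 * n + 8) * (2 * y i x)) = 0" if "x \<in> \<Omega>" "i \<in> Basis" for x i
    unfolding W1'[OF that] N_def using n_pos by (simp add: divide_simps) (simp add: algebra_simps)
qed

lemma div_A: "(\<Sum>k\<in>Basis. dA k k x) = b x"
proof -
  have "(\<Sum>k\<in>Basis. dA k k x) = (\<Sum>k\<in>Basis. T [k, k] x + 1 / (8 * N) * (- 4 * \<tau> x * (y k x * y k x) + delta k k * (\<tau> x)\<^sup>2))"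
    by (intro sum.cong refl) (simp add: dA_def algebra_simps)
  also have "\<dots> = V [] x + 1 / (8 * N) * (- 4 * \<tau> x * s x + n * (\<tau> x)\<^sup>2)"
    unfolding sum.distrib sum_distrib_left[symmetric] sum_y2 sum_one by (simp add: T_tr)
  also have "\<dots> = b x" using N_pos by (simp add: b_def field_simps power2_eq_square)
  finally show ?thesis .
qed

lemma div_B: "(\<Sum>k\<in>Basis. dB k k x) = e x"
proof -
  have "(\<Sum>k\<in>Basis. dB k k x) = (\<Sum>k\<in>Basis. V [k, k] x - 1 / (2 * N) * (- (2 * n + 8) * (y k x * y k x) + delta k k * ((n + 2) * \<tau> x - 2 * s x)))"
    by (intro sum.cong refl) (simp add: dB_def algebra_simps)
  also have "\<dots> = W [] x - 1 / (2 * N) * (- (2 * n + 8) * s x + n * ((n + 2) * \<tau> x - 2 * s x))"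
    unfolding sum_subtractf sum.distrib sum_distrib_left[symmetric] sum_y2 sum_one by (simp add: V_tr)
  also have "\<dots> = e x" using N_pos by (simp add: e_def algebra_simps)
  finally show ?thesis .
qed

lemma zero_bdry_ab: "zero_bdry \<Omega> a" "zero_bdry \<Omega> (A k)" "zero_bdry \<Omega> b"
proof -
  have t: "C0bar \<Omega> \<tau>" "C0bar \<Omega> s" "C0bar \<Omega> (y k)" for k
    using C1barD(1)[OF grad_barD(1)[OF tau_grad]] C1barD(1)[OF grad_barD(1)[OF s_grad]]
    by (auto simp: y_def[abs_def] intro!: C0bar_diff C0bar_inner C0bar_const)
  show "zero_bdry \<Omega> a" unfolding a_def[abs_def]
    by (intro zero_bdry_diff T0_zero_bdry zero_bdry_mult2[OF opn C0bar_const] zero_bdry_mult[OF opn tau_zero_bdry] C0bar_power t)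
  show "zero_bdry \<Omega> (A k)" unfolding A_def[abs_def] power2_eq_square
    by (intro zero_bdry_add T1_zero_bdry zero_bdry_mult2[OF opn C0bar_const] zero_bdry_mult2[OF opn t(3)]
        zero_bdry_mult[OF opn tau_zero_bdry] t)
  show "zero_bdry \<Omega> b" unfolding b_def[abs_def]
    by (intro zero_bdry_diff V0_zero_bdry zero_bdry_mult2[OF opn C0bar_const] zero_bdry_mult[OF opn tau_zero_bdry]
        C0bar_diff C0bar_mult C0bar_const t)
qed

lemma gradient_zero:
  assumes F: "\<And>k. k \<in> Basis \<Longrightarrow> C0bar \<Omega> (F k)" and i: "integral \<Omega> (\<lambda>x. \<Sum>k\<in>Basis. (F k x)\<^sup>2) = 0"
    and x: "x \<in> \<Omega>" and k: "k \<in> Basis"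
  shows "F k x = 0"
proof -
  have "(\<Sum>k\<in>Basis. (F k x)\<^sup>2) = 0"
    by (rule integral_nonneg_zero_imp[OF opn bdd C0bar_sum[OF C0bar_power[OF F]] _ _ x]) (use i in \<open>simp_all add: sum_nonneg\<close>)
  then have "(F k x)\<^sup>2 = 0" using k by (subst (asm) sum_nonneg_eq_0_iff) auto
  then show ?thesis by simp
qed

text \<open>The field b \<nabla>b - e \<nabla>a vanishes on the boundary. As e is constant,
  \<Delta>b = e and \<Delta>a = b, its divergence is b e + |\<nabla>b|^2 - b e, so the unknown
  constant drops out.\<close>

lemma B_zero:
  assumes x: "x \<in> \<Omega>" "k \<in> Basis"
  shows "B k x = 0"
proof (rule gradient_zero[where F = B, OF _ _ x])
  show "C0bar \<Omega> (B k)" if "k \<in> Basis" for k by (rule C1barD(1)[OF grad_barD(1)[OF B_grad[OF that]]])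
  show "integral \<Omega> (\<lambda>x. \<Sum>k\<in>Basis. (B k x)\<^sup>2) = 0"
  proof (rule divergence_zero_grad[OF opn bdd])
    show "grad_bar \<Omega> (\<lambda>x. b x * B k x - A k x * e x) (\<lambda>l x. (b x * dB l k x + B l x * B k x) - (A k x * 0 + dA l k x * e x))"
      if "k \<in> Basis" for k by (intro grad_bar_diff grad_bar_mult b_grad B_grad A_grad e_grad that)
    show "zero_bdry \<Omega> (\<lambda>x. b x * B k x - A k x * e x)" if "k \<in> Basis" for k
      by (intro zero_bdry_diff zero_bdry_mult[OF opn] zero_bdry_ab C1barD(1)[OF grad_barD(1)[OF B_grad[OF that]]] C1barD(1)[OF grad_barD(1)[OF e_grad]])
    fix x
    have "(\<Sum>k\<in>Basis. (b x * dB k k x + B k x * B k x) - (A k x * 0 + dA k k x * e x))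
      = b x * (\<Sum>k\<in>Basis. dB k k x) + (\<Sum>k\<in>Basis. (B k x)\<^sup>2) - (\<Sum>k\<in>Basis. dA k k x) * e x"
      by (simp add: sum.distrib sum_subtractf sum_distrib_left sum_distrib_right power2_eq_square)
    then show "(\<Sum>k\<in>Basis. (B k x)\<^sup>2) = (\<Sum>k\<in>Basis. (b x * dB k k x + B k x * B k x) - (A k x * 0 + dA k k x * e x))"
      unfolding div_A div_B by simp
  qed
qed

lemma b_zero: "x \<in> \<Omega> \<Longrightarrow> b x = 0"
  by (rule zero_of_zero_gradient[OF opn conn bdd grad_barD(1)[OF b_grad] zero_bdry_ab(3)])
    (simp_all add: grad_barD(2)[OF b_grad] B_zero)

lemma A_zero:
  assumes x: "x \<in> \<Omega>" "k \<in> Basis"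
  shows "A k x = 0"
proof (rule gradient_zero[where F = A, OF _ _ x])
  show "C0bar \<Omega> (A k)" if "k \<in> Basis" for k by (rule C1barD(1)[OF grad_barD(1)[OF A_grad[OF that]]])
  show "integral \<Omega> (\<lambda>x. \<Sum>k\<in>Basis. (A k x)\<^sup>2) = 0"
  proof (rule divergence_zero_grad[OF opn bdd])
    show "grad_bar \<Omega> (\<lambda>x. a x * A k x) (\<lambda>l x. a x * dA l k x + A l x * A k x)"
      if "k \<in> Basis" for k by (intro grad_bar_mult a_grad A_grad that)
    show "zero_bdry \<Omega> (\<lambda>x. a x * A k x)" if "k \<in> Basis" for k
      by (intro zero_bdry_mult[OF opn] zero_bdry_ab C1barD(1)[OF grad_barD(1)[OF A_grad[OF that]]])
    show "(\<Sum>k\<in>Basis. (A k x)\<^sup>2) = (\<Sum>k\<in>Basis. a x * dA k k x + A k x * A k x)" if "x \<in> \<Omega>" for x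
      using div_A[of x] b_zero[OF that] by (simp add: sum.distrib power2_eq_square flip: sum_distrib_left)
  qed
qed

lemma a_zero: "x \<in> \<Omega> \<Longrightarrow> a x = 0"
  by (rule zero_of_zero_gradient[OF opn conn bdd grad_barD(1)[OF a_grad] zero_bdry_ab(1)])
    (simp_all add: grad_barD(2)[OF a_grad] A_zero)

lemma u_eq:
  assumes x: "x \<in> closure \<Omega>"
  shows "u x = (R\<^sup>2 - (dist x x0)\<^sup>2) ^ 3 / (48 * N)"
proof (cases "x \<in> \<Omega>")
  case True
  then have "u x = 1 / (48 * N) * (\<tau> x * (\<tau> x)\<^sup>2)" using a_zero[OF True] by (simp add: a_def T_def)
  then show ?thesis by (simp add: \<tau>_def s_dist power3_eq_cube power2_eq_square)
next
  case False
  then have p: "x \<in> frontier \<Omega>" using x opn by (auto simp: frontier_def interior_open)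
  then show ?thesis using bc0 tau_bdry[OF p] by (simp add: \<tau>_def s_dist)
qed

text \<open>On the frontier \<tau> = 0 and s = R^2, so B = 0 means \<nabla>v = - (R^2 / N) y in the
  limit, and its norm R^3 / N must be |c|.\<close>

lemma R_eq: "R ^ 3 = \<bar>c\<bar> * N"
proof -
  have "frontier \<Omega> \<noteq> {}" using ne bdd frontier_eq_empty not_bounded_UNIV by blast
  then obtain p where p: "p \<in> frontier \<Omega>" by blast
  let ?k = "\<lambda>x. 1 / (2 * N) * ((n + 2) * (R\<^sup>2 - s x) - 2 * s x)"
  have V1: "V [j] x = y j x * ?k x" if "x \<in> \<Omega>" "j \<in> Basis" for x j
    using B_zero[OF that] by (simp add: B_def \<tau>_def)
  have "((\<lambda>x. s x * (?k x)\<^sup>2) \<longlongrightarrow> s p * (?k p)\<^sup>2) (at p within \<Omega>)"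
    by (intro tendsto_intros s_tendsto)
  moreover have "((\<lambda>x. s x * (?k x)\<^sup>2) \<longlongrightarrow> c\<^sup>2) (at p within \<Omega>)"
    by (subst tendsto_cong_within[of \<Omega> _ GV]) (use GV_eq[OF _ V1] GV_bdry[OF p] in auto)
  ultimately have "s p * (?k p)\<^sup>2 = c\<^sup>2" by (rule tendsto_unique[OF frontier_within_nontrivial[OF opn p]])
  moreover have sp: "s p = R\<^sup>2" using tau_bdry[OF p] by (simp add: \<tau>_def)
  ultimately have "R\<^sup>2 * (R\<^sup>2 / N)\<^sup>2 = c\<^sup>2" using N_pos by simp
  then have "(R ^ 3)\<^sup>2 = (\<bar>c\<bar> * N)\<^sup>2"
    using N_pos by (simp add: power2_eq_square power3_eq_cube field_simps)
  then show ?thesis by (rule power2_eq_imp_eq) (use R N_pos in auto)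
qed

lemma conclusion:
  "\<exists>x0. \<Omega> = ball x0 (root 3 (\<bar>c\<bar> * real DIM('a) * (real DIM('a) + 2) * (real DIM('a) + 4))) \<and>
    (\<forall>x\<in>closure \<Omega>.
      (let N = real DIM('a) * (real DIM('a) + 2) * (real DIM('a) + 4); \<rho> = dist x x0 in
       u x = - (\<rho> ^ 6) / (48 * N) + root 3 (c\<^sup>2 / N) * \<rho> ^ 4 / 16
             - root 3 (c ^ 4 * N) * \<rho>\<^sup>2 / 16 + c\<^sup>2 * N / 48))"
proof (intro exI[of _ x0] conjI ballI)
  have Neq: "real DIM('a) * (real DIM('a) + 2) * (real DIM('a) + 4) = N" by (simp add: N_def n_def)
  \<comment> \<open>This relation reduces the radicals of the claim to powers of R: the cube roots
    become R^2 / N and R^4 / N, and the constant term R^6 / (48 N).\<close>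
  have c6: "c\<^sup>2 * N\<^sup>2 = R ^ 6"
  proof -
    have "R ^ 6 = (R ^ 3)\<^sup>2" by (simp flip: power_mult)
    then show ?thesis unfolding R_eq by (simp add: power_mult_distrib)
  qed
  have "root 3 (\<bar>c\<bar> * N) = R" unfolding R_eq[symmetric] using R by (simp add: real_root_power_cancel)
  then show "\<Omega> = ball x0 (root 3 (\<bar>c\<bar> * real DIM('a) * (real DIM('a) + 2) * (real DIM('a) + 4)))"
    using ball Neq by (simp add: mult.assoc)
  have r1: "root 3 (c\<^sup>2 / N) = R\<^sup>2 / N"
  proof (rule real_root_pos_unique)
    have "(R\<^sup>2 / N) ^ 3 = R ^ 6 / N ^ 3" by (simp add: power_divide flip: power_mult)
    also have "\<dots> = c\<^sup>2 / N" unfolding c6[symmetric] using N_pos by (simp add: eval_nat_numeral)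
    finally show "(R\<^sup>2 / N) ^ 3 = c\<^sup>2 / N" .
  qed (use N_pos in auto)
  have r2: "root 3 (c ^ 4 * N) = R ^ 4 / N"
  proof (rule real_root_pos_unique)
    have "(R ^ 4 / N) ^ 3 = (R ^ 6)\<^sup>2 / N ^ 3" by (simp add: power_divide flip: power_mult)
    also have "\<dots> = c ^ 4 * N" unfolding c6[symmetric] using N_pos by (simp add: power_mult_distrib eval_nat_numeral)
    finally show "(R ^ 4 / N) ^ 3 = c ^ 4 * N" .
  qed (use N_pos in auto)
  have r3: "c\<^sup>2 * N / 48 = R ^ 6 / (48 * N)" unfolding c6[symmetric] using N_pos by (simp add: power2_eq_square)
  fix x assume x: "x \<in> closure \<Omega>"
  define \<rho> where "\<rho> = dist x x0"
  have "u x = (R\<^sup>2 - \<rho>\<^sup>2) ^ 3 / (48 * N)" using u_eq[OF x] by (simp add: \<rho>_def)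
  also have "(R\<^sup>2 - \<rho>\<^sup>2) ^ 3 = - (\<rho> ^ 6) + 3 * (R\<^sup>2 * \<rho> ^ 4) - 3 * (R ^ 4 * \<rho>\<^sup>2) + R ^ 6"
    by (simp add: eval_nat_numeral algebra_simps)
  also have "(- (\<rho> ^ 6) + 3 * (R\<^sup>2 * \<rho> ^ 4) - 3 * (R ^ 4 * \<rho>\<^sup>2) + R ^ 6) / (48 * N)
    = - (\<rho> ^ 6) / (48 * N) + R\<^sup>2 / N * \<rho> ^ 4 / 16 - R ^ 4 / N * \<rho>\<^sup>2 / 16 + R ^ 6 / (48 * N)"
    using N_pos by (simp add: field_simps)
  finally show "let N = real DIM('a) * (real DIM('a) + 2) * (real DIM('a) + 4); \<rho> = dist x x0 in
       u x = - (\<rho> ^ 6) / (48 * N) + root 3 (c\<^sup>2 / N) * \<rho> ^ 4 / 16 - root 3 (c ^ 4 * N) * \<rho>\<^sup>2 / 16 + c\<^sup>2 * N / 48"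
    unfolding Neq Let_def r1 r2 r3 \<rho>_def .
qed

end

theorem theorem2:
  fixes \<Omega> :: "'a::euclidean_space set" and u :: "'a \<Rightarrow> real" and c e :: real
  assumes n2: "DIM('a) \<ge> 2"
    and dom: "open \<Omega>" "connected \<Omega>" "bounded \<Omega>" "\<Omega> \<noteq> {}"
    and eps: "0 < e" "e < 1"
    and bdry: "Ck_eps_boundary 6 e \<Omega>"
    and reg: "Ck_closure 6 \<Omega> u"
    and pde: "\<forall>x\<in>\<Omega>. laplacian (laplacian (laplacian u)) x = -1"
    and bc0: "\<forall>p\<in>frontier \<Omega>. u p = 0"
    and bc1: "\<forall>p\<in>frontier \<Omega>. normal_deriv \<Omega> u p = 0"
    and bc2: "\<forall>p\<in>frontier \<Omega>. bval \<Omega> (laplacian u) p = 0"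
    and bc3: "\<forall>p\<in>frontier \<Omega>. normal_deriv \<Omega> (laplacian u) p = c"
    and extra: "DIM('a) \<ge> 3 \<longrightarrow> (\<exists>\<gamma>. torsion_function \<Omega> \<gamma> \<and>
        integral \<Omega> (\<lambda>x. (laplacian (laplacian u) x)\<^sup>2 * \<gamma> x)
          \<le> 2 * (real DIM('a) + 2) * c\<^sup>2 * measure lebesgue \<Omega> / (real DIM('a) + 6))"
  shows "\<exists>x0. \<Omega> = ball x0 (root 3 (\<bar>c\<bar> * real DIM('a) * (real DIM('a) + 2) * (real DIM('a) + 4))) \<and>
    (\<forall>x\<in>closure \<Omega>.
      (let N = real DIM('a) * (real DIM('a) + 2) * (real DIM('a) + 4); \<rho> = dist x x0 in
       u x = - (\<rho> ^ 6) / (48 * N) + root 3 (c\<^sup>2 / N) * \<rho> ^ 4 / 16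
             - root 3 (c ^ 4 * N) * \<rho>\<^sup>2 / 16 + c\<^sup>2 * N / 48))"
proof -
  interpret O: overdetermined \<Omega> u c
    using n2 dom reg pde bc0 bc1 bc2 bc3 bdry unfolding Ck_eps_boundary_def by unfold_locales blast+
  \<comment> \<open>The left side is 2 |H|^2. In dimension 2 the factor \<kappa> is zero, so there
    it is E itself that has to vanish.\<close>
  have E0: "O.E x + O.\<kappa> * (O.W [] x)\<^sup>2 = 0" if x: "x \<in> \<Omega>" for x
  proof (cases "DIM('a) \<ge> 3")
    case True
    then obtain \<gamma> where "torsion_function \<Omega> \<gamma>"
      "integral \<Omega> (\<lambda>x. (laplacian (laplacian u) x)\<^sup>2 * \<gamma> x) \<le> 2 * (O.n + 2) * c\<^sup>2 * measure lebesgue \<Omega> / (O.n + 6)"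
      using extra unfolding O.n_def by blast
    then show ?thesis using O.E_zero_torsion x by blast
  next
    case False
    then have "O.n = 2" using n2 by (simp add: O.n_def)
    then have "O.\<kappa> = 0" by (simp add: O.\<kappa>_def)
    then show ?thesis using O.E_zero_2d[OF _ x] by simp
  qed
  interpret rigid \<Omega> u c
    using O.H_zero_of_E_zero[OF E0] by unfold_locales
  obtain x0 where "\<And>x j. x \<in> \<Omega> \<Longrightarrow> j \<in> Basis \<Longrightarrow> O.W [j] x = - ((x \<bullet> j) - (x0 \<bullet> j)) / O.n"
    using center_exists by blast
  then interpret centered \<Omega> u c x0 by unfold_locales
  obtain R where R: "0 < R" "frontier \<Omega> \<subseteq> sphere x0 R" using frontier_sphere by blast
  then interpret on_ball \<Omega> u c x0 R
    using bounded_open_frontier_in_sphere[OF n2 dom(1,3,4) R(2,1)] by unfold_locales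
  show ?thesis by (rule conclusion)
qed

end
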